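(* The path geometry of para-CR Lewy curves in dimension three determines the underlying para-CR structure up to the sign of the almost para-complex structure. That is: let $(N,\mathcal D_1,\mathcal D_2)$ and $(N',\mathcal D_1',\mathcal D_2')$ be 3-dimensional para-CR structures and let $f:N\to N'$ be a (local) diffeomorphism mapping the path geometry of Lewy curves of the first to the path geometry of Lewy curves of the second. Then, locally, either $f_*\mathcal D_1=\mathcal D_1'$ and $f_*\mathcal D_2=\mathcal D_2'$, or $f_*\mathcal D_1=\mathcal D_2'$ and $f_*\mathcal D_2=\mathcal D_1'$.
   Context: All statements are local. A 3-dimensional para-CR structure $(N,\mathcal D_1,\mathcal D_2)$ is a 3-manifold with a contact distribution $\mathcal C=\mathcal D_1\oplus\mathcal D_2$ split into line bundles. Its almost para-complex structure is $K:\mathcal C\to\mathcal C$, $K^2=\mathrm{Id}$, with $\pm1$-eigenspaces $\mathcal D_1$, $\mathcal D_2$; changing the sign of $K$ interchanges $\mathcal D_1$ and $\mathcal D_2$. Let $M_1=N/\mathcal D_2$, $M_2=N/\mathcal D_1$ be the local leaf spaces with projections $\pi_i:N\to M_i$, and for $x\in M_1,y\in M_2$ put $H_x=\pi_2(\pi_1^{-1}(x))\subset M_2$, $H_y=\pi_1(\pi_2^{-1}(y))\subset M_1$. $(x,y)$ is incident if $x\in H_y$. The Lewy curves are the curves $\gamma_{xy}=\pi_2^{-1}(H_x)\cap\pi_1^{-1}(H_y)\subset N$ for non-incident $(x,y)$. Their tangential lifts foliate an open subset $Q\subset\mathbb P(TN\setminus\mathcal C)$ and define a path geometry $(Q,\mathcal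 V,\mathcal X)$ on $N$, where $\mathcal V$ is the vertical bundle of $Q\to N$ and $\mathcal X$ is the line field tangent to the lifted curves. A diffeomorphism $f$ maps one path geometry to another if its lift to projectivized tangent bundles maps $(\mathcal X,\mathcal V)$ to $(\mathcal X',\mathcal V')$, i.e. $f$ maps paths to paths. *)

theory Defs
  imports "HOL-Analysis.Analysis"
begin

text \<open>All notions are local, so a 3-manifold is an open subset \<open>N\<close> of \<open>\<real>\<^sup>3\<close>, and a local leaf
  space is an open subset of \<open>\<real>\<^sup>2\<close>. Distributions assign to a point a linear subspace of
  the ambient vector space.\<close>

section \<open>Smooth maps, line fields, tangent vectors\<close>

text \<open>\<open>C\<^sup>k\<close> and \<open>C\<^sup>\<infinity>\<close> maps; only meant for open sets.\<close>

primrec Ck_on :: "nat \<Rightarrow> 'a::real_normed_vector set \<Rightarrow> ('a \<Rightarrow> 'b::real_normed_vector) \<Rightarrow> bool" where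
  "Ck_on 0 S f \<longleftrightarrow> continuous_on S f"
| "Ck_on (Suc k) S f \<longleftrightarrow>
     (\<forall>x\<in>S. f differentiable (at x)) \<and> (\<forall>v. Ck_on k S (\<lambda>x. frechet_derivative f (at x) v))"

definition smooth_on :: "'a::real_normed_vector set \<Rightarrow> ('a \<Rightarrow> 'b::real_normed_vector) \<Rightarrow> bool" where
  "smooth_on S f \<longleftrightarrow> (\<forall>k. Ck_on k S f)"

text \<open>A rank-one subbundle along \<open>S\<close> of the trivial bundle; \<open>S\<close> may be a submanifold, in which case
  the local spanning fields are restrictions of smooth fields defined on an ambient open set.\<close>

definition smooth_line_field :: "'a::euclidean_space set \<Rightarrow> ('a \<Rightarrow> 'a set) \<Rightarrow> bool" where
  "smooth_line_field S D \<longleftrightarrow>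
     (\<forall>p\<in>S. \<exists>W \<xi>. open W \<and> p \<in> W \<and> smooth_on W \<xi> \<and>
        (\<forall>q\<in>S \<inter> W. \<xi> q \<noteq> 0 \<and> D q = span {\<xi> q}))"

definition lie_bracket :: "('a::real_normed_vector \<Rightarrow> 'a) \<Rightarrow> ('a \<Rightarrow> 'a) \<Rightarrow> 'a \<Rightarrow> 'a" where
  "lie_bracket X Y q =
     frechet_derivative Y (at q) (X q) - frechet_derivative X (at q) (Y q)"

text \<open>\<open>c\<close> is a smooth curve in \<open>S\<close>, parametrized near \<open>0\<close>, with \<open>c 0 = q\<close> and velocity \<open>w\<close> there.\<close>

definition smooth_curve_in :: "'a::real_normed_vector set \<Rightarrow> (real \<Rightarrow> 'a) \<Rightarrow> 'a \<Rightarrow> 'a \<Rightarrow> bool" where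
  "smooth_curve_in S c q w \<longleftrightarrow>
     (\<exists>e>0. smooth_on {-e<..<e} c \<and> c ` {-e<..<e} \<subseteq> S) \<and>
     c 0 = q \<and> (c has_vector_derivative w) (at 0)"

definition tangent_space :: "'a::real_normed_vector set \<Rightarrow> 'a \<Rightarrow> 'a set" where
  "tangent_space S q = {w. \<exists>c. smooth_curve_in S c q w}"

text \<open>Image under the differential at \<open>q\<close> of a map \<open>F\<close>, given only on \<open>S\<close>, of a set \<open>W\<close> of vectors
  tangent to \<open>S\<close>.\<close>

definition push_tangent ::
  "'a::real_normed_vector set \<Rightarrow> ('a \<Rightarrow> 'b::real_normed_vector) \<Rightarrow> 'a \<Rightarrow> 'a set \<Rightarrow> 'b set" where
  "push_tangent S F q W =
     {w'. \<exists>c. \<exists>w\<in>W. smooth_curve_in S c q w \<and> ((F \<circ> c) has_vector_derivative w') (at 0)}"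

section \<open>Para-CR structures\<close>

definition dist_sum :: "('a \<Rightarrow> 'b::real_vector set) \<Rightarrow> ('a \<Rightarrow> 'b set) \<Rightarrow> 'a \<Rightarrow> 'b set" where
  "dist_sum D1 D2 p = {u + w | u w. u \<in> D1 p \<and> w \<in> D2 p}"

text \<open>Contact means that the Levi bracket \<open>\<Lambda>\<^sup>2C \<rightarrow> TN/C\<close> is nondegenerate. As the ambient dimension is
  three, the spanning condition says that \<open>X\<close>, \<open>Y\<close> are independent with bracket transverse to \<open>C\<close>.\<close>

definition contact_distribution :: "(real^3) set \<Rightarrow> (real^3 \<Rightarrow> (real^3) set) \<Rightarrow> bool" where
  "contact_distribution N C \<longleftrightarrow>
     (\<forall>p\<in>N. \<exists>U X Y. open U \<and> p \<in> U \<and> U \<subseteq> N \<and> smooth_on U X \<and> smooth_on U Y \<and>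
        (\<forall>q\<in>U. C q = span {X q, Y q} \<and> span {X q, Y q, lie_bracket X Y q} = UNIV))"

definition para_CR ::
  "(real^3) set \<Rightarrow> (real^3 \<Rightarrow> (real^3) set) \<Rightarrow> (real^3 \<Rightarrow> (real^3) set) \<Rightarrow> bool" where
  "para_CR N D1 D2 \<longleftrightarrow>
     open N \<and> smooth_line_field N D1 \<and> smooth_line_field N D2 \<and>
     (\<forall>p\<in>N. D1 p \<inter> D2 p = {0}) \<and> contact_distribution N (dist_sum D1 D2)"

text \<open>\<open>\<pi>\<close> realizes the leaf space \<open>N/D\<close> as the set \<open>\<pi> ` N\<close> in the plane: it is a submersion whose
  (connected) fibres are the leaves of \<open>D\<close>.\<close>

definition leaf_projection ::
  "(real^3) set \<Rightarrow> (real^3 \<Rightarrow> (real^3) set) \<Rightarrow> (real^3 \<Rightarrow> real^2) \<Rightarrow> bool" where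
  "leaf_projection N D \<pi> \<longleftrightarrow>
     smooth_on N \<pi> \<and>
     (\<forall>p\<in>N. surj (frechet_derivative \<pi> (at p)) \<and>
            {v. frechet_derivative \<pi> (at p) v = 0} = D p \<and>
            connected {q\<in>N. \<pi> q = \<pi> p})"

section \<open>Lewy curves\<close>

definition H1 ::
  "(real^3) set \<Rightarrow> (real^3 \<Rightarrow> real^2) \<Rightarrow> (real^3 \<Rightarrow> real^2) \<Rightarrow> real^2 \<Rightarrow> (real^2) set" where
  "H1 N \<pi>1 \<pi>2 x = \<pi>2 ` {p\<in>N. \<pi>1 p = x}"

definition H2 ::
  "(real^3) set \<Rightarrow> (real^3 \<Rightarrow> real^2) \<Rightarrow> (real^3 \<Rightarrow> real^2) \<Rightarrow> real^2 \<Rightarrow> (real^2) set" where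
  "H2 N \<pi>1 \<pi>2 y = \<pi>1 ` {p\<in>N. \<pi>2 p = y}"

definition incident ::
  "(real^3) set \<Rightarrow> (real^3 \<Rightarrow> real^2) \<Rightarrow> (real^3 \<Rightarrow> real^2) \<Rightarrow> real^2 \<Rightarrow> real^2 \<Rightarrow> bool" where
  "incident N \<pi>1 \<pi>2 x y \<longleftrightarrow> x \<in> H2 N \<pi>1 \<pi>2 y"

definition lewy_curve ::
  "(real^3) set \<Rightarrow> (real^3 \<Rightarrow> real^2) \<Rightarrow> (real^3 \<Rightarrow> real^2) \<Rightarrow> real^2 \<Rightarrow> real^2 \<Rightarrow> (real^3) set" where
  "lewy_curve N \<pi>1 \<pi>2 x y = {p\<in>N. \<pi>2 p \<in> H1 N \<pi>1 \<pi>2 x \<and> \<pi>1 p \<in> H2 N \<pi>1 \<pi>2 y}"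

definition lewy_curves ::
  "(real^3) set \<Rightarrow> (real^3 \<Rightarrow> real^2) \<Rightarrow> (real^3 \<Rightarrow> real^2) \<Rightarrow> (real^3) set set" where
  "lewy_curves N \<pi>1 \<pi>2 =
     {lewy_curve N \<pi>1 \<pi>2 x y | x y. x \<in> \<pi>1 ` N \<and> y \<in> \<pi>2 ` N \<and> \<not> incident N \<pi>1 \<pi>2 x y}"

section \<open>The projectivized tangent bundle and path geometries\<close>

text \<open>The projective plane is realized as the submanifold of rank-one orthogonal projectors in
  \<open>\<real>\<^sup>3\<^sup>\<times>\<^sup>3\<close>: the line spanned by \<open>v\<close> is the matrix \<open>v v\<^sup>T / |v|\<^sup>2\<close>. Thus \<open>\<P>(TN)\<close> is a submanifold of
  \<open>\<real>\<^sup>3 \<times> \<real>\<^sup>3\<^sup>\<times>\<^sup>3\<close>.\<close>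

type_synonym ptm = "(real^3) \<times> (real^3^3)"

definition line_of :: "real^3 \<Rightarrow> real^3^3" where
  "line_of v = (\<chi> i j. v $ i * v $ j / (v \<bullet> v))"

text \<open>\<open>\<P>(TN - C)\<close>; for \<open>C = {0}\<close> this would be \<open>\<P>(TN)\<close>.\<close>

definition PT_minus :: "(real^3) set \<Rightarrow> (real^3 \<Rightarrow> (real^3) set) \<Rightarrow> ptm set" where
  "PT_minus N C = {(p, line_of v) | p v. p \<in> N \<and> v \<notin> C p}"

definition tangential_lift :: "(real^3) set \<Rightarrow> ptm set" where
  "tangential_lift \<gamma> = {(p, line_of v) | p v. p \<in> \<gamma> \<and> v \<in> tangent_space \<gamma> p \<and> v \<noteq> 0}"

text \<open>The data \<open>(Q, \<V>, \<X>)\<close> determined by a family \<open>\<Gamma>\<close> of paths.\<close>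

definition path_Q :: "(real^3) set set \<Rightarrow> ptm set" where
  "path_Q \<Gamma> = (\<Union>\<gamma>\<in>\<Gamma>. tangential_lift \<gamma>)"

definition path_V :: "(real^3) set set \<Rightarrow> ptm \<Rightarrow> ptm set" where
  "path_V \<Gamma> q = {w \<in> tangent_space (path_Q \<Gamma>) q. fst w = 0}"

definition path_X :: "(real^3) set set \<Rightarrow> ptm \<Rightarrow> ptm set" where
  "path_X \<Gamma> q = (\<Union>\<gamma>\<in>{\<gamma>\<in>\<Gamma>. q \<in> tangential_lift \<gamma>}. tangent_space (tangential_lift \<gamma>) q)"

text \<open>The lifts of the paths foliate an open subset of \<open>\<P>(TN - C)\<close>: since \<^const>\<open>path_X\<close> collects the
  tangent lines of all lifts through a point, being a smooth line field means that the lifts are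
  integral curves of one and the same line field. For Lewy curves this is automatic once \<open>N\<close> is small;
  on a large \<open>N\<close> conjugate points may occur, so it is part of the locality assumptions there.\<close>

definition lifts_foliate :: "(real^3) set \<Rightarrow> (real^3 \<Rightarrow> (real^3) set) \<Rightarrow> (real^3) set set \<Rightarrow> bool" where
  "lifts_foliate N C \<Gamma> \<longleftrightarrow>
     openin (top_of_set (PT_minus N C)) (path_Q \<Gamma>) \<and> smooth_line_field (path_Q \<Gamma>) (path_X \<Gamma>)"

definition local_diffeo :: "(real^3) set \<Rightarrow> (real^3) set \<Rightarrow> (real^3 \<Rightarrow> real^3) \<Rightarrow> bool" where
  "local_diffeo N N' f \<longleftrightarrow>
     smooth_on N f \<and> f ` N \<subseteq> N' \<and> (\<forall>p\<in>N. bij (frechet_derivative f (at p)))"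

text \<open>The choice of the spanning vector \<open>u\<close> does not matter, as it is unique up to a nonzero factor.\<close>

definition PT_map :: "(real^3 \<Rightarrow> real^3) \<Rightarrow> ptm \<Rightarrow> ptm" where
  "PT_map f = (\<lambda>(p, L). (f p,
     line_of (frechet_derivative f (at p) (SOME u. u \<noteq> 0 \<and> line_of u = L))))"

definition maps_path_geometry ::
  "(real^3 \<Rightarrow> real^3) \<Rightarrow> (real^3) set set \<Rightarrow> (real^3) set set \<Rightarrow> bool" where
  "maps_path_geometry f \<Gamma> \<Gamma>' \<longleftrightarrow>
     (\<forall>q\<in>path_Q \<Gamma>. PT_map f q \<in> path_Q \<Gamma>' \<and>
        push_tangent (path_Q \<Gamma>) (PT_map f) q (path_X \<Gamma> q) = path_X \<Gamma>' (PT_map f q) \<and>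
        push_tangent (path_Q \<Gamma>) (PT_map f) q (path_V \<Gamma> q) = path_V \<Gamma>' (PT_map f q))"

definition pushes_to ::
  "(real^3) set \<Rightarrow> (real^3 \<Rightarrow> real^3) \<Rightarrow> (real^3 \<Rightarrow> (real^3) set) \<Rightarrow> (real^3 \<Rightarrow> (real^3) set) \<Rightarrow> bool" where
  "pushes_to U f D D' \<longleftrightarrow> (\<forall>q\<in>U. frechet_derivative f (at q) ` D q = D' (f q))"

end

theory Submission
  imports Defs
begin

text \<open>Fix a Lewy curve through \<open>p\<close>. Its projection to \<open>M1\<close> lies in a path \<open>H2\<close> of a point \<open>y\<close>, so, modulo
  \<open>D2\<close> and the tangent, its acceleration is the curvature of that path times the square of the
  velocity. As \<open>f\<close> preserves Lewy curves, the images under \<open>\<pi>1' \<circ> f\<close> of the curves at \<open>p\<close> tangent to a plane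
  through \<open>K = df\<inverse>(D2')\<close> therefore all have the same normalized curvature, wherever this plane avoids
  special positions. If \<open>K\<close> were neither \<open>D1\<close> nor \<open>D2\<close>, then along a suitable plane containing \<open>K\<close> the
  directions could be moved towards \<open>C\<close>, where the acceleration of the Lewy curves tends to infinity in the
  direction of \<open>D2\<close>, which \<open>d(\<pi>1' \<circ> f)\<close> does not annihilate modulo that plane: a contradiction. So \<open>K\<close> is
  \<open>D1\<close> or \<open>D2\<close>; exchanging \<open>\<pi>1'\<close> and \<open>\<pi>2'\<close> gives the same for \<open>df\<inverse>(D1')\<close>.

  Two points need care when \<open>N\<close> is not small. Only nonincident pairs define Lewy curves, but the directions
  that arise from such pairs are dense. And the paths may return to a point, but countably many
  branches suffice, so for generic directions a path is locally one smooth branch up to accumulation.\<close>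

section \<open>Calculus of smooth maps\<close>

text \<open>Equality of the normalized curvatures cannot be read off at every direction: an image
  path may have several branches, and only near regular directions is the branch known. So the
  derivative of the curvature along the pencil of directions is shown to vanish at regular
  directions, continuity extends this to all admissible ones, and integration comes last. All of
  this happens on 2-jets: the line field \<open>path_X\<close> is continuous and fixes the
  acceleration of a path modulo its velocity, so limits of Lewy jets can be compared with Lewy jets.
  The blow-up has a simple source. The acceleration solves two linear equations, one for each of the
  two paths that define the curve. Their determinant vanishes to first order in the offset \<rho> of
  an auxiliary point, with the contact constant as coefficient up to sign, while the right-hand
  sides keep a difference proportional to the same constant. The constant cancels, and \<rho> times
  the acceleration tends to twice the \<open>D2\<close> part of the limiting direction.\<close>

abbreviation dir :: "('a::real_normed_vector \<Rightarrow> 'b::real_normed_vector) \<Rightarrow> 'a \<Rightarrow> 'a \<Rightarrow> 'b" where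
  "dir f x v \<equiv> frechet_derivative f (at x) v"

lemma Ck_on_subset: "Ck_on k S f \<Longrightarrow> T \<subseteq> S \<Longrightarrow> Ck_on k T f"
  by (induction k arbitrary: f) (auto intro: continuous_on_subset)

lemma Ck_on_cong:
  assumes "Ck_on k S f" "open S" "\<And>x. x \<in> S \<Longrightarrow> f x = g x"
  shows "Ck_on k S g"
  using assms
proof (induction k arbitrary: f g)
  case 0
  then show ?case by (simp cong: continuous_on_cong)
next
  case (Suc k)
  have eq: "frechet_derivative f (at x) = frechet_derivative g (at x)" if "x \<in> S" for x
    using Suc.prems that by (intro frechet_derivative_transform_within_open) auto
  have "g differentiable at x" if "x \<in> S" for x
  proof -
    have "f differentiable at x"
      using Suc.prems that by auto
    then obtain f' where "(f has_derivative f') (at x)"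
      by (auto simp: differentiable_def)
    then have "(g has_derivative f') (at x)"
      using Suc.prems that by (intro has_derivative_transform_within_open[of f f' x UNIV S g]) auto
    then show ?thesis
      by (auto simp: differentiable_def)
  qed
  moreover have "Ck_on k S (\<lambda>x. dir g x v)" for v
  proof (rule Suc.IH)
    show "Ck_on k S (\<lambda>x. dir f x v)"
      using Suc.prems(1) by simp
  qed (simp_all add: eq Suc.prems(2))
  ultimately show ?case
    by simp
qed

lemma Ck_on_Suc_imp: "Ck_on (Suc k) S f \<Longrightarrow> Ck_on k S f"
proof (induction k arbitrary: f)
  case 0
  then have "f differentiable_on S"
    by (simp add: differentiable_on_def differentiable_at_withinI)
  then show ?case
    by (simp add: differentiable_imp_continuous_on)
next
  case (Suc k)
  then show ?case by auto
qed

lemma Ck_on_mono: "Ck_on k S f \<Longrightarrow> j \<le> k \<Longrightarrow> Ck_on j S f"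
  by (induction k) (auto simp del: Ck_on.simps dest: Ck_on_Suc_imp elim: le_SucE)

lemma Ck_on_imp_continuous_on: "Ck_on k S f \<Longrightarrow> continuous_on S f"
  using Ck_on_mono[of k S f 0] by simp

lemma Ck_on_Union:
  assumes "\<And>x. x \<in> S \<Longrightarrow> \<exists>T. open T \<and> x \<in> T \<and> Ck_on k T f"
  shows "Ck_on k S f"
  using assms
proof (induction k arbitrary: f)
  case 0
  have "isCont f x" if "x \<in> S" for x
    using 0[OF that] continuous_on_eq_continuous_at by fastforce
  then show ?case
    by (simp add: continuous_at_imp_continuous_on)
next
  case (Suc k)
  then show ?case
    by simp metis
qed

lemma Ck_on_const [simp]: "Ck_on k S (\<lambda>x. c)"
  by (induction k arbitrary: c) auto

lemma Ck_on_bounded_linear: "bounded_linear L \<Longrightarrow> Ck_on k S L"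
proof (induction k)
  case 0
  then show ?case by (simp add: linear_continuous_on)
next
  case (Suc k)
  then have "frechet_derivative L (at x) = L" for x
    by (metis bounded_linear_imp_has_derivative frechet_derivative_at)
  with Suc show ?case
    by (auto simp: bounded_linear_imp_differentiable)
qed

lemma Ck_on_linear_comp: "bounded_linear L \<Longrightarrow> open S \<Longrightarrow> Ck_on k S f \<Longrightarrow> Ck_on k S (\<lambda>x. L (f x))"
proof (induction k arbitrary: f)
  case 0
  then show ?case
    by (auto intro: bounded_linear.continuous_on)
next
  case (Suc k)
  have D: "((\<lambda>x. L (f x)) has_derivative (\<lambda>v. L (dir f x v))) (at x)" if "x \<in> S" for x
    using Suc.prems that
    by (intro bounded_linear.has_derivative[OF Suc.prems(1)])
      (simp add: frechet_derivative_works[symmetric])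
  have "Ck_on k S (\<lambda>x. dir (\<lambda>x. L (f x)) x v)" for v
    by (rule Ck_on_cong[OF Suc.IH[of "\<lambda>x. dir f x v"]])
      (use Suc.prems D in \<open>auto simp: frechet_derivative_at[symmetric, OF D]\<close>)
  with D show ?case
    by (auto simp: differentiable_def)
qed

lemma Ck_on_add: "open S \<Longrightarrow> Ck_on k S f \<Longrightarrow> Ck_on k S g \<Longrightarrow> Ck_on k S (\<lambda>x. f x + g x)"
proof (induction k arbitrary: f g)
  case 0
  then show ?case
    by (auto intro: continuous_intros)
next
  case (Suc k)
  have D: "((\<lambda>x. f x + g x) has_derivative (\<lambda>v. dir f x v + dir g x v)) (at x)" if "x \<in> S" for x
    using Suc.prems that
    by (intro has_derivative_add) (simp_all add: frechet_derivative_works[symmetric])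
  have "Ck_on k S (\<lambda>x. dir (\<lambda>x. f x + g x) x v)" for v
    by (rule Ck_on_cong[OF Suc.IH[of "\<lambda>x. dir f x v" "\<lambda>x. dir g x v"]])
      (use Suc.prems in \<open>auto simp: frechet_derivative_at[symmetric, OF D]\<close>)
  with D show ?case
    by (auto simp: differentiable_def)
qed

lemma Ck_on_sum:
  "open S \<Longrightarrow> (\<And>i. i \<in> I \<Longrightarrow> Ck_on k S (f i)) \<Longrightarrow> Ck_on k S (\<lambda>x. \<Sum>i\<in>I. f i x)"
  by (induction I rule: infinite_finite_induct) (auto intro: Ck_on_add)

lemma Ck_on_bilinear:
  assumes "bounded_bilinear B" "open S"
  shows "Ck_on k S f \<Longrightarrow> Ck_on k S g \<Longrightarrow> Ck_on k S (\<lambda>x. B (f x) (g x))"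
proof (induction k arbitrary: f g)
  case 0
  then show ?case
    using bounded_bilinear.continuous_on[OF assms(1)] by auto
next
  case (Suc k)
  have D: "((\<lambda>x. B (f x) (g x)) has_derivative (\<lambda>v. B (f x) (dir g x v) + B (dir f x v) (g x))) (at x)"
    if "x \<in> S" for x
    using Suc.prems that
    by (intro bounded_bilinear.FDERIV[OF assms(1)]) (simp_all add: frechet_derivative_works[symmetric])
  have "Ck_on k S (\<lambda>x. dir (\<lambda>x. B (f x) (g x)) x v)" for v
    by (rule Ck_on_cong[OF Ck_on_add[OF assms(2) Suc.IH[of f "\<lambda>x. dir g x v"] Suc.IH[of "\<lambda>x. dir f x v" g]]])
      (use Suc.prems assms Ck_on_Suc_imp in \<open>auto simp: frechet_derivative_at[symmetric, OF D]\<close>)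
  with D show ?case
    by (auto simp: differentiable_def)
qed

lemma frechet_derivative_Basis:
  fixes f :: "'a::euclidean_space \<Rightarrow> 'b::real_normed_vector"
  assumes "f differentiable at x"
  shows "dir f x v = (\<Sum>b\<in>Basis. (v \<bullet> b) *\<^sub>R dir f x b)"
proof -
  have "linear (dir f x)"
    using assms by (rule linear_frechet_derivative)
  then show ?thesis
    by (subst euclidean_representation[symmetric, of v]) (simp add: linear_sum linear_scale)
qed

text \<open>\<open>Ck_on\<close> controls derivatives only along constant directions. Expanding the
  moving direction \<open>w x\<close> in the basis reduces to those.\<close>

lemma Ck_on_dir_comp:
  fixes f :: "'a::euclidean_space \<Rightarrow> 'b::real_normed_vector"
  assumes "open S" "\<And>x. x \<in> S \<Longrightarrow> f differentiable at (h x)"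
    and "\<And>v. Ck_on k S (\<lambda>x. dir f (h x) v)" "Ck_on k S w"
  shows "Ck_on k S (\<lambda>x. dir f (h x) (w x))"
proof -
  have "Ck_on k S (\<lambda>x. \<Sum>b\<in>Basis. (w x \<bullet> b) *\<^sub>R dir f (h x) b)"
    using assms
    by (intro Ck_on_sum Ck_on_bilinear[OF bounded_bilinear_scaleR] Ck_on_linear_comp[OF bounded_linear_inner_left]) auto
  then show ?thesis
    by (rule Ck_on_cong) (use assms in \<open>auto simp: frechet_derivative_Basis[symmetric]\<close>)
qed

lemma Ck_on_compose:
  fixes g :: "'b::euclidean_space \<Rightarrow> 'c::real_normed_vector"
  assumes "open S"
  shows "Ck_on k T g \<Longrightarrow> Ck_on k S f \<Longrightarrow> f ` S \<subseteq> T \<Longrightarrow> Ck_on k S (\<lambda>x. g (f x))"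
proof (induction k arbitrary: g)
  case 0
  then show ?case
    using continuous_on_compose2[of T g S f] by auto
next
  case (Suc k)
  have D: "((\<lambda>x. g (f x)) has_derivative (\<lambda>v. dir g (f x) (dir f x v))) (at x)" if "x \<in> S" for x
    using Suc.prems that
    by (intro has_derivative_compose[of f _ x UNIV g]) (auto simp: frechet_derivative_works[symmetric])
  have "Ck_on k S (\<lambda>x. dir (\<lambda>x. g (f x)) x v)" for v
  proof (rule Ck_on_cong[OF Ck_on_dir_comp[of S g f k "\<lambda>x. dir f x v"]])
    show "Ck_on k S (\<lambda>x. dir g (f x) v)" for v
      using Suc.prems Ck_on_Suc_imp[OF Suc.prems(2)] by (intro Suc.IH[of "\<lambda>x. dir g x v"]) auto
  qed (use Suc.prems assms in \<open>auto simp: frechet_derivative_at[symmetric, OF D]\<close>)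
  with D show ?case
    by (auto simp: differentiable_def)
qed

lemma Ck_on_inverse:
  fixes f :: "'a::real_normed_vector \<Rightarrow> real"
  assumes "open S" "\<And>x. x \<in> S \<Longrightarrow> f x \<noteq> 0"
  shows "Ck_on k S f \<Longrightarrow> Ck_on k S (\<lambda>x. inverse (f x))"
proof (induction k)
  case 0
  then show ?case
    using assms by (auto intro: continuous_intros)
next
  case (Suc k)
  have D: "((\<lambda>x. inverse (f x)) has_derivative (\<lambda>v. - (inverse (f x) * dir f x v * inverse (f x)))) (at x)"
    if "x \<in> S" for x
    using Suc.prems that assms
    by (intro Deriv.has_derivative_inverse) (simp_all add: frechet_derivative_works[symmetric])
  have inv: "Ck_on k S (\<lambda>x. inverse (f x))"
    using Suc Ck_on_Suc_imp by blast
  have "Ck_on k S (\<lambda>x. - (inverse (f x) * dir f x v * inverse (f x)))" for v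
    by (intro Ck_on_linear_comp[OF bounded_linear_minus[OF bounded_linear_ident]] assms
        Ck_on_bilinear[OF bounded_bilinear_mult] inv) (use Suc.prems in auto)
  then have "Ck_on k S (\<lambda>x. dir (\<lambda>x. inverse (f x)) x v)" for v
    by (rule Ck_on_cong) (use assms in \<open>auto simp: frechet_derivative_at[symmetric, OF D]\<close>)
  with D show ?case
    by (auto simp: differentiable_def)
qed

text \<open>Smoothness of the germ at a point: products, quotients and compositions then need no
  bookkeeping of domains.\<close>

definition smooth_at :: "'a::real_normed_vector \<Rightarrow> ('a \<Rightarrow> 'b::real_normed_vector) \<Rightarrow> bool" where
  "smooth_at x f \<longleftrightarrow> (\<exists>S. open S \<and> x \<in> S \<and> smooth_on S f)"

lemma smooth_on_imp_smooth_at: "smooth_on S f \<Longrightarrow> open S \<Longrightarrow> x \<in> S \<Longrightarrow> smooth_at x f"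
  by (auto simp: smooth_at_def)

lemma smooth_onI: "(\<And>x. x \<in> S \<Longrightarrow> smooth_at x f) \<Longrightarrow> smooth_on S f"
  unfolding smooth_on_def smooth_at_def
  by (intro allI Ck_on_Union) blast

lemma smooth_at_cong:
  assumes "smooth_at x f" "eventually (\<lambda>y. f y = g y) (nhds x)"
  shows "smooth_at x g"
proof -
  obtain S T where "open S" "x \<in> S" "smooth_on S f" "open T" "x \<in> T" "\<And>y. y \<in> T \<Longrightarrow> f y = g y"
    using assms by (auto simp: smooth_at_def eventually_nhds)
  then have "smooth_on (S \<inter> T) g"
    unfolding smooth_on_def
    by (auto intro!: Ck_on_cong[of _ "S \<inter> T" f g] intro: Ck_on_subset)
  then show ?thesis
    using \<open>open S\<close> \<open>open T\<close> \<open>x \<in> S\<close> \<open>x \<in> T\<close> by (auto simp: smooth_at_def)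
qed

lemma eventually_smooth_at: "smooth_at x f \<Longrightarrow> eventually (\<lambda>y. smooth_at y f) (nhds x)"
  by (auto simp: smooth_at_def eventually_nhds)

lemma smooth_on_differentiable: "smooth_on S f \<Longrightarrow> x \<in> S \<Longrightarrow> f differentiable at x"
  unfolding smooth_on_def by (drule spec[of _ 1]) simp

lemma smooth_at_differentiable: "smooth_at x f \<Longrightarrow> f differentiable at x"
  by (auto simp: smooth_at_def intro: smooth_on_differentiable)

lemma smooth_at_has_derivative: "smooth_at x f \<Longrightarrow> (f has_derivative dir f x) (at x)"
  using smooth_at_differentiable frechet_derivative_works by blast

lemma smooth_on_continuous_on: "smooth_on S f \<Longrightarrow> continuous_on S f"
  by (auto simp: smooth_on_def intro: Ck_on_imp_continuous_on)

lemma smooth_at_isCont: "smooth_at x f \<Longrightarrow> isCont f x"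
  using smooth_at_differentiable differentiable_imp_continuous_within by blast

lemma smooth_on_dir: "smooth_on S f \<Longrightarrow> smooth_on S (\<lambda>x. dir f x v)"
  unfolding smooth_on_def by (metis Ck_on.simps(2))

named_theorems smooth_intros

lemma smooth_at_const [smooth_intros]: "smooth_at x (\<lambda>x. c)"
  by (auto simp: smooth_at_def smooth_on_def)

lemma smooth_at_bounded_linear: "bounded_linear L \<Longrightarrow> smooth_at x L"
  by (auto simp: smooth_at_def smooth_on_def intro: Ck_on_bounded_linear)

lemma smooth_at_ident [smooth_intros]: "smooth_at x (\<lambda>x. x)"
  by (rule smooth_at_bounded_linear[OF bounded_linear_ident])

lemma smooth_at_linear_comp:
  assumes "bounded_linear L" "smooth_at x f" shows "smooth_at x (\<lambda>x. L (f x))"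
  using assms by (auto simp: smooth_at_def smooth_on_def intro: Ck_on_linear_comp)

lemma smooth_at_bilinear:
  assumes "bounded_bilinear B" "smooth_at x f" "smooth_at x g"
  shows "smooth_at x (\<lambda>x. B (f x) (g x))"
proof -
  obtain S T where "open S" "x \<in> S" "smooth_on S f" "open T" "x \<in> T" "smooth_on T g"
    using assms by (auto simp: smooth_at_def)
  then have "smooth_on (S \<inter> T) (\<lambda>x. B (f x) (g x))"
    unfolding smooth_on_def
    by (auto intro!: Ck_on_bilinear[OF assms(1)] intro: Ck_on_subset)
  then show ?thesis
    using \<open>open S\<close> \<open>open T\<close> \<open>x \<in> S\<close> \<open>x \<in> T\<close> by (auto simp: smooth_at_def)
qed

lemma smooth_at_add [smooth_intros]:
  assumes "smooth_at x f" "smooth_at x g" shows "smooth_at x (\<lambda>x. f x + g x)"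
proof -
  obtain S T where "open S" "x \<in> S" "smooth_on S f" "open T" "x \<in> T" "smooth_on T g"
    using assms by (auto simp: smooth_at_def)
  then have "smooth_on (S \<inter> T) (\<lambda>x. f x + g x)"
    unfolding smooth_on_def
    by (auto intro!: Ck_on_add intro: Ck_on_subset)
  then show ?thesis
    using \<open>open S\<close> \<open>open T\<close> \<open>x \<in> S\<close> \<open>x \<in> T\<close> by (auto simp: smooth_at_def)
qed

lemmas smooth_at_minus [smooth_intros] = smooth_at_linear_comp[OF bounded_linear_minus[OF bounded_linear_ident]]
lemmas smooth_at_fst [smooth_intros] = smooth_at_linear_comp[OF bounded_linear_fst]
lemmas smooth_at_snd [smooth_intros] = smooth_at_linear_comp[OF bounded_linear_snd]
lemmas smooth_at_vec_nth [smooth_intros] = smooth_at_linear_comp[OF bounded_linear_vec_nth]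
lemmas smooth_at_mult [smooth_intros] = smooth_at_bilinear[OF bounded_bilinear_mult]
lemmas smooth_at_scaleR [smooth_intros] = smooth_at_bilinear[OF bounded_bilinear_scaleR]
lemmas smooth_at_inner [smooth_intros] = smooth_at_bilinear[OF bounded_bilinear_inner]

lemma smooth_at_diff [smooth_intros]:
  "smooth_at x f \<Longrightarrow> smooth_at x g \<Longrightarrow> smooth_at x (\<lambda>x. f x - g x)"
  unfolding diff_conv_add_uminus by (intro smooth_intros)

lemma smooth_at_sum [smooth_intros]:
  "(\<And>i. i \<in> I \<Longrightarrow> smooth_at x (f i)) \<Longrightarrow> smooth_at x (\<lambda>x. \<Sum>i\<in>I. f i x)"
  by (induction I rule: infinite_finite_induct) (auto intro: smooth_intros)

lemma smooth_at_Pair [smooth_intros]: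
  assumes "smooth_at x f" "smooth_at x g" shows "smooth_at x (\<lambda>x. (f x, g x))"
proof -
  have "smooth_at x (\<lambda>x. (f x, 0) + (0, g x))"
    by (intro smooth_intros smooth_at_linear_comp[of "\<lambda>a. (a, 0)"] smooth_at_linear_comp[of "\<lambda>a. (0, a)"]
        assms bounded_linear_Pair bounded_linear_ident bounded_linear_zero)
  then show ?thesis by simp
qed

lemma smooth_at_inverse [smooth_intros]:
  fixes f :: "'a::real_normed_vector \<Rightarrow> real"
  assumes "smooth_at x f" "f x \<noteq> 0" shows "smooth_at x (\<lambda>x. inverse (f x))"
proof -
  obtain S where S: "open S" "x \<in> S" "smooth_on S f"
    using assms by (auto simp: smooth_at_def)
  have "eventually (\<lambda>y. f y \<noteq> 0) (nhds x)"
    using topological_tendstoD[of f "f x" "nhds x" "- {0}"] smooth_at_isCont[OF assms(1)] assms(2)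
    by (simp add: isCont_def tendsto_at_iff_tendsto_nhds open_Compl)
  then obtain T where T: "open T" "x \<in> T" "\<And>y. y \<in> T \<Longrightarrow> f y \<noteq> 0"
    by (auto simp: eventually_nhds)
  have "smooth_on (S \<inter> T) (\<lambda>x. inverse (f x))"
    using S T unfolding smooth_on_def
    by (auto intro!: Ck_on_inverse intro: Ck_on_subset)
  then show ?thesis
    using S T by (auto simp: smooth_at_def)
qed

lemma smooth_at_divide [smooth_intros]:
  fixes f g :: "'a::real_normed_vector \<Rightarrow> real"
  shows "smooth_at x f \<Longrightarrow> smooth_at x g \<Longrightarrow> g x \<noteq> 0 \<Longrightarrow> smooth_at x (\<lambda>x. f x / g x)"
  unfolding divide_inverse by (intro smooth_intros)

lemma smooth_at_power [smooth_intros]: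
  fixes f :: "'a::real_normed_vector \<Rightarrow> real"
  shows "smooth_at x f \<Longrightarrow> smooth_at x (\<lambda>x. f x ^ n)"
  by (induction n) (auto intro: smooth_intros)

lemma smooth_at_compose:
  fixes g :: "'b::euclidean_space \<Rightarrow> 'c::real_normed_vector"
  assumes "smooth_at (f x) g" "smooth_at x f" shows "smooth_at x (\<lambda>x. g (f x))"
proof -
  obtain S T where S: "open S" "x \<in> S" "smooth_on S f" and T: "open T" "f x \<in> T" "smooth_on T g"
    using assms by (auto simp: smooth_at_def)
  define R where "R = S \<inter> f -` T"
  have "open R"
    unfolding R_def
    by (rule continuous_open_preimage[OF smooth_on_continuous_on[OF S(3)] S(1) T(1)])
  moreover have "smooth_on R (\<lambda>x. g (f x))"
    unfolding smooth_on_def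
  proof
    fix k
    have "R \<subseteq> S"
      by (simp add: R_def)
    have Rf: "Ck_on k R f"
      by (rule Ck_on_subset[OF _ \<open>R \<subseteq> S\<close>]) (use S(3) in \<open>unfold smooth_on_def, blast\<close>)
    have "Ck_on k T g"
      using T(3) unfolding smooth_on_def by blast
    then show "Ck_on k R (\<lambda>x. g (f x))"
      by (rule Ck_on_compose[OF \<open>open R\<close> _ Rf]) (auto simp: R_def)
  qed
  ultimately show ?thesis
    using S T by (auto simp: smooth_at_def R_def)
qed

lemma smooth_at_dir:
  fixes f :: "'b::euclidean_space \<Rightarrow> 'c::real_normed_vector"
  assumes "smooth_at (h x) f" "smooth_at x h" "smooth_at x w"
  shows "smooth_at x (\<lambda>x. dir f (h x) (w x))"
proof -
  have "smooth_at (h x) (\<lambda>y. dir f y b)" for b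
    using assms(1) smooth_on_dir by (auto simp: smooth_at_def)
  then have "smooth_at x (\<lambda>x. \<Sum>b\<in>Basis. (w x \<bullet> b) *\<^sub>R dir f (h x) b)"
    using assms(2,3) by (intro smooth_intros) (auto intro: smooth_at_compose[where f = h])
  moreover have "(h \<longlongrightarrow> h x) (nhds x)"
    using smooth_at_isCont[OF assms(2)] by (simp add: isCont_def tendsto_at_iff_tendsto_nhds)
  then have "eventually (\<lambda>y. smooth_at (h y) f) (nhds x)"
    using eventually_smooth_at[OF assms(1)] by (auto simp: filterlim_iff)
  then have "eventually (\<lambda>x. (\<Sum>b\<in>Basis. (w x \<bullet> b) *\<^sub>R dir f (h x) b) = dir f (h x) (w x)) (nhds x)"
    by eventually_elim (simp add: frechet_derivative_Basis[OF smooth_at_differentiable, symmetric])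
  ultimately show ?thesis
    by (rule smooth_at_cong)
qed

section \<open>Second directional derivatives and their symmetry\<close>

abbreviation dir2 :: "('a::real_normed_vector \<Rightarrow> 'b::real_normed_vector) \<Rightarrow> 'a \<Rightarrow> 'a \<Rightarrow> 'a \<Rightarrow> 'b" where
  "dir2 f x v w \<equiv> frechet_derivative (\<lambda>y. frechet_derivative f (at y) v) (at x) w"

lemma linear_dir: "smooth_at x f \<Longrightarrow> linear (dir f x)"
  by (simp add: linear_frechet_derivative smooth_at_differentiable)

lemma dir_cong:
  assumes "smooth_at x f" "eventually (\<lambda>y. f y = g y) (nhds x)"
  shows "dir f x = dir g x"
proof -
  obtain T where "open T" "x \<in> T" "\<And>y. y \<in> T \<Longrightarrow> f y = g y"
    using assms by (auto simp: eventually_nhds)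
  then show ?thesis
    using frechet_derivative_transform_within_open smooth_at_differentiable[OF assms(1)] by blast
qed

lemma smooth_at_dir_const: "smooth_at x f \<Longrightarrow> smooth_at x (\<lambda>y. dir f y v)"
  using smooth_on_dir by (auto simp: smooth_at_def)

lemma eventually_smooth_at_comp:
  assumes "smooth_at (h x) f" "isCont h x"
  shows "eventually (\<lambda>y. smooth_at (h y) f) (nhds x)"
proof -
  have "(h \<longlongrightarrow> h x) (nhds x)"
    using assms(2) by (simp add: isCont_def tendsto_at_iff_tendsto_nhds)
  then show ?thesis
    using eventually_smooth_at[OF assms(1)] by (auto simp: filterlim_iff)
qed

lemma dir_add: "smooth_at x f \<Longrightarrow> dir f x (v + w) = dir f x v + dir f x w"
  by (rule linear_add[OF linear_dir])

lemma dir_scale: "smooth_at x f \<Longrightarrow> dir f x (c *\<^sub>R v) = c *\<^sub>R dir f x v"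
  by (rule linear_scale[OF linear_dir])

lemma dir_zero: "smooth_at x f \<Longrightarrow> dir f x 0 = 0"
  by (rule linear_0[OF linear_dir])

lemma dir_diff: "smooth_at x f \<Longrightarrow> dir f x (v - w) = dir f x v - dir f x w"
  by (rule linear_diff[OF linear_dir])

lemma has_derivative_imp_dir: "(f has_derivative f') (at x) \<Longrightarrow> dir f x v = f' v"
  using frechet_derivative_at by metis

lemma dir_ident: "dir (\<lambda>x. x) x w = w"
  by (rule has_derivative_imp_dir) (rule has_derivative_ident)

lemma dir_bilinear:
  assumes B: "bounded_bilinear B" and "smooth_at x f" "smooth_at x g"
  shows "dir (\<lambda>x. B (f x) (g x)) x v = B (f x) (dir g x v) + B (dir f x v) (g x)"
  by (intro has_derivative_imp_dir bounded_bilinear.FDERIV[OF B] smooth_at_has_derivative assms)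

lemma dir_linear_comp:
  assumes "bounded_linear L" "smooth_at x f"
  shows "dir (\<lambda>x. L (f x)) x v = L (dir f x v)"
  by (intro has_derivative_imp_dir bounded_linear.has_derivative[OF assms(1)] smooth_at_has_derivative assms)

lemma dir_sum_fun:
  assumes "\<And>i. i \<in> I \<Longrightarrow> smooth_at x (f i)"
  shows "dir (\<lambda>x. \<Sum>i\<in>I. f i x) x v = (\<Sum>i\<in>I. dir (f i) x v)"
  by (intro has_derivative_imp_dir has_derivative_sum smooth_at_has_derivative assms)

lemma dir_compose:
  assumes "smooth_at (h x) g" "smooth_at x h"
  shows "dir (\<lambda>x. g (h x)) x v = dir g (h x) (dir h x v)"
  by (intro has_derivative_imp_dir has_derivative_compose[of h _ x UNIV g] smooth_at_has_derivative assms)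

lemma dir2_linear_fst:
  fixes f :: "'a::euclidean_space \<Rightarrow> 'b::real_normed_vector"
  assumes "smooth_at x f"
  shows "dir2 f x v w = (\<Sum>b\<in>Basis. (v \<bullet> b) *\<^sub>R dir2 f x b w)"
proof -
  have "eventually (\<lambda>y. dir f y v = (\<Sum>b\<in>Basis. (v \<bullet> b) *\<^sub>R dir f y b)) (nhds x)"
    using eventually_smooth_at[OF assms] by eventually_elim (rule frechet_derivative_Basis[OF smooth_at_differentiable])
  then have "dir2 f x v w = dir (\<lambda>y. \<Sum>b\<in>Basis. (v \<bullet> b) *\<^sub>R dir f y b) x w"
    by (rule dir_cong[OF smooth_at_dir_const[OF assms], THEN fun_cong])
  also have "\<dots> = (\<Sum>b\<in>Basis. (v \<bullet> b) *\<^sub>R dir2 f x b w)"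
    by (subst dir_sum_fun)
      (auto intro!: smooth_intros smooth_at_dir_const assms sum.cong dir_linear_comp bounded_linear_scaleR_right)
  finally show ?thesis .
qed

text \<open>Product rule for a derivative taken at a moving point along a moving vector; the basis
  expansion makes it a finite sum of products.\<close>

lemma dir_dir_comp:
  fixes g :: "'b::euclidean_space \<Rightarrow> 'c::real_normed_vector"
  assumes g: "smooth_at (h x) g" and h: "smooth_at x h" and k: "smooth_at x k"
  shows "dir (\<lambda>x. dir g (h x) (k x)) x w = dir2 g (h x) (k x) (dir h x w) + dir g (h x) (dir k x w)"
proof -
  have s: "smooth_at x (\<lambda>y. dir g (h y) b)" for b
    by (rule smooth_at_dir[OF g h smooth_at_const])
  have "eventually (\<lambda>y. dir g (h y) (k y) = (\<Sum>b\<in>Basis. (k y \<bullet> b) *\<^sub>R dir g (h y) b)) (nhds x)"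
    using eventually_smooth_at_comp[OF g smooth_at_isCont[OF h]]
    by eventually_elim (rule frechet_derivative_Basis[OF smooth_at_differentiable])
  then have "dir (\<lambda>x. dir g (h x) (k x)) x w = dir (\<lambda>y. \<Sum>b\<in>Basis. (k y \<bullet> b) *\<^sub>R dir g (h y) b) x w"
    by (rule dir_cong[OF smooth_at_dir[OF g h k], THEN fun_cong])
  also have "\<dots> = (\<Sum>b\<in>Basis. (k x \<bullet> b) *\<^sub>R dir2 g (h x) b (dir h x w) + (dir k x w \<bullet> b) *\<^sub>R dir g (h x) b)"
  proof (subst dir_sum_fun)
    show "smooth_at x (\<lambda>y. (k y \<bullet> b) *\<^sub>R dir g (h y) b)" for b
      by (intro smooth_intros k s)
    have "dir (\<lambda>y. (k y \<bullet> b) *\<^sub>R dir g (h y) b) x w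
        = (k x \<bullet> b) *\<^sub>R dir2 g (h x) b (dir h x w) + (dir k x w \<bullet> b) *\<^sub>R dir g (h x) b" for b
      using smooth_at_inner[OF k smooth_at_const]
      by (simp add: dir_bilinear[OF bounded_bilinear_scaleR _ s] dir_linear_comp[OF bounded_linear_inner_left k]
          dir_compose[OF smooth_at_dir_const[OF g] h])
    then show "(\<Sum>b\<in>Basis. dir (\<lambda>y. (k y \<bullet> b) *\<^sub>R dir g (h y) b) x w)
        = (\<Sum>b\<in>Basis. (k x \<bullet> b) *\<^sub>R dir2 g (h x) b (dir h x w) + (dir k x w \<bullet> b) *\<^sub>R dir g (h x) b)"
      by simp
  qed
  also have "\<dots> = dir2 g (h x) (k x) (dir h x w) + dir g (h x) (dir k x w)"
    unfolding sum.distrib dir2_linear_fst[OF g, symmetric]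
      frechet_derivative_Basis[OF smooth_at_differentiable, OF g, symmetric] ..
  finally show ?thesis .
qed

lemma dir2_compose:
  fixes g :: "'b::euclidean_space \<Rightarrow> 'c::real_normed_vector"
  assumes g: "smooth_at (h x) g" and h: "smooth_at x h"
  shows "dir2 (\<lambda>x. g (h x)) x v w = dir2 g (h x) (dir h x v) (dir h x w) + dir g (h x) (dir2 h x v w)"
proof -
  have "eventually (\<lambda>y. dir (\<lambda>x. g (h x)) y v = dir g (h y) (dir h y v)) (nhds x)"
    using eventually_smooth_at_comp[OF g smooth_at_isCont[OF h]] eventually_smooth_at[OF h]
    by eventually_elim (rule dir_compose)
  then have "dir2 (\<lambda>x. g (h x)) x v w = dir (\<lambda>y. dir g (h y) (dir h y v)) x w"
    by (rule dir_cong[OF smooth_at_dir_const[OF smooth_at_compose[OF g h]], THEN fun_cong])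
  then show ?thesis
    using dir_dir_comp[OF g h smooth_at_dir_const[OF h]] by simp
qed

text \<open>The mean value theorem is applied first along v and then along w. The left-hand side is
  symmetric in v and w while the right-hand side is not, which is the source of the symmetry of
  second derivatives.\<close>

lemma second_difference:
  fixes f :: "'a::euclidean_space \<Rightarrow> real"
  assumes f: "smooth_on S f" and t: "t > 0"
    and S: "\<And>a b. 0 \<le> a \<Longrightarrow> a \<le> t \<Longrightarrow> 0 \<le> b \<Longrightarrow> b \<le> t \<Longrightarrow> x + a *\<^sub>R v + b *\<^sub>R w \<in> S" and "open S"
  obtains a b where "0 < a" "a < t" "0 < b" "b < t"
    "f (x + t *\<^sub>R v + t *\<^sub>R w) - f (x + t *\<^sub>R v) - f (x + t *\<^sub>R w) + f x
      = t\<^sup>2 * dir2 f (x + a *\<^sub>R v + b *\<^sub>R w) v w"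
proof -
  have sm: "smooth_at (x + a *\<^sub>R v + b *\<^sub>R w) f" if "0 \<le> a" "a \<le> t" "0 \<le> b" "b \<le> t" for a b
    using smooth_on_imp_smooth_at[OF f \<open>open S\<close>] S that by blast
  define g where "g a = f (x + a *\<^sub>R v + t *\<^sub>R w) - f (x + a *\<^sub>R v + 0 *\<^sub>R w)" for a
  have line: "((\<lambda>a. h (y + a *\<^sub>R u)) has_real_derivative dir h (y + a *\<^sub>R u) u) (at a)"
    if "smooth_at (y + a *\<^sub>R u) h" for h :: "'a \<Rightarrow> real" and y u a
  proof -
    have "((\<lambda>a. y + a *\<^sub>R u) has_derivative (\<lambda>h. h *\<^sub>R u)) (at a)"
      by (auto intro!: derivative_eq_intros)
    from has_derivative_compose[OF this smooth_at_has_derivative[OF that]]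
    show ?thesis
      by (rule has_derivative_imp_has_field_derivative) (simp add: dir_scale[OF that])
  qed
  have "(g has_real_derivative dir f (x + a *\<^sub>R v + t *\<^sub>R w) v - dir f (x + a *\<^sub>R v + 0 *\<^sub>R w) v) (at a)"
    if "0 \<le> a" "a \<le> t" for a
    unfolding g_def using sm[of a t] sm[of a 0] that t line[of "x + t *\<^sub>R w" a v f] line[of "x + 0 *\<^sub>R w" a v f]
    by (intro DERIV_diff) (simp_all add: algebra_simps)
  from MVT2[of 0 t g, OF t this] obtain a where a: "0 < a" "a < t"
    "g t - g 0 = t * (dir f (x + a *\<^sub>R v + t *\<^sub>R w) v - dir f (x + a *\<^sub>R v + 0 *\<^sub>R w) v)"
    by auto
  have "((\<lambda>b. dir f (x + a *\<^sub>R v + b *\<^sub>R w) v) has_real_derivative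
      dir2 f (x + a *\<^sub>R v + b *\<^sub>R w) v w) (at b)"
    if "0 \<le> b" "b \<le> t" for b
    using line[of "x + a *\<^sub>R v" b w "\<lambda>y. dir f y v"] smooth_at_dir_const[OF sm] that a by simp
  from MVT2[of 0 t "\<lambda>b. dir f (x + a *\<^sub>R v + b *\<^sub>R w) v", OF t this] obtain b where "0 < b" "b < t"
    "dir f (x + a *\<^sub>R v + t *\<^sub>R w) v - dir f (x + a *\<^sub>R v + 0 *\<^sub>R w) v = t * dir2 f (x + a *\<^sub>R v + b *\<^sub>R w) v w"
    by auto
  with a show thesis
    by (intro that[of a b]) (simp_all add: g_def power2_eq_square)
qed

lemma dir2_commute_real:
  fixes f :: "'a::euclidean_space \<Rightarrow> real"
  assumes "smooth_at x f"
  shows "dir2 f x v w = dir2 f x w v"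
proof -
  obtain S where S: "open S" "x \<in> S" "smooth_on S f"
    using assms by (auto simp: smooth_at_def)
  obtain r where r: "r > 0" "ball x r \<subseteq> S"
    using S open_contains_ball by blast
  define c where "c = norm v + norm w + 1"
  have c: "c > 0"
    unfolding c_def by (smt (verit) norm_ge_zero)
  \<comment> \<open>With this size every parallelogram spanned by \<open>t n\<close> times v and w
    stays in \<open>ball x r\<close>, since \<open>t n * c < r\<close>. The summand 1 in
    \<open>c\<close> covers the case that both vectors vanish.\<close>
  define t where "t n = r / (c * (real n + 2))" for n :: nat
  have t: "t n > 0" for n
    unfolding t_def using r c by simp
  have "(\<lambda>n. (r / c) * inverse (real (n + 2))) \<longlonglongrightarrow> (r / c) * 0"
    using LIMSEQ_ignore_initial_segment[OF LIMSEQ_inverse_real_of_nat, of 1]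
    by (intro tendsto_mult) (simp_all add: add.commute)
  then have t0: "t \<longlonglongrightarrow> 0"
    unfolding t_def by (simp add: field_simps)
  have tr: "t n * c < r" for n
  proof -
    have "t n * c = r / (real n + 2)"
      using c by (simp add: t_def)
    also have "\<dots> < r / 1"
      using r by (intro divide_strict_left_mono) auto
    finally show ?thesis by simp
  qed
  have in_ball: "x + a *\<^sub>R v + b *\<^sub>R w \<in> ball x r"
    if "0 \<le> a" "a \<le> t n" "0 \<le> b" "b \<le> t n" for a b n
  proof -
    have "norm (a *\<^sub>R v + b *\<^sub>R w) \<le> a * norm v + b * norm w"
      using that by (intro norm_triangle_le) simp
    also have "\<dots> \<le> t n * norm v + t n * norm w"
      using that by (intro add_mono mult_right_mono) auto
    also have "\<dots> \<le> t n * c"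
      using t[of n] by (simp add: c_def algebra_simps)
    finally show ?thesis
      using tr[of n] by (simp add: dist_norm norm_minus_commute algebra_simps)
  qed
  have lim: "(\<lambda>n. (f (x + t n *\<^sub>R p + t n *\<^sub>R q) - f (x + t n *\<^sub>R p) - f (x + t n *\<^sub>R q) + f x) / (t n)\<^sup>2)
      \<longlonglongrightarrow> dir2 f x p q"
    if pq: "\<And>a b n. 0 \<le> a \<Longrightarrow> a \<le> t n \<Longrightarrow> 0 \<le> b \<Longrightarrow> b \<le> t n \<Longrightarrow> x + a *\<^sub>R p + b *\<^sub>R q \<in> ball x r" for p q
  proof -
    have "\<exists>a b. 0 < a \<and> a < t n \<and> 0 < b \<and> b < t n \<and>
      f (x + t n *\<^sub>R p + t n *\<^sub>R q) - f (x + t n *\<^sub>R p) - f (x + t n *\<^sub>R q) + f x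
      = (t n)\<^sup>2 * dir2 f (x + a *\<^sub>R p + b *\<^sub>R q) p q" for n
      by (rule second_difference[OF S(3) t[of n] _ S(1), of x p q]) (use pq r in blast)+
    then obtain a b where ab: "\<And>n. 0 < a n" "\<And>n. a n < t n" "\<And>n. 0 < b n" "\<And>n. b n < t n"
      "\<And>n. f (x + t n *\<^sub>R p + t n *\<^sub>R q) - f (x + t n *\<^sub>R p) - f (x + t n *\<^sub>R q) + f x
      = (t n)\<^sup>2 * dir2 f (x + a n *\<^sub>R p + b n *\<^sub>R q) p q"
      by metis
    have "a \<longlonglongrightarrow> 0" "b \<longlonglongrightarrow> 0"
      using ab by (auto intro!: tendsto_sandwich[OF _ _ tendsto_const t0] always_eventually less_imp_le)
    then have "(\<lambda>n. x + a n *\<^sub>R p + b n *\<^sub>R q) \<longlonglongrightarrow> x + 0 *\<^sub>R p + 0 *\<^sub>R q"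
      by (intro tendsto_intros)
    moreover have "isCont (\<lambda>y. dir2 f y p q) x"
      by (intro smooth_at_isCont smooth_at_dir_const assms)
    ultimately have "(\<lambda>n. dir2 f (x + a n *\<^sub>R p + b n *\<^sub>R q) p q) \<longlonglongrightarrow> dir2 f x p q"
      using isCont_tendsto_compose[of x "\<lambda>y. dir2 f y p q"] by simp
    then show ?thesis
      using ab t by (simp add: less_imp_neq[OF t, symmetric])
  qed
  \<comment> \<open>Exchanging v and w leaves the second difference unchanged, so both mixed
    derivatives are limits of the same sequence.\<close>
  have "x + a *\<^sub>R w + b *\<^sub>R v \<in> ball x r" if "0 \<le> a" "a \<le> t n" "0 \<le> b" "b \<le> t n" for a b n
    using in_ball[of b n a] that by (simp add: add.commute add.left_commute)
  from lim[OF this] have "(\<lambda>n. (f (x + t n *\<^sub>R v + t n *\<^sub>R w) - f (x + t n *\<^sub>R v) - f (x + t n *\<^sub>R w) + f x) / (t n)\<^sup>2)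
      \<longlonglongrightarrow> dir2 f x w v"
    by (simp add: algebra_simps)
  with lim[OF in_ball] show ?thesis
    by (rule LIMSEQ_unique) auto
qed

lemma dir2_commute:
  fixes f :: "'a::euclidean_space \<Rightarrow> 'b::euclidean_space"
  assumes "smooth_at x f"
  shows "dir2 f x v w = dir2 f x w v"
proof (rule euclidean_eqI)
  fix b :: 'b assume "b \<in> Basis"
  have "dir2 (\<lambda>y. f y \<bullet> b) x p q = dir2 f x p q \<bullet> b" for p q
  proof -
    have "eventually (\<lambda>y. dir f y p \<bullet> b = dir (\<lambda>y. f y \<bullet> b) y p) (nhds x)"
      using eventually_smooth_at[OF assms]
      by eventually_elim (simp add: dir_linear_comp[OF bounded_linear_inner_left])
    from dir_cong[OF smooth_at_inner[OF smooth_at_dir_const[OF assms] smooth_at_const] this]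
    have "dir2 (\<lambda>y. f y \<bullet> b) x p q = dir (\<lambda>y. dir f y p \<bullet> b) x q"
      by simp
    then show ?thesis
      by (simp add: dir_linear_comp[OF bounded_linear_inner_left smooth_at_dir_const[OF assms]])
  qed
  then show "dir2 f x v w \<bullet> b = dir2 f x w v \<bullet> b"
    using dir2_commute_real[OF smooth_at_inner[OF assms smooth_at_const[of x b]], where v = v and w = w] by simp
qed

section \<open>Smooth inverse function theorem\<close>

text \<open>Continuity of \<phi> is enough because \<psi> vanishes at x. For inverse functions,
  \<phi> will be a component of the very function whose differentiability is sought.\<close>

lemma has_derivative_scaleR_vanishing:
  fixes \<phi> :: "'a::real_normed_vector \<Rightarrow> real" and \<psi> :: "'a \<Rightarrow> 'b::real_normed_vector"
  assumes \<phi>: "isCont \<phi> x" and \<psi>: "(\<psi> has_derivative \<psi>') (at x)" and [simp]: "\<psi> x = 0"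
  shows "((\<lambda>y. \<phi> y *\<^sub>R \<psi> y) has_derivative (\<lambda>h. \<phi> x *\<^sub>R \<psi>' h)) (at x)"
proof -
  have bl: "bounded_linear \<psi>'"
    using \<psi> by (rule has_derivative_bounded_linear)
  then obtain K where K: "\<And>h. norm (\<psi>' h) \<le> norm h * K"
    using bounded_linear.bounded by blast
  define e where "e y = norm (\<psi> y - \<psi>' (y - x)) / norm (y - x)" for y
  have e: "(e \<longlongrightarrow> 0) (at x)"
    using \<psi> by (simp add: has_derivative_iff_norm e_def[abs_def])
  have *: "norm (\<phi> y *\<^sub>R \<psi> y - \<phi> x *\<^sub>R \<psi> x - \<phi> x *\<^sub>R \<psi>' (y - x)) / norm (y - x)
      \<le> \<bar>\<phi> y\<bar> * e y + \<bar>\<phi> y - \<phi> x\<bar> * K" if "y \<noteq> x" for y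
  proof -
    have "\<phi> y *\<^sub>R \<psi> y - \<phi> x *\<^sub>R \<psi>' (y - x)
        = \<phi> y *\<^sub>R (\<psi> y - \<psi>' (y - x)) + (\<phi> y - \<phi> x) *\<^sub>R \<psi>' (y - x)"
      by (simp add: algebra_simps)
    then have "norm (\<phi> y *\<^sub>R \<psi> y - \<phi> x *\<^sub>R \<psi>' (y - x))
        \<le> \<bar>\<phi> y\<bar> * norm (\<psi> y - \<psi>' (y - x)) + \<bar>\<phi> y - \<phi> x\<bar> * norm (\<psi>' (y - x))"
      by (metis norm_scaleR norm_triangle_ineq)
    also have "\<dots> \<le> \<bar>\<phi> y\<bar> * norm (\<psi> y - \<psi>' (y - x)) + \<bar>\<phi> y - \<phi> x\<bar> * (norm (y - x) * K)"
      by (intro add_left_mono mult_left_mono K) auto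
    also have "\<dots> = (\<bar>\<phi> y\<bar> * e y + \<bar>\<phi> y - \<phi> x\<bar> * K) * norm (y - x)"
      using that by (simp add: e_def algebra_simps)
    finally show ?thesis
      using that by (simp add: divide_le_eq)
  qed
  have \<phi>': "(\<phi> \<longlongrightarrow> \<phi> x) (at x)"
    using \<phi> by (simp add: isCont_def)
  have "((\<lambda>y. \<bar>\<phi> y\<bar> * e y + \<bar>\<phi> y - \<phi> x\<bar> * K) \<longlongrightarrow> \<bar>\<phi> x\<bar> * 0 + \<bar>\<phi> x - \<phi> x\<bar> * K) (at x)"
    by (intro tendsto_intros \<phi>' e)
  then have "((\<lambda>y. \<bar>\<phi> y\<bar> * e y + \<bar>\<phi> y - \<phi> x\<bar> * K) \<longlongrightarrow> 0) (at x)"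
    by simp
  then have "((\<lambda>y. norm (\<phi> y *\<^sub>R \<psi> y - \<phi> x *\<^sub>R \<psi> x - \<phi> x *\<^sub>R \<psi>' (y - x)) / norm (y - x)) \<longlongrightarrow> 0) (at x)"
  proof (rule Lim_null_comparison[rotated])
    show "eventually (\<lambda>y. norm (norm (\<phi> y *\<^sub>R \<psi> y - \<phi> x *\<^sub>R \<psi> x - \<phi> x *\<^sub>R \<psi>' (y - x)) / norm (y - x))
        \<le> \<bar>\<phi> y\<bar> * e y + \<bar>\<phi> y - \<phi> x\<bar> * K) (at x)"
      unfolding eventually_at_filter using * by (intro always_eventually) auto
  qed
  then show ?thesis
    by (simp add: has_derivative_iff_norm bounded_linear_scaleR_right[THEN bounded_linear_compose, OF bl])
qed

text \<open>A bootstrap: the derivative of g is the inverse of the derivative of f at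
  \<open>g y\<close>, and applying this inverse to a function z is an operation whose derivative is
  again built from the same operation. Regularity therefore rises one order at a time.\<close>

lemma smooth_on_inverse_function:
  fixes f :: "'a::euclidean_space \<Rightarrow> 'b::euclidean_space"
  assumes "open V" and f: "\<And>y. y \<in> V \<Longrightarrow> smooth_at (g y) f"
    and bij: "\<And>y. y \<in> V \<Longrightarrow> bij (dir f (g y))"
    and g: "\<And>y. y \<in> V \<Longrightarrow> (g has_derivative inv (dir f (g y))) (at y)"
  shows "smooth_on V g"
proof -
  define A where "A y = dir f (g y)" for y
  have linA: "linear (A y)" if "y \<in> V" for y
    unfolding A_def using f[OF that] by (rule linear_dir)
  have Aexp: "A y u = (\<Sum>b\<in>Basis. (u \<bullet> b) *\<^sub>R A y b)" if "y \<in> V" for y u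
    unfolding A_def by (rule frechet_derivative_Basis[OF smooth_at_differentiable[OF f[OF that]]])
  have AinvA: "A y (inv (A y) b) = b" and invAA: "inv (A y) (A y a) = a" if "y \<in> V" for y a b
    using bij[OF that] by (auto simp: A_def bij_def surj_f_inv_f)
  have lin_inv: "linear (inv (A y))" if "y \<in> V" for y
    using g[OF that] has_derivative_linear unfolding A_def by blast
  have dg: "dir g y h = inv (A y) h" if "y \<in> V" for y h
    using has_derivative_imp_dir[OF g[OF that]] by (simp add: A_def)
  have contg: "isCont g y" if "y \<in> V" for y
    using g[OF that] by (rule has_derivative_continuous)
  have dA: "((\<lambda>y. A y b) has_derivative (\<lambda>h. dir2 f (g y) b (inv (A y) h))) (at y)" if "y \<in> V" for y b
    unfolding A_def
    using has_derivative_compose[OF g[OF that] smooth_at_has_derivative[OF smooth_at_dir_const[OF f[OF that]]], of b]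
    by simp
  \<comment> \<open>A perturbation argument: \<open>A y0\<close> stretches vectors at least by c,
    and \<open>A y\<close> differs from it by at most \<open>S y < c / 2\<close> in operator norm,
    so near y0 the inverses are bounded by 2 / c.\<close>
  have contw: "isCont (\<lambda>y. inv (A y) (z y)) y0" if y0: "y0 \<in> V" and z: "isCont z y0" for z y0
  proof -
    obtain c where c: "c > 0" "\<And>u. c * norm u \<le> norm (A y0 u)"
      using linear_inj_bounded_below_pos[OF linA[OF y0]] bij[OF y0] by (metis A_def bij_is_inj mult.commute)
    define S where "S y = (\<Sum>b\<in>Basis. norm (A y b - A y0 b))" for y
    have "isCont (\<lambda>y. A y b) y0" for b
      using dA[OF y0] by (rule has_derivative_continuous)
    then have "isCont S y0"
      unfolding S_def by (intro continuous_intros)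
    then have "(S \<longlongrightarrow> 0) (at y0)"
      by (simp add: isCont_def S_def)
    then have Sev: "eventually (\<lambda>y. S y < c / 2) (at y0)"
      using c by (intro order_tendstoD) auto
    define w0 where "w0 = inv (A y0) (z y0)"
    have bd: "norm (inv (A y) (z y) - w0) \<le> 2 / c * norm (z y - A y w0)" if y: "y \<in> V" "S y < c / 2" for y
    proof -
      define u where "u = inv (A y) (z y) - w0"
      have lin: "linear (\<lambda>u. A y u - A y0 u)"
        using linA[OF y(1)] linA[OF y0] by (rule linear_compose_sub)
      have "A y u - A y0 u = (\<Sum>b\<in>Basis. (u \<bullet> b) *\<^sub>R (A y b - A y0 b))"
        unfolding Aexp[OF y(1), of u] Aexp[OF y0, of u] by (simp add: sum_subtractf scaleR_diff_right)
      also have "norm \<dots> \<le> (\<Sum>b\<in>Basis. norm u * norm (A y b - A y0 b))"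
        by (rule sum_norm_le) (auto intro!: mult_right_mono Basis_le_norm)
      also have "\<dots> = norm u * S y"
        by (simp add: S_def sum_distrib_left)
      also have "\<dots> \<le> norm u * (c / 2)"
        using y by (intro mult_left_mono) auto
      finally have "norm (A y u) \<ge> norm (A y0 u) - norm u * (c / 2)"
        by (smt (verit) norm_triangle_sub norm_minus_commute)
      with c(2)[of u] have "norm u * (c / 2) \<le> norm (A y u)"
        by (simp add: algebra_simps)
      also have "A y u = z y - A y w0"
        unfolding u_def by (simp add: linear_diff[OF linA[OF y(1)]] AinvA[OF y(1)])
      finally show ?thesis
        using c(1) by (simp add: u_def field_simps)
    qed
    have "isCont (\<lambda>y. z y - A y w0) y0"
      using dA[OF y0] by (intro continuous_intros z) (rule has_derivative_continuous)
    then have "((\<lambda>y. z y - A y w0) \<longlongrightarrow> z y0 - A y0 w0) (at y0)"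
      by (simp add: isCont_def)
    then have "((\<lambda>y. 2 / c * norm (z y - A y w0)) \<longlongrightarrow> 2 / c * norm (z y0 - A y0 w0)) (at y0)"
      by (intro tendsto_mult tendsto_norm tendsto_const)
    moreover have "2 / c * norm (z y0 - A y0 w0) = 0"
      by (simp add: w0_def AinvA[OF y0])
    ultimately have "((\<lambda>y. 2 / c * norm (z y - A y w0)) \<longlongrightarrow> 0) (at y0)"
      by (simp only:)
    moreover have "eventually (\<lambda>y. norm (inv (A y) (z y) - w0) \<le> 2 / c * norm (z y - A y w0)) (at y0)"
      using Sev eventually_at_in_open'[OF \<open>open V\<close> y0] by eventually_elim (rule bd)
    ultimately have "((\<lambda>y. inv (A y) (z y) - w0) \<longlongrightarrow> 0) (at y0)"
      by (rule Lim_null_comparison[rotated])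
    then show ?thesis
      by (simp add: isCont_def w0_def[symmetric] LIM_zero_iff)
  qed
  have dw: "((\<lambda>y. inv (A y) (z y)) has_derivative
      (\<lambda>h. inv (A y0) (dir z y0 h - dir2 f (g y0) (inv (A y0) (z y0)) (inv (A y0) h)))) (at y0)"
    if y0: "y0 \<in> V" and z: "z differentiable (at y0)" for z y0
  proof -
    define w where "w y = inv (A y) (z y)" for y
    have cw: "isCont w y0"
      unfolding w_def using z by (intro contw y0 differentiable_imp_continuous_within)
    \<comment> \<open>The identity moves all dependence on y out of the inverse. Every difference
      \<open>A y b - A y0 b\<close> vanishes at y0, so the continuity of w suffices to differentiate
      there.\<close>
    have eq: "w y = inv (A y0) (z y - (\<Sum>b\<in>Basis. (w y \<bullet> b) *\<^sub>R (A y b - A y0 b)))" if y: "y \<in> V" for y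
    proof -
      have "(\<Sum>b\<in>Basis. (w y \<bullet> b) *\<^sub>R (A y b - A y0 b)) = A y (w y) - A y0 (w y)"
        unfolding Aexp[OF y, of "w y"] Aexp[OF y0, of "w y"] by (simp add: sum_subtractf scaleR_diff_right)
      then show ?thesis
        by (simp add: w_def AinvA[OF y] invAA[OF y0])
    qed
    have "((\<lambda>y. inv (A y0) (z y - (\<Sum>b\<in>Basis. (w y \<bullet> b) *\<^sub>R (A y b - A y0 b)))) has_derivative
      (\<lambda>h. inv (A y0) (dir z y0 h - (\<Sum>b\<in>Basis. (w y0 \<bullet> b) *\<^sub>R dir2 f (g y0) b (inv (A y0) h))))) (at y0)"
    proof (intro bounded_linear.has_derivative[of "inv (A y0)"] has_derivative_diff has_derivative_sum
        has_derivative_scaleR_vanishing)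
      show "bounded_linear (inv (A y0))"
        using lin_inv[OF y0] by (simp add: linear_conv_bounded_linear)
      show "(z has_derivative dir z y0) (at y0)"
        using z frechet_derivative_works by blast
      show "isCont (\<lambda>y. w y \<bullet> b) y0" for b
        by (intro continuous_intros cw)
      show "((\<lambda>y. A y b - A y0 b) has_derivative (\<lambda>h. dir2 f (g y0) b (inv (A y0) h))) (at y0)" for b
        using has_derivative_diff[OF dA[OF y0, of b] has_derivative_const[of "A y0 b"]] by simp
    qed simp
    then have "(w has_derivative
      (\<lambda>h. inv (A y0) (dir z y0 h - (\<Sum>b\<in>Basis. (w y0 \<bullet> b) *\<^sub>R dir2 f (g y0) b (inv (A y0) h))))) (at y0)"
      by (rule has_derivative_transform_within_open[OF _ \<open>open V\<close> y0]) (use eq in simp)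
    then show ?thesis
      unfolding w_def dir2_linear_fst[OF f[OF y0], symmetric] .
  qed
  \<comment> \<open>The induction hypothesis is used in three ways: for constant fields it controls
    the derivative of g, for z the solution itself, and for the bracket in \<open>dw\<close> the
    derivative of the solution.\<close>
  have main: "Ck_on k V z \<Longrightarrow> Ck_on k V (\<lambda>y. inv (A y) (z y))" for k z
  proof (induction k arbitrary: z)
    case 0
    then show ?case
      using contw \<open>open V\<close> by (auto simp: continuous_on_eq_continuous_at)
  next
    case (Suc k)
    have zk: "Ck_on k V z"
      using Suc.prems by (rule Ck_on_Suc_imp)
    have gk: "Ck_on k V g"
    proof (rule Ck_on_Suc_imp, unfold Ck_on.simps, intro conjI allI ballI)
      show "g differentiable at y" if "y \<in> V" for y
        using g[OF that] by (rule differentiableI)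
      show "Ck_on k V (\<lambda>y. dir g y v)" for v
        by (rule Ck_on_cong[OF Suc.IH[OF Ck_on_const[of k V v]] \<open>open V\<close>]) (simp add: dg)
    qed
    have fk: "Ck_on k V (\<lambda>y. dir2 f (g y) v w)" for v w
    proof (rule Ck_on_compose[OF \<open>open V\<close> _ gk])
      show "Ck_on k {x. smooth_at x f} (\<lambda>x. dir2 f x v w)"
      proof -
        have "smooth_on {x. smooth_at x f} (\<lambda>x. dir2 f x v w)"
          by (rule smooth_onI) (simp add: smooth_at_dir_const)
        then show ?thesis
          unfolding smooth_on_def by blast
      qed
    qed (use f in auto)
    have df: "(\<lambda>x. dir f x v) differentiable at (g y)" if "y \<in> V" for y v
      using f[OF that] by (intro smooth_at_differentiable smooth_at_dir_const)
    have *: "Ck_on k V (\<lambda>y. dir2 f (g y) (inv (A y) (z y)) (inv (A y) h))" for h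
    proof (rule Ck_on_cong[OF _ \<open>open V\<close>])
      show "Ck_on k V (\<lambda>y. \<Sum>b\<in>Basis. (inv (A y) (z y) \<bullet> b) *\<^sub>R dir2 f (g y) b (inv (A y) h))"
      proof (rule Ck_on_sum[OF \<open>open V\<close>])
        fix b
        have 1: "Ck_on k V (\<lambda>y. dir2 f (g y) b (inv (A y) h))"
          by (rule Ck_on_dir_comp[OF \<open>open V\<close> df fk Suc.IH[OF Ck_on_const]])
        have 2: "Ck_on k V (\<lambda>y. inv (A y) (z y) \<bullet> b)"
          by (rule Ck_on_linear_comp[OF bounded_linear_inner_left \<open>open V\<close> Suc.IH[OF zk]])
        show "Ck_on k V (\<lambda>y. (inv (A y) (z y) \<bullet> b) *\<^sub>R dir2 f (g y) b (inv (A y) h))"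
          by (rule Ck_on_bilinear[OF bounded_bilinear_scaleR \<open>open V\<close> 2 1])
      qed
      show "(\<Sum>b\<in>Basis. (inv (A y) (z y) \<bullet> b) *\<^sub>R dir2 f (g y) b (inv (A y) h))
          = dir2 f (g y) (inv (A y) (z y)) (inv (A y) h)" if "y \<in> V" for y
        by (rule dir2_linear_fst[OF f[OF that], symmetric])
    qed
    have D: "((\<lambda>y. inv (A y) (z y)) has_derivative
      (\<lambda>h. inv (A y) (dir z y h - dir2 f (g y) (inv (A y) (z y)) (inv (A y) h)))) (at y)" if "y \<in> V" for y
      using dw[OF that, of z] Suc.prems that by simp
    have "Ck_on k V (\<lambda>y. inv (A y) (dir z y h + - dir2 f (g y) (inv (A y) (z y)) (inv (A y) h)))" for h
    proof (rule Suc.IH, rule Ck_on_add[OF \<open>open V\<close>])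
      show "Ck_on k V (\<lambda>y. dir z y h)"
        using Suc.prems by simp
      show "Ck_on k V (\<lambda>y. - dir2 f (g y) (inv (A y) (z y)) (inv (A y) h))"
        by (rule Ck_on_linear_comp[OF bounded_linear_minus[OF bounded_linear_ident] \<open>open V\<close> *])
    qed
    then have "Ck_on k V (\<lambda>y. dir (\<lambda>y. inv (A y) (z y)) y h)" for h
      by (rule Ck_on_cong[OF _ \<open>open V\<close>]) (simp add: has_derivative_imp_dir[OF D])
    moreover have "(\<lambda>y. inv (A y) (z y)) differentiable at y" if "y \<in> V" for y
      using D[OF that] by (rule differentiableI)
    ultimately show ?case
      by simp
  qed
  have "Ck_on (Suc k) V g" for k
  proof (unfold Ck_on.simps, intro conjI allI ballI)
    show "g differentiable at y" if "y \<in> V" for y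
      using g[OF that] by (rule differentiableI)
    show "Ck_on k V (\<lambda>y. dir g y v)" for v
      by (rule Ck_on_cong[OF main[OF Ck_on_const[of k V v]] \<open>open V\<close>]) (simp add: dg)
  qed
  then show ?thesis
    unfolding smooth_on_def using Ck_on_Suc_imp by blast
qed

lemma bij_linear_imp_linear_inv:
  assumes "linear f" "bij f"
  shows "linear (inv f)"
proof (rule linearI)
  have f: "f (inv f b) = b" "inv f (f a) = a" for a b
    using assms(2) by (auto simp: bij_def surj_f_inv_f)
  show "inv f (a + b) = inv f a + inv f b" for a b
    using f(2)[of "inv f a + inv f b"] by (simp add: linear_add[OF assms(1)] f(1))
  show "inv f (r *\<^sub>R b) = r *\<^sub>R inv f b" for r b
    using f(2)[of "r *\<^sub>R inv f b"] by (simp add: linear_scale[OF assms(1)] f(1))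
qed

text \<open>Composition with the inverse of the derivative at x0 turns f into a self-map whose
  derivative there is the identity. The local inverse of this map has a derivative by the inverse
  function theorem, and \<open>smooth_on_inverse_function\<close> makes it smooth.\<close>

theorem smooth_inverse_function_theorem:
  fixes f :: "'a::euclidean_space \<Rightarrow> 'b::euclidean_space"
  assumes f: "smooth_at x0 f" and bij: "bij (dir f x0)" and W: "open W" "x0 \<in> W"
  obtains g U V where "open U" "x0 \<in> U" "U \<subseteq> W" "open V" "f x0 \<in> V" "smooth_on U f" "smooth_on V g"
    "\<And>x. x \<in> U \<Longrightarrow> f x \<in> V" "\<And>x. x \<in> U \<Longrightarrow> g (f x) = x"
    "\<And>y. y \<in> V \<Longrightarrow> g y \<in> U" "\<And>y. y \<in> V \<Longrightarrow> f (g y) = y"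
proof -
  obtain S where S: "open S" "x0 \<in> S" "smooth_on S f"
    using f by (auto simp: smooth_at_def)
  define L where "L = inv (dir f x0)"
  have linL: "linear L"
    unfolding L_def by (intro bij_linear_imp_linear_inv linear_dir f bij)
  then have blL: "bounded_linear L"
    by (simp add: linear_conv_bounded_linear)
  have injL: "inj L"
    unfolding L_def using bij by (metis bij_imp_bij_inv bij_is_inj)
  have smS: "smooth_at x f" if "x \<in> S \<inter> W" for x
    using that S smooth_on_imp_smooth_at by blast
  define f1 where "f1 x = L (f x)" for x
  have sm1: "smooth_at x f1" if "x \<in> S \<inter> W" for x
    unfolding f1_def by (intro smooth_at_linear_comp[OF blL] smS that)
  have app: "blinfun_apply (Blinfun (dir f1 x)) = dir f1 x" if "x \<in> S \<inter> W" for x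
    by (rule bounded_linear_Blinfun_apply)
      (rule linear_dir[OF sm1[OF that], unfolded linear_conv_bounded_linear])
  have d1: "dir f1 x v = L (dir f x v)" if "x \<in> S \<inter> W" for x v
    unfolding f1_def by (rule dir_linear_comp[OF blL smS[OF that]])
  obtain U V1 g1 g1' where g1: "open U" "U \<subseteq> S \<inter> W" "x0 \<in> U" "open V1" "f1 x0 \<in> V1" "homeomorphism U V1 f1 g1"
    "\<And>y. y \<in> V1 \<Longrightarrow> (g1 has_derivative g1' y) (at y)"
    "\<And>y. y \<in> V1 \<Longrightarrow> g1' y = inv (blinfun_apply (Blinfun (dir f1 (g1 y))))"
    "\<And>y. y \<in> V1 \<Longrightarrow> bij (blinfun_apply (Blinfun (dir f1 (g1 y))))"
  proof (rule inverse_function_theorem[of "S \<inter> W" f1 "\<lambda>x. Blinfun (dir f1 x)" x0 id_blinfun])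
    show "open (S \<inter> W)" "x0 \<in> S \<inter> W"
      using S W by auto
    show "(f1 has_derivative blinfun_apply (Blinfun (dir f1 x))) (at x)" if "x \<in> S \<inter> W" for x
      using smooth_at_has_derivative[OF sm1[OF that]] by (simp add: app[OF that])
    have "continuous_on (S \<inter> W) (\<lambda>x. dir f1 x b)" for b
      using sm1 by (auto intro!: continuous_at_imp_continuous_on smooth_at_isCont smooth_at_dir_const)
    then show "continuous_on (S \<inter> W) (\<lambda>x. Blinfun (dir f1 x))"
      by (intro continuous_on_blinfun_componentwise, rule continuous_on_eq) (simp add: app)
    show "id_blinfun o\<^sub>L Blinfun (dir f1 x0) = id_blinfun"
    proof (rule blinfun_eqI)
      have "dir f1 x0 v = v" for v
        using S W bij by (simp add: d1 L_def inv_f_f bij_is_inj)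
      moreover have "blinfun_apply (Blinfun (dir f1 x0)) v = dir f1 x0 v" for v
        using S W app[of x0] by simp
      ultimately show "blinfun_apply (id_blinfun o\<^sub>L Blinfun (dir f1 x0)) v = blinfun_apply id_blinfun v" for v
        by simp
    qed
  qed blast
  have in_U: "g1 y \<in> U" if "y \<in> V1" for y
    using g1(6) that by (auto simp: homeomorphism_def)
  have sg1: "smooth_on V1 g1"
  proof (rule smooth_on_inverse_function[OF g1(4)])
    fix y assume y: "y \<in> V1"
    then have mem: "g1 y \<in> S \<inter> W"
      using in_U g1(2) by blast
    then show "smooth_at (g1 y) f1"
      by (rule sm1)
    show "bij (dir f1 (g1 y))"
      using g1(9)[OF y] by (simp only: app[OF mem])
    show "(g1 has_derivative inv (dir f1 (g1 y))) (at y)"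
      using g1(7)[OF y] g1(8)[OF y] by (simp only: app[OF mem])
  qed
  define V where "V = L -` V1"
  have "open V"
    unfolding V_def by (rule open_vimage[OF g1(4) linear_continuous_on[OF blL]])
  have fin: "f x \<in> V" if "x \<in> U" for x
    using g1(6) that by (auto simp: V_def homeomorphism_def f1_def)
  have sg: "smooth_on V (\<lambda>y. g1 (L y))"
  proof (rule smooth_onI)
    fix y assume "y \<in> V"
    then have "smooth_at (L y) g1"
      using sg1 g1(4) by (auto simp: V_def intro: smooth_on_imp_smooth_at)
    then show "smooth_at y (\<lambda>y. g1 (L y))"
      by (rule smooth_at_compose[OF _ smooth_at_bounded_linear[OF blL]])
  qed
  show thesis
  proof (rule that[of U V "\<lambda>y. g1 (L y)"])
    show "smooth_on U f"
      using g1(2) smS by (intro smooth_onI) auto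
    show "g1 (L (f x)) = x" if "x \<in> U" for x
      using g1(6) that by (auto simp: homeomorphism_def f1_def)
    show "g1 (L y) \<in> U" if "y \<in> V" for y
      using in_U that by (simp add: V_def)
    show "f (g1 (L y)) = y" if "y \<in> V" for y
    proof (rule injD[OF injL])
      show "L (f (g1 (L y))) = L y"
        using g1(6) that by (auto simp: homeomorphism_def f1_def V_def)
    qed
  qed (use g1 fin \<open>open V\<close> sg in auto)
qed

lemma smooth_at_tendsto_nhds: "smooth_at x f \<Longrightarrow> (f \<longlongrightarrow> f x) (nhds x)"
  using smooth_at_isCont unfolding isCont_def by (subst (asm) tendsto_at_iff_tendsto_nhds)

lemma eventually_smooth_at_in_open:
  "smooth_at x f \<Longrightarrow> open S \<Longrightarrow> f x \<in> S \<Longrightarrow> eventually (\<lambda>y. f y \<in> S) (nhds x)"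
  using smooth_at_tendsto_nhds topological_tendstoD by blast

lemma eventually_smooth_at_neq:
  fixes c :: "'b::real_normed_vector"
  shows "smooth_at x f \<Longrightarrow> f x \<noteq> c \<Longrightarrow> eventually (\<lambda>y. f y \<noteq> c) (nhds x)"
  using eventually_smooth_at_in_open[of x f "- {c}"] by (simp add: open_Compl)

lemma dir_Pair:
  assumes "smooth_at x f" "smooth_at x g"
  shows "dir (\<lambda>x. (f x, g x)) x v = (dir f x v, dir g x v)"
  by (intro has_derivative_imp_dir has_derivative_Pair smooth_at_has_derivative assms)

lemma dir2_scale:
  fixes f :: "'a::euclidean_space \<Rightarrow> 'b::euclidean_space"
  assumes "smooth_at x f"
  shows "dir2 f x (r *\<^sub>R v) (s *\<^sub>R w) = (r * s) *\<^sub>R dir2 f x v w"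
proof -
  have *: "dir2 f x v (s *\<^sub>R w) = s *\<^sub>R dir2 f x v w" for v w s
    using dir_scale[OF smooth_at_dir_const[OF assms]] .
  have "dir2 f x (r *\<^sub>R v) (s *\<^sub>R w) = s *\<^sub>R dir2 f x w (r *\<^sub>R v)"
    unfolding * dir2_commute[OF assms, of "r *\<^sub>R v" w] ..
  also have "\<dots> = s *\<^sub>R r *\<^sub>R dir2 f x v w"
    unfolding * dir2_commute[OF assms, of w v] ..
  finally show ?thesis by (simp add: mult.commute)
qed

lemma dir2_add_right:
  assumes "smooth_at x f"
  shows "dir2 f x v (w + w') = dir2 f x v w + dir2 f x v w'"
  using dir_add[OF smooth_at_dir_const[OF assms]] .

lemma dir2_add_left:
  fixes f :: "'a::euclidean_space \<Rightarrow> 'b::euclidean_space"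
  assumes "smooth_at x f"
  shows "dir2 f x (v + v') w = dir2 f x v w + dir2 f x v' w"
  using dir2_add_right[OF assms] dir2_commute[OF assms] by metis

lemma smooth_at_vec:
  fixes f :: "'a::real_normed_vector \<Rightarrow> 'b::euclidean_space ^ 'n"
  assumes "\<And>i. smooth_at x (\<lambda>x. f x $ i)"
  shows "smooth_at x f"
proof -
  have "smooth_at x (\<lambda>x. \<Sum>i\<in>UNIV. axis i (f x $ i))"
  proof (rule smooth_at_sum)
    fix i
    have "linear (axis i :: 'b \<Rightarrow> 'b ^ 'n)"
      by (rule linearI) (auto simp: axis_def vec_eq_iff)
    then have "bounded_linear (axis i :: 'b \<Rightarrow> 'b ^ 'n)"
      by (simp add: linear_conv_bounded_linear)
    then show "smooth_at x (\<lambda>x. axis i (f x $ i))"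
      by (rule smooth_at_linear_comp) (rule assms)
  qed
  moreover have "(\<Sum>i\<in>UNIV. axis i (f x $ i)) = f x" for x
    by (simp add: vec_eq_iff axis_def)
  ultimately show ?thesis by simp
qed

section \<open>Jets of curves and paths\<close>

text \<open>Order two is enough, as a path geometry is a second-order equation: the lift of a curve
  uses its velocity, and the tangent of the lift its acceleration.\<close>

definition has_jet :: "(real \<Rightarrow> 'a::euclidean_space) \<Rightarrow> 'a \<Rightarrow> 'a \<Rightarrow> 'a \<Rightarrow> bool" where
  "has_jet c p v a \<longleftrightarrow> smooth_at 0 c \<and> c 0 = p \<and> dir c 0 1 = v \<and> dir2 c 0 1 1 = a"

lemma dir_real:
  fixes c :: "real \<Rightarrow> 'a::real_normed_vector"
  assumes "smooth_at t c"
  shows "dir c t s = s *\<^sub>R dir c t 1"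
  using dir_scale[OF assms, of s 1] by simp

lemma has_jet_compose:
  fixes g :: "'a::euclidean_space \<Rightarrow> 'b::euclidean_space"
  assumes "has_jet c p v a" "smooth_at p g"
  shows "has_jet (\<lambda>t. g (c t)) (g p) (dir g p v) (dir2 g p v v + dir g p a)"
  using assms unfolding has_jet_def
  by (auto simp: dir_compose dir2_compose intro: smooth_at_compose)

lemma has_jet_cong:
  assumes "has_jet c p v a" "eventually (\<lambda>t. c t = d t) (nhds 0)"
  shows "has_jet d p v a"
proof -
  have c: "smooth_at 0 c"
    using assms by (simp add: has_jet_def)
  have "eventually (\<lambda>t. dir c t 1 = dir d t 1) (nhds 0)"
    using iffD2[OF eventually_eventually assms(2)] eventually_smooth_at[OF c]
    by eventually_elim (simp add: dir_cong)
  then have "dir2 c 0 1 1 = dir2 d 0 1 1"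
    by (simp add: dir_cong[OF smooth_at_dir_const[OF c]])
  moreover have "c 0 = d 0"
    using assms(2) by (rule eventually_nhds_x_imp_x)
  ultimately show ?thesis
    using assms(1) smooth_at_cong[OF c assms(2)] dir_cong[OF c assms(2)] by (simp add: has_jet_def)
qed

lemma has_jet_unique:
  "has_jet c p v a \<Longrightarrow> has_jet c p' v' a' \<Longrightarrow> p = p' \<and> v = v' \<and> a = a'"
  by (auto simp: has_jet_def)

text \<open>The parameter change has first derivative k and second derivative m at 0. Thus m adds an
  arbitrary multiple of the velocity to the acceleration.\<close>

lemma has_jet_reparametrize:
  assumes "has_jet c p v a"
  shows "has_jet (\<lambda>t. c (k * t + m / 2 * t\<^sup>2)) p (k *\<^sub>R v) (k\<^sup>2 *\<^sub>R a + m *\<^sub>R v)"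
proof -
  define h :: "real \<Rightarrow> real" where "h t = k * t + m / 2 * t\<^sup>2" for t
  have sh: "smooth_at t h" for t
    unfolding h_def by (intro smooth_intros)
  have h': "dir h t 1 = k + m * t" for t
  proof -
    have "(h has_derivative (\<lambda>s. s * (k + m * t))) (at t)"
      unfolding h_def by (auto intro!: derivative_eq_intros simp: algebra_simps)
    from has_derivative_imp_dir[OF this, of 1] show ?thesis by simp
  qed
  have "dir2 h 0 1 1 = m"
  proof -
    have "((\<lambda>t. k + m * t) has_derivative (\<lambda>s. s * m)) (at 0)"
      by (auto intro!: derivative_eq_intros)
    from has_derivative_imp_dir[OF this, of 1] show ?thesis by (simp add: h')
  qed
  then have "has_jet h 0 k m"
    unfolding has_jet_def using sh h'[of 0] by (simp add: h_def)
  from has_jet_compose[OF this, of c] assms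
  have "has_jet (\<lambda>t. c (h t)) (c 0) (dir c 0 k) (dir2 c 0 k k + dir c 0 m)"
    by (simp add: has_jet_def)
  moreover have "dir2 c 0 k k = k\<^sup>2 *\<^sub>R dir2 c 0 1 1"
    using dir2_scale[of 0 c k 1 k 1] assms by (simp add: has_jet_def power2_eq_square)
  ultimately show ?thesis
    using assms dir_real[of 0 c k] dir_real[of 0 c m] by (simp add: has_jet_def h_def)
qed

lemma has_jet_imp_has_vector_derivative:
  assumes "smooth_at t c"
  shows "(c has_vector_derivative dir c t 1) (at t)"
proof -
  have "dir c t = (\<lambda>s. s *\<^sub>R dir c t 1)"
    by (rule ext) (rule dir_real[OF assms])
  then show ?thesis
    unfolding has_vector_derivative_def using smooth_at_has_derivative[OF assms] by metis
qed

lemma smooth_curve_in_iff: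
  "smooth_curve_in S c q w \<longleftrightarrow>
    smooth_at 0 c \<and> eventually (\<lambda>t. c t \<in> S) (nhds 0) \<and> c 0 = q \<and> dir c 0 1 = w"
proof
  assume L: "smooth_curve_in S c q w"
  then obtain e where e: "e > 0" "smooth_on {-e<..<e} c" "c ` {-e<..<e} \<subseteq> S"
    by (auto simp: smooth_curve_in_def)
  then have s: "smooth_at 0 c"
    by (auto intro: smooth_on_imp_smooth_at)
  moreover have "eventually (\<lambda>t. c t \<in> S) (nhds 0)"
    unfolding eventually_nhds using e by (intro exI[of _ "{-e<..<e}"]) auto
  moreover have "dir c 0 1 = w"
    using L has_jet_imp_has_vector_derivative[OF s] vector_derivative_unique_at
    by (auto simp: smooth_curve_in_def)
  ultimately show "smooth_at 0 c \<and> eventually (\<lambda>t. c t \<in> S) (nhds 0) \<and> c 0 = q \<and> dir c 0 1 = w"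
    using L by (simp add: smooth_curve_in_def)
next
  assume R: "smooth_at 0 c \<and> eventually (\<lambda>t. c t \<in> S) (nhds 0) \<and> c 0 = q \<and> dir c 0 1 = w"
  then have "eventually (\<lambda>t. smooth_at t c \<and> c t \<in> S) (nhds 0)"
    using eventually_smooth_at eventually_conj by blast
  then obtain e where e: "e > 0" "\<And>t. dist t 0 < e \<Longrightarrow> smooth_at t c \<and> c t \<in> S"
    by (auto simp: eventually_nhds_metric)
  then have "smooth_on {-e<..<e} c" "c ` {-e<..<e} \<subseteq> S"
    by (auto intro!: smooth_onI simp: dist_real_def abs_less_iff)
  then show "smooth_curve_in S c q w"
    unfolding smooth_curve_in_def
    using R e(1) has_jet_imp_has_vector_derivative[of 0 c] by blast
qed

lemma dir_in_tangent_space: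
  fixes c :: "real \<Rightarrow> 'a::euclidean_space"
  assumes c: "smooth_at t c" and S: "eventually (\<lambda>s. c s \<in> S) (nhds t)"
  shows "dir c t 1 \<in> tangent_space S (c t)"
proof -
  have "eventually (\<lambda>s. c (t + s) \<in> S) (nhds 0)"
  proof -
    have "((\<lambda>s. t + s) \<longlongrightarrow> t + 0) (nhds 0)"
      by (intro tendsto_intros filterlim_ident)
    then show ?thesis
      using S by (auto simp: filterlim_iff)
  qed
  moreover have sm: "smooth_at 0 (\<lambda>s. c (t + s))"
    using c by (intro smooth_at_compose[of _ 0 c]) (auto intro: smooth_intros)
  moreover have "dir (\<lambda>s. c (t + s)) 0 1 = dir c t 1"
  proof -
    have "((\<lambda>s. t + s) has_derivative (\<lambda>s. s)) (at 0)"
      by (auto intro!: derivative_eq_intros)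
    then have "dir (\<lambda>s. t + s) 0 1 = 1"
      by (rule has_derivative_imp_dir)
    then show ?thesis
      using dir_compose[of "\<lambda>s. t + s" 0 c 1] c by (simp add: smooth_at_add smooth_at_const smooth_at_ident)
  qed
  ultimately have "smooth_curve_in S (\<lambda>s. c (t + s)) (c t) (dir c t 1)"
    by (simp add: smooth_curve_in_iff)
  then show ?thesis
    unfolding tangent_space_def by blast
qed

section \<open>Lines and lifts\<close>

lemma smooth_at_line_of:
  assumes "v \<noteq> 0" shows "smooth_at v line_of"
proof (rule smooth_at_vec, rule smooth_at_vec)
  show "smooth_at v (\<lambda>v. line_of v $ i $ j)" for i j
    using assms unfolding line_of_def by simp (intro smooth_intros, simp)
qed

lemma line_of_scale: "k \<noteq> 0 \<Longrightarrow> line_of (k *\<^sub>R v) = line_of v"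
  by (simp add: line_of_def vec_eq_iff)

lemma line_of_apply: "v \<noteq> 0 \<Longrightarrow> (\<Sum>j\<in>UNIV. line_of v $ i $ j * w $ j) = (v \<bullet> w) / (v \<bullet> v) * v $ i"
  by (simp add: line_of_def inner_vec_def sum_divide_distrib sum_distrib_left mult.commute mult.left_commute)

lemma line_of_eqD:
  assumes "line_of v = line_of w" "v \<noteq> 0" "w \<noteq> 0"
  obtains k where "k \<noteq> 0" "w = k *\<^sub>R v"
proof
  have "w $ i = (v \<bullet> w) / (v \<bullet> v) * v $ i" for i
    using line_of_apply[OF assms(3), of i w] line_of_apply[OF assms(2), of i w] assms by simp
  then show "w = ((v \<bullet> w) / (v \<bullet> v)) *\<^sub>R v"
    by (simp add: vec_eq_iff)
  with assms(3) show "(v \<bullet> w) / (v \<bullet> v) \<noteq> 0"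
    by auto
qed

text \<open>The projector \<open>line_of w\<close> fixes w. Differentiating this along a, with the
  projector stationary, shows that \<open>line_of v\<close> fixes a. Hence the velocity of a lift
  determines the acceleration of the curve modulo its velocity.\<close>

lemma dir_line_of_eq_0D:
  assumes v: "v \<noteq> 0" and 0: "dir line_of v a = 0"
  obtains k where "a = k *\<^sub>R v"
proof
  have sm: "smooth_at v (\<lambda>w. line_of w $ i $ j)" for i j
    by (intro smooth_at_vec_nth smooth_at_line_of v)
  have d: "dir (\<lambda>w. line_of w $ i $ j) v a = 0" for i j
  proof -
    have "bounded_linear (\<lambda>L::real^3^3. L $ i $ j)"
      by (intro bounded_linear_compose[OF bounded_linear_vec_nth bounded_linear_vec_nth])
    from dir_linear_comp[OF this smooth_at_line_of[OF v]] show ?thesis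
      by (simp add: 0)
  qed
  have nth: "dir (\<lambda>w::real^3. w $ i) v a = a $ i" for i
    by (rule has_derivative_imp_dir) (rule bounded_linear_imp_has_derivative[OF bounded_linear_vec_nth])
  have smn: "smooth_at v (\<lambda>w::real^3. w $ i)" for i
    by (intro smooth_intros)
  have "a $ i = (v \<bullet> a) / (v \<bullet> v) * v $ i" for i
  proof -
    have ev: "eventually (\<lambda>w. (\<Sum>j\<in>UNIV. line_of w $ i $ j * w $ j) = w $ i) (nhds v)"
      using t1_space_nhds[of v 0] v line_of_apply[of _ i]
      by (auto elim!: eventually_mono)
    have 1: "dir (\<lambda>w. \<Sum>j\<in>UNIV. line_of w $ i $ j * w $ j) v a
        = (\<Sum>j\<in>UNIV. line_of v $ i $ j * a $ j)"
      by (subst dir_sum_fun)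
        (auto intro!: smooth_at_mult sm smn simp: dir_bilinear[OF bounded_bilinear_mult sm smn] d nth)
    have 2: "dir (\<lambda>w. \<Sum>j\<in>UNIV. line_of w $ i $ j * w $ j) v a = a $ i"
      unfolding dir_cong[OF smooth_at_sum[OF smooth_at_mult[OF sm smn]] ev] by (rule nth)
    show ?thesis
      by (rule trans[OF trans[OF sym[OF 2] 1] line_of_apply[OF v]])
  qed
  then show "a = ((v \<bullet> a) / (v \<bullet> v)) *\<^sub>R v"
    unfolding vec_eq_iff vector_scaleR_component real_scaleR_def by (rule allI)
qed

text \<open>A path is only a point set, so any smooth curve that stays in it near time 0 is allowed;
  the acceleration is meaningful only modulo the velocity.\<close>

definition path_jet :: "(real^3) set set \<Rightarrow> real^3 \<Rightarrow> real^3 \<Rightarrow> real^3 \<Rightarrow> bool" where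
  "path_jet \<Gamma> p v a \<longleftrightarrow> v \<noteq> 0 \<and>
     (\<exists>\<gamma>\<in>\<Gamma>. \<exists>c. has_jet c p v a \<and> eventually (\<lambda>t. c t \<in> \<gamma>) (nhds 0))"

definition lift :: "(real \<Rightarrow> real^3) \<Rightarrow> real \<Rightarrow> ptm" where
  "lift c t = (c t, line_of (dir c t 1))"

lemma lift_derivative:
  assumes "has_jet c p v a" "v \<noteq> 0"
  shows "smooth_at 0 (lift c)" "lift c 0 = (p, line_of v)" "dir (lift c) 0 1 = (v, dir line_of v a)"
proof -
  have s: "smooth_at 0 c" "smooth_at 0 (\<lambda>t. dir c t 1)"
    using assms smooth_at_dir_const by (auto simp: has_jet_def)
  have l: "smooth_at (dir c 0 1) line_of"
    using assms by (intro smooth_at_line_of) (simp add: has_jet_def)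
  have lc: "smooth_at 0 (\<lambda>t. line_of (dir c t 1))"
    by (rule smooth_at_compose[where f = "\<lambda>t. dir c t 1", OF l s(2)])
  show "smooth_at 0 (lift c)"
    unfolding lift_def[abs_def] by (intro smooth_at_Pair s lc)
  show "lift c 0 = (p, line_of v)"
    using assms by (simp add: lift_def has_jet_def)
  have "dir (\<lambda>t. line_of (dir c t 1)) 0 1 = dir line_of v a"
    using dir_compose[where h = "\<lambda>t. dir c t 1", OF l s(2)] assms by (simp add: has_jet_def)
  then show "dir (lift c) 0 1 = (v, dir line_of v a)"
    unfolding lift_def[abs_def] dir_Pair[OF s(1) lc] using assms by (simp add: has_jet_def)
qed

lemma lift_in_tangential_lift:
  assumes "smooth_at t c" "eventually (\<lambda>s. c s \<in> \<gamma>) (nhds t)" "dir c t 1 \<noteq> 0"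
  shows "lift c t \<in> tangential_lift \<gamma>"
  unfolding lift_def tangential_lift_def
  using assms dir_in_tangent_space[OF assms(1,2)] eventually_nhds_x_imp_x[OF assms(2)] by blast

lemma eventually_lift_in_tangential_lift:
  assumes c: "has_jet c p v a" "v \<noteq> 0" and \<gamma>: "eventually (\<lambda>t. c t \<in> \<gamma>) (nhds 0)"
  shows "eventually (\<lambda>t. lift c t \<in> tangential_lift \<gamma>) (nhds 0)"
proof -
  have s: "smooth_at 0 c" "dir c 0 1 \<noteq> 0"
    using c by (auto simp: has_jet_def)
  have "eventually (\<lambda>t. dir c t 1 \<noteq> 0) (nhds 0)"
    by (rule eventually_smooth_at_neq[OF smooth_at_dir_const[OF s(1)] s(2)])
  with eventually_smooth_at[OF s(1)] iffD2[OF eventually_eventually \<gamma>]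
  show ?thesis
    by eventually_elim (rule lift_in_tangential_lift)
qed

lemma path_jet_in_path_Q: "path_jet \<Gamma> p v a \<Longrightarrow> (p, line_of v) \<in> path_Q \<Gamma>"
proof -
  assume "path_jet \<Gamma> p v a"
  then obtain \<gamma> c where \<gamma>: "\<gamma> \<in> \<Gamma>" "has_jet c p v a" "eventually (\<lambda>t. c t \<in> \<gamma>) (nhds 0)" "v \<noteq> 0"
    by (auto simp: path_jet_def)
  have "lift c 0 \<in> tangential_lift \<gamma>"
    by (rule eventually_nhds_x_imp_x[OF eventually_lift_in_tangential_lift[OF \<gamma>(2,4,3)]])
  then show ?thesis
    using \<gamma> lift_derivative(2)[OF \<gamma>(2,4)] by (auto simp: path_Q_def)
qed

lemma path_jet_in_path_X: "path_jet \<Gamma> p v a \<Longrightarrow> (v, dir line_of v a) \<in> path_X \<Gamma> (p, line_of v)"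
proof -
  assume "path_jet \<Gamma> p v a"
  then obtain \<gamma> c where \<gamma>: "\<gamma> \<in> \<Gamma>" "has_jet c p v a" "eventually (\<lambda>t. c t \<in> \<gamma>) (nhds 0)" "v \<noteq> 0"
    by (auto simp: path_jet_def)
  note ev = eventually_lift_in_tangential_lift[OF \<gamma>(2,4,3)]
  have "smooth_curve_in (tangential_lift \<gamma>) (lift c) (p, line_of v) (v, dir line_of v a)"
    using lift_derivative[OF \<gamma>(2,4)] ev by (simp add: smooth_curve_in_iff)
  moreover have "(p, line_of v) \<in> tangential_lift \<gamma>"
    using eventually_nhds_x_imp_x[OF ev] lift_derivative(2)[OF \<gamma>(2,4)] by simp
  ultimately show ?thesis
    using \<gamma>(1) unfolding path_X_def tangent_space_def by blast
qed

lemma path_jet_reparametrize: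
  assumes "path_jet \<Gamma> p v a" "k \<noteq> 0"
  shows "path_jet \<Gamma> p (k *\<^sub>R v) (k\<^sup>2 *\<^sub>R a + m *\<^sub>R v)"
proof -
  obtain \<gamma> c where \<gamma>: "\<gamma> \<in> \<Gamma>" "has_jet c p v a" "eventually (\<lambda>t. c t \<in> \<gamma>) (nhds 0)" "v \<noteq> 0"
    using assms by (auto simp: path_jet_def)
  have "((\<lambda>t::real. k * t + m / 2 * t\<^sup>2) \<longlongrightarrow> k * 0 + m / 2 * 0\<^sup>2) (nhds 0)"
    by (intro tendsto_intros filterlim_ident)
  then have "eventually (\<lambda>t. c (k * t + m / 2 * t\<^sup>2) \<in> \<gamma>) (nhds 0)"
    using \<gamma>(3) by (auto simp: filterlim_iff)
  with has_jet_reparametrize[OF \<gamma>(2), of k m] \<gamma>(1,4) assms(2) show ?thesis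
    unfolding path_jet_def by auto
qed

lemma path_jet_exists:
  assumes "(p, line_of v) \<in> path_Q \<Gamma>" "v \<noteq> 0"
  obtains a where "path_jet \<Gamma> p v a"
proof -
  obtain \<gamma> u where \<gamma>: "\<gamma> \<in> \<Gamma>" "u \<in> tangent_space \<gamma> p" "u \<noteq> 0" "line_of u = line_of v"
    using assms(1) by (auto simp: path_Q_def tangential_lift_def)
  then obtain c where "smooth_curve_in \<gamma> c p u"
    by (auto simp: tangent_space_def)
  then have "path_jet \<Gamma> p u (dir2 c 0 1 1)"
    using \<gamma> unfolding path_jet_def has_jet_def smooth_curve_in_iff by blast
  moreover obtain k where "k \<noteq> 0" "v = k *\<^sub>R u"
    using line_of_eqD[OF \<gamma>(4,3) assms(2)] by blast
  ultimately show thesis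
    using path_jet_reparametrize[of \<Gamma> p u _ k] that by blast
qed

text \<open>The lifted velocities span a continuous line field, so their limit lies in its value at
  the limit point, which is spanned by the lift belonging to b as well. The jets may come from a
  different path for each n.\<close>

lemma path_jet_limit_unique:
  assumes X: "smooth_line_field (path_Q \<Gamma>) (path_X \<Gamma>)"
    and jets: "\<And>n::nat. path_jet \<Gamma> (p n) (v n) (a n)"
    and p: "p \<longlonglongrightarrow> p0" and v: "v \<longlonglongrightarrow> v0" and a: "a \<longlonglongrightarrow> a0"
    and b: "path_jet \<Gamma> p0 v0 b"
  obtains k where "a0 = b + k *\<^sub>R v0"
proof -
  have v0: "v0 \<noteq> 0"
    using b by (simp add: path_jet_def)
  from bspec[OF X[unfolded smooth_line_field_def] path_jet_in_path_Q[OF b]]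
  obtain W \<xi> where W': "open W \<and> (p0, line_of v0) \<in> W \<and> smooth_on W \<xi> \<and>
      (\<forall>q\<in>path_Q \<Gamma> \<inter> W. \<xi> q \<noteq> 0 \<and> path_X \<Gamma> q = span {\<xi> q})"
    by (elim exE)
  then have W: "open W" "(p0, line_of v0) \<in> W" "smooth_on W \<xi>"
    "\<And>q. q \<in> path_Q \<Gamma> \<inter> W \<Longrightarrow> \<xi> q \<noteq> 0 \<and> path_X \<Gamma> q = span {\<xi> q}"
    by simp_all
  define q where "q n = (p n, line_of (v n))" for n
  define q0 where "q0 = (p0, line_of v0)"
  have "(\<lambda>n. line_of (v n)) \<longlonglongrightarrow> line_of v0"
    by (rule isCont_tendsto_compose[OF smooth_at_isCont[OF smooth_at_line_of[OF v0]] v])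
  then have q: "q \<longlonglongrightarrow> q0"
    unfolding q_def q0_def by (intro tendsto_Pair p)
  have \<xi>: "(\<lambda>n. \<xi> (q n)) \<longlonglongrightarrow> \<xi> q0"
    using isCont_tendsto_compose[OF _ q] smooth_at_isCont[OF smooth_on_imp_smooth_at[OF W(3,1,2)]]
    by (simp add: q0_def)
  have "smooth_at (v0, a0) (\<lambda>x. dir line_of (fst x) (snd x))"
    by (intro smooth_at_dir smooth_intros) (simp add: smooth_at_line_of v0)
  then have dl: "(\<lambda>n. dir line_of (v n) (a n)) \<longlonglongrightarrow> dir line_of v0 a0"
    using isCont_tendsto_compose[OF smooth_at_isCont tendsto_Pair[OF v a]] by fastforce
  have "(v0, dir line_of v0 b) \<in> span {\<xi> q0}"
    using path_jet_in_path_X[OF b] W(4)[of q0] path_jet_in_path_Q[OF b] W(2) by (simp add: q0_def)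
  then obtain s where s: "(v0, dir line_of v0 b) = s *\<^sub>R \<xi> q0"
    by (auto simp: span_singleton)
  have ev: "eventually (\<lambda>n. q n \<in> W) sequentially"
    using q W(1,2) by (auto simp: q0_def dest: topological_tendstoD)
  have fs: "fst (\<xi> q0) \<noteq> 0"
    using s v0 by (metis fst_conv fst_scaleR scaleR_zero_right)
  define r where "r n = (v n \<bullet> fst (\<xi> (q n))) / (fst (\<xi> (q n)) \<bullet> fst (\<xi> (q n)))" for n
  define r0 where "r0 = (v0 \<bullet> fst (\<xi> q0)) / (fst (\<xi> q0) \<bullet> fst (\<xi> q0))"
  have r: "r \<longlonglongrightarrow> r0"
    unfolding r_def r0_def using fs by (intro tendsto_intros v \<xi>) simp
  have "eventually (\<lambda>n. (v n, dir line_of (v n) (a n)) = r n *\<^sub>R \<xi> (q n)) sequentially"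
    using ev
  proof eventually_elim
    case (elim n)
    then have "(v n, dir line_of (v n) (a n)) \<in> span {\<xi> (q n)}"
      using path_jet_in_path_X[OF jets[of n]] W(4)[of "q n"] path_jet_in_path_Q[OF jets[of n]] by (simp add: q_def)
    then obtain t where t: "(v n, dir line_of (v n) (a n)) = t *\<^sub>R \<xi> (q n)"
      by (auto simp: span_singleton)
    then have vt: "v n = t *\<^sub>R fst (\<xi> (q n))"
      by (metis fst_conv fst_scaleR)
    have "v n \<noteq> 0"
      using jets[of n] by (simp add: path_jet_def)
    then have "fst (\<xi> (q n)) \<noteq> 0"
      using vt by auto
    then have "r n = t"
      by (simp add: r_def vt)
    then show ?case
      using t by simp
  qed
  then have "(\<lambda>n. r n *\<^sub>R \<xi> (q n)) \<longlonglongrightarrow> (v0, dir line_of v0 a0)"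
    using tendsto_Pair[OF v dl] tendsto_cong by fastforce
  moreover have "(\<lambda>n. r n *\<^sub>R \<xi> (q n)) \<longlonglongrightarrow> r0 *\<^sub>R \<xi> q0"
    by (intro tendsto_intros r \<xi>)
  ultimately have lim: "(v0, dir line_of v0 a0) = r0 *\<^sub>R \<xi> q0"
    by (rule LIMSEQ_unique)
  have "r0 *\<^sub>R fst (\<xi> q0) = s *\<^sub>R fst (\<xi> q0)"
    using lim s by (metis fst_conv fst_scaleR)
  then have "r0 = s"
    using fs by simp
  then have "dir line_of v0 a0 = dir line_of v0 b"
    using lim s by (metis snd_conv)
  then have "dir line_of v0 (a0 - b) = 0"
    by (simp add: dir_diff[OF smooth_at_line_of[OF v0]])
  then obtain k where "a0 - b = k *\<^sub>R v0"
    by (rule dir_line_of_eq_0D[OF v0])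
  then show thesis
    by (intro that[of k]) (simp add: algebra_simps)
qed

text \<open>\<open>line_of\<close> is continuous away from the zero vector, so openness among lines
  becomes openness among pairs of a point and a vector, a form that suits moving velocities.\<close>

lemma path_Q_locally_open:
  assumes Q: "openin (top_of_set (PT_minus N C)) (path_Q \<Gamma>)"
    and q: "(p, line_of v) \<in> path_Q \<Gamma>" and v: "v \<noteq> 0"
  shows "eventually (\<lambda>q. fst q \<in> N \<longrightarrow> snd q \<notin> C (fst q) \<longrightarrow> (fst q, line_of (snd q)) \<in> path_Q \<Gamma>) (nhds (p, v))"
proof -
  obtain T where T: "open T" "path_Q \<Gamma> = PT_minus N C \<inter> T"
    using Q by (auto simp: openin_open)
  have "smooth_at (p, v) (\<lambda>q. (fst q, line_of (snd q)))"
    using v by (intro smooth_intros smooth_at_compose[where f = snd and g = line_of])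
      (auto intro: smooth_at_line_of smooth_intros)
  from eventually_smooth_at_in_open[OF this T(1)] q T(2)
  have "eventually (\<lambda>q. (fst q, line_of (snd q)) \<in> T) (nhds (p, v))"
    by auto
  then show ?thesis
    unfolding T(2) PT_minus_def by eventually_elim auto
qed

lemma path_Q_transverse:
  assumes Q: "openin (top_of_set (PT_minus N C)) (path_Q \<Gamma>)"
    and C: "\<And>p. p \<in> N \<Longrightarrow> subspace (C p)"
    and q: "(p, line_of v) \<in> path_Q \<Gamma>" and v: "v \<noteq> 0"
  shows "p \<in> N" "v \<notin> C p"
proof -
  have "(p, line_of v) \<in> PT_minus N C"
    using openin_imp_subset[OF Q] q by blast
  then obtain u where u: "p \<in> N" "u \<notin> C p" "line_of u = line_of v"
    by (auto simp: PT_minus_def)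
  then show "p \<in> N" by simp
  have "u \<noteq> 0"
    using u C subspace_0 by blast
  from line_of_eqD[OF u(3)[symmetric] v this] obtain k where "u = k *\<^sub>R v" by blast
  then show "v \<notin> C p"
    using u C subspace_scale by blast
qed

lemma PT_map_line_of:
  assumes "smooth_at p f" "v \<noteq> 0"
  shows "PT_map f (p, line_of v) = (f p, line_of (dir f p v))"
proof -
  define u where "u = (SOME u. u \<noteq> 0 \<and> line_of u = line_of v)"
  have "u \<noteq> 0 \<and> line_of u = line_of v"
    unfolding u_def by (rule someI[of _ v]) (use assms in auto)
  then obtain k where "k \<noteq> 0" "u = k *\<^sub>R v"
    using line_of_eqD[of v u] assms(2) by metis
  then have "line_of (dir f p u) = line_of (dir f p v)"
    by (simp add: dir_scale[OF assms(1)] line_of_scale)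
  then show ?thesis
    by (simp add: PT_map_def u_def)
qed

text \<open>\<open>PT_map f\<close> carries the lift of c to the lift of the image curve, whose
  velocity thus lies in the target line field. Comparison with some target jet b in the same
  direction leaves a multiple of the velocity, which a reparametrization of the target path absorbs.
  The image curve itself is not claimed to lie in a target path.\<close>

lemma maps_path_geometry_path_jet:
  assumes maps: "maps_path_geometry f \<Gamma> \<Gamma>'"
    and X': "smooth_line_field (path_Q \<Gamma>') (path_X \<Gamma>')"
    and f: "smooth_at p f" "bij (dir f p)"
    and jet: "path_jet \<Gamma> p v a"
  shows "path_jet \<Gamma>' (f p) (dir f p v) (dir2 f p v v + dir f p a)"
proof -
  define q where "q = (p, line_of v)"
  define v' where "v' = dir f p v"
  define a' where "a' = dir2 f p v v + dir f p a"
  obtain \<gamma> c where \<gamma>: "\<gamma> \<in> \<Gamma>" "has_jet c p v a" "eventually (\<lambda>t. c t \<in> \<gamma>) (nhds 0)" and v: "v \<noteq> 0"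
    using jet by (auto simp: path_jet_def)
  have v': "v' \<noteq> 0"
    using v dir_zero[OF f(1)] f(2) unfolding v'_def by (metis bij_is_inj injD)
  have q: "q \<in> path_Q \<Gamma>"
    unfolding q_def by (rule path_jet_in_path_Q[OF jet])
  have q': "PT_map f q = (f p, line_of v')"
    unfolding q_def v'_def by (rule PT_map_line_of[OF f(1) v])
  have Q': "PT_map f q \<in> path_Q \<Gamma>'"
    and push: "push_tangent (path_Q \<Gamma>) (PT_map f) q (path_X \<Gamma> q) = path_X \<Gamma>' (PT_map f q)"
    using maps q unfolding maps_path_geometry_def by blast+
  have c0: "smooth_at 0 c" "c 0 = p" "dir c 0 1 = v"
    using \<gamma>(2) by (auto simp: has_jet_def)
  have fc: "has_jet (\<lambda>t. f (c t)) (f p) v' a'"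
    unfolding v'_def a'_def by (rule has_jet_compose[OF \<gamma>(2) f(1)])
  have "eventually (\<lambda>t. lift (\<lambda>t. f (c t)) t = (PT_map f \<circ> lift c) t) (nhds 0)"
  proof -
    have "eventually (\<lambda>t. smooth_at (c t) f) (nhds 0)"
      by (rule eventually_smooth_at_comp) (use c0 f smooth_at_isCont in auto)
    moreover have "eventually (\<lambda>t. dir c t 1 \<noteq> 0) (nhds 0)"
      by (rule eventually_smooth_at_neq[OF smooth_at_dir_const[OF c0(1)]]) (simp add: c0 v)
    ultimately show ?thesis
      using eventually_smooth_at[OF c0(1)]
      by eventually_elim (simp add: lift_def PT_map_line_of dir_compose)
  qed
  moreover have "smooth_at 0 (lift (\<lambda>t. f (c t)))" and
    d: "dir (lift (\<lambda>t. f (c t))) 0 1 = (v', dir line_of v' a')"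
    using lift_derivative[OF fc v'] by auto
  ultimately have "smooth_at 0 (PT_map f \<circ> lift c)" "dir (PT_map f \<circ> lift c) 0 1 = (v', dir line_of v' a')"
    using smooth_at_cong[of 0 "lift (\<lambda>t. f (c t))"] dir_cong[of 0 "lift (\<lambda>t. f (c t))" "PT_map f \<circ> lift c"]
    by (blast, simp)
  then have hvd: "((PT_map f \<circ> lift c) has_vector_derivative (v', dir line_of v' a')) (at 0)"
    using has_jet_imp_has_vector_derivative by metis
  have "eventually (\<lambda>t. lift c t \<in> path_Q \<Gamma>) (nhds 0)"
    using eventually_lift_in_tangential_lift[OF \<gamma>(2) v \<gamma>(3)] \<gamma>(1)
    by (auto simp: path_Q_def elim!: eventually_mono)
  then have "smooth_curve_in (path_Q \<Gamma>) (lift c) q (v, dir line_of v a)"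
    using lift_derivative[OF \<gamma>(2) v] by (simp add: smooth_curve_in_iff q_def)
  then have in_X: "(v', dir line_of v' a') \<in> path_X \<Gamma>' (f p, line_of v')"
    using hvd path_jet_in_path_X[OF jet] push unfolding push_tangent_def q' q_def[symmetric] by blast
  obtain b where b: "path_jet \<Gamma>' (f p) v' b"
    using path_jet_exists Q' v' unfolding q' by blast
  obtain \<xi> where \<xi>: "path_X \<Gamma>' (f p, line_of v') = span {\<xi>}"
  proof -
    from bspec[OF X'[unfolded smooth_line_field_def] Q'[unfolded q']]
    obtain W \<xi> where "open W \<and> (f p, line_of v') \<in> W \<and> smooth_on W \<xi> \<and>
        (\<forall>q\<in>path_Q \<Gamma>' \<inter> W. \<xi> q \<noteq> 0 \<and> path_X \<Gamma>' q = span {\<xi> q})"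
      by (elim exE)
    then show ?thesis
      using Q'[unfolded q'] by (intro that[of "\<xi> (f p, line_of v')"]) simp
  qed
  obtain s t where st: "(v', dir line_of v' a') = s *\<^sub>R \<xi>" "(v', dir line_of v' b) = t *\<^sub>R \<xi>"
    using in_X path_jet_in_path_X[OF b] unfolding \<xi> span_singleton by auto
  then have "v' = s *\<^sub>R fst \<xi>" "v' = t *\<^sub>R fst \<xi>"
    by (metis fst_conv fst_scaleR)+
  then have "s *\<^sub>R fst \<xi> = t *\<^sub>R fst \<xi>" "fst \<xi> \<noteq> 0"
    using v' by auto
  then have "s = t"
    by simp
  have "dir line_of v' a' = s *\<^sub>R snd \<xi>" "dir line_of v' b = t *\<^sub>R snd \<xi>"
    using st by (metis snd_conv snd_scaleR)+
  then have "dir line_of v' a' = dir line_of v' b"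
    by (simp only: \<open>s = t\<close>)
  then have "dir line_of v' (a' - b) = 0"
    by (simp add: dir_diff[OF smooth_at_line_of[OF v']])
  then obtain k where "a' - b = k *\<^sub>R v'"
    by (rule dir_line_of_eq_0D[OF v'])
  then have "a' = 1\<^sup>2 *\<^sub>R b + k *\<^sub>R v'"
    by (simp add: algebra_simps)
  with path_jet_reparametrize[OF b, of 1 k] show ?thesis
    by (simp add: a'_def v'_def)
qed

section \<open>Planar determinants and linear bijections\<close>

definition det2 :: "real^2 \<Rightarrow> real^2 \<Rightarrow> real" where
  "det2 a b = a $ 1 * b $ 2 - a $ 2 * b $ 1"

lemma bounded_bilinear_det2: "bounded_bilinear det2"
proof (rule bilinear_conv_bounded_bilinear[THEN iffD1])
  show "bilinear det2"
    by (auto simp: bilinear_def det2_def intro!: linearI) (simp_all add: algebra_simps)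
qed

interpretation det2: bounded_bilinear det2
  by (rule bounded_bilinear_det2)

lemma det2_self [simp]: "det2 a a = 0"
  by (simp add: det2_def)

lemma det2_swap: "det2 a b = - det2 b a"
  by (simp add: det2_def)

lemma det2_eq_0D:
  assumes "det2 a b = 0" "a \<noteq> 0"
  obtains k where "b = k *\<^sub>R a"
proof
  have "a $ 1 * b $ 2 = a $ 2 * b $ 1"
    using assms by (simp add: det2_def)
  moreover have "a \<bullet> a \<noteq> 0"
    using assms by simp
  ultimately show "b = ((a \<bullet> b) / (a \<bullet> a)) *\<^sub>R a"
    by (simp add: vec_eq_iff forall_2 inner_vec_def sum_2 field_simps)
qed

lemma det2_nondegenerate:
  assumes "a \<noteq> 0" obtains b where "det2 a b \<noteq> 0"
proof -
  have "det2 a (vector [- a $ 2, a $ 1]) = a \<bullet> a"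
    by (simp add: det2_def inner_vec_def sum_2)
  then show thesis
    using assms that by (metis inner_eq_zero_iff)
qed

lemmas smooth_at_det2 [smooth_intros] = smooth_at_bilinear[OF bounded_bilinear_det2]
lemmas dir_det2 = dir_bilinear[OF bounded_bilinear_det2]

lemma inj_linear_bij:
  fixes f :: "'a::euclidean_space \<Rightarrow> 'b::euclidean_space"
  assumes "linear f" "\<And>x. f x = 0 \<Longrightarrow> x = 0" "DIM('a) = DIM('b)"
  shows "bij f"
proof -
  have inj: "inj f"
    using assms linear_injective_0 by blast
  have "dim (range f) = DIM('b)"
    using dim_image_eq[OF assms(1), of UNIV] inj assms(3) by simp
  then have "span (range f) = UNIV"
    by (simp add: dim_eq_full)
  then have "range f = UNIV"
    using linear_subspace_image[OF assms(1) subspace_UNIV] span_eq_iff by metis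
  then show ?thesis
    using inj by (simp add: bij_def)
qed

lemma has_jet_linear:
  assumes L: "bounded_linear L" and c: "has_jet c p v a"
  shows "has_jet (\<lambda>t. L (c t)) (L p) (L v) (L a)"
proof -
  have d: "dir L x w = L w" for x w
    by (rule has_derivative_imp_dir[OF bounded_linear_imp_has_derivative[OF L]])
  show ?thesis
    using has_jet_compose[OF c smooth_at_bounded_linear[OF L, of p]] by (simp add: d)
qed

section \<open>Double fibrations and model curves\<close>

text \<open>\<open>X\<close> spans \<open>D1\<close>, the kernel of the derivative of
  \<open>\<pi>2\<close>, and \<open>Y\<close> spans \<open>D2\<close>, the kernel of that of
  \<open>\<pi>1\<close>. The contact condition is given in the form in which it acts: along a leaf
  of \<open>D2\<close>, which \<open>\<pi>1\<close> maps to a point, the projection of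
  \<open>X\<close> rotates at nonzero speed, and symmetrically.\<close>

locale double_fibration =
  fixes N :: "(real^3) set" and \<pi>1 \<pi>2 :: "real^3 \<Rightarrow> real^2" and X Y :: "real^3 \<Rightarrow> real^3"
  assumes open_N: "open N"
    and smooth_\<pi>1: "p \<in> N \<Longrightarrow> smooth_at p \<pi>1" and smooth_\<pi>2: "p \<in> N \<Longrightarrow> smooth_at p \<pi>2"
    and smooth_X: "p \<in> N \<Longrightarrow> smooth_at p X" and smooth_Y: "p \<in> N \<Longrightarrow> smooth_at p Y"
    and ker_\<pi>1: "p \<in> N \<Longrightarrow> dir \<pi>1 p w = 0 \<longleftrightarrow> (\<exists>k. w = k *\<^sub>R Y p)"
    and ker_\<pi>2: "p \<in> N \<Longrightarrow> dir \<pi>2 p w = 0 \<longleftrightarrow> (\<exists>k. w = k *\<^sub>R X p)"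
    and \<pi>1_X: "p \<in> N \<Longrightarrow> dir \<pi>1 p (X p) \<noteq> 0"
    and \<pi>2_Y: "p \<in> N \<Longrightarrow> dir \<pi>2 p (Y p) \<noteq> 0"
    and contact1: "p \<in> N \<Longrightarrow>
      det2 (dir \<pi>1 p (X p)) (dir (\<lambda>q. dir \<pi>1 q (X q)) p (Y p)) \<noteq> 0"
    and contact2: "p \<in> N \<Longrightarrow>
      det2 (dir \<pi>2 p (Y p)) (dir (\<lambda>q. dir \<pi>2 q (Y q)) p (X p)) \<noteq> 0"
begin

text \<open>Tangent at \<open>\<pi>1 p\<close> of the path \<open>H2\<close> of
  \<open>\<pi>2 p\<close>, as this path is the projection of a \<open>D1\<close> leaf; likewise
  \<open>U2 p\<close> is tangent at \<open>\<pi>2 p\<close> to the path \<open>H1\<close> of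
  \<open>\<pi>1 p\<close>.\<close>

definition U1 :: "real^3 \<Rightarrow> real^2" where "U1 p = dir \<pi>1 p (X p)"
definition U2 :: "real^3 \<Rightarrow> real^2" where "U2 p = dir \<pi>2 p (Y p)"
definition contact_plane :: "real^3 \<Rightarrow> (real^3) set" where
  "contact_plane p = {w. \<exists>a b. w = a *\<^sub>R X p + b *\<^sub>R Y p}"

lemma smooth_U1: "p \<in> N \<Longrightarrow> smooth_at p U1" and smooth_U2: "p \<in> N \<Longrightarrow> smooth_at p U2"
  unfolding U1_def[abs_def] U2_def[abs_def]
  by (intro smooth_at_dir smooth_at_ident smooth_\<pi>1 smooth_\<pi>2 smooth_X smooth_Y, assumption+)+

lemma \<pi>1_Y_eq_0: "p \<in> N \<Longrightarrow> dir \<pi>1 p (k *\<^sub>R Y p) = 0" and \<pi>2_X_eq_0: "p \<in> N \<Longrightarrow> dir \<pi>2 p (k *\<^sub>R X p) = 0"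
  using ker_\<pi>1 ker_\<pi>2 by blast+

lemma U1_neq_0: "p \<in> N \<Longrightarrow> U1 p \<noteq> 0" and U2_neq_0: "p \<in> N \<Longrightarrow> U2 p \<noteq> 0"
  using \<pi>1_X \<pi>2_Y by (auto simp: U1_def U2_def)

text \<open>The derivative of \<open>\<pi>1\<close> maps the plane onto the line of
  \<open>U1 p\<close> and has its kernel inside the plane, which is therefore the full preimage of
  that line.\<close>

lemma contact_plane_iff1: "p \<in> N \<Longrightarrow> w \<in> contact_plane p \<longleftrightarrow> det2 (U1 p) (dir \<pi>1 p w) = 0"
proof
  assume p: "p \<in> N" and "w \<in> contact_plane p"
  then show "det2 (U1 p) (dir \<pi>1 p w) = 0"
    by (auto simp: contact_plane_def dir_add[OF smooth_\<pi>1] dir_scale[OF smooth_\<pi>1, of p _ "X p"]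
        \<pi>1_Y_eq_0 U1_def det2.scaleR_right)
next
  assume p: "p \<in> N" and "det2 (U1 p) (dir \<pi>1 p w) = 0"
  then obtain k where "dir \<pi>1 p w = k *\<^sub>R U1 p"
    using det2_eq_0D[OF _ U1_neq_0] by metis
  then have "dir \<pi>1 p (w - k *\<^sub>R X p) = 0"
    using p by (simp add: dir_diff[OF smooth_\<pi>1] dir_scale[OF smooth_\<pi>1] U1_def)
  then obtain m where "w - k *\<^sub>R X p = m *\<^sub>R Y p"
    using ker_\<pi>1[OF p] by blast
  then have "w = k *\<^sub>R X p + m *\<^sub>R Y p"
    by (simp add: algebra_simps)
  then show "w \<in> contact_plane p"
    by (auto simp: contact_plane_def)
qed

lemma subspace_contact_plane: "p \<in> N \<Longrightarrow> subspace (contact_plane p)"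
  by (auto simp: subspace_def contact_plane_iff1 dir_add[OF smooth_\<pi>1] dir_scale[OF smooth_\<pi>1]
      dir_zero[OF smooth_\<pi>1] det2.add_right det2.scaleR_right det2.zero_right)

end

lemma (in double_fibration) swap: "double_fibration N \<pi>2 \<pi>1 Y X"
  by unfold_locales
    (use open_N smooth_\<pi>1 smooth_\<pi>2 smooth_X smooth_Y ker_\<pi>1 ker_\<pi>2 \<pi>1_X \<pi>2_Y contact1 contact2 in auto)

context double_fibration
begin

lemma contact_plane_iff2: "p \<in> N \<Longrightarrow> w \<in> contact_plane p \<longleftrightarrow> det2 (U2 p) (dir \<pi>2 p w) = 0"
proof -
  interpret s: double_fibration N \<pi>2 \<pi>1 Y X by (rule swap)
  have "s.contact_plane = contact_plane" "s.U1 = U2"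
    by (auto simp: fun_eq_iff s.contact_plane_def contact_plane_def s.U1_def U2_def) (metis add.commute)+
  then show "p \<in> N \<Longrightarrow> w \<in> contact_plane p \<longleftrightarrow> det2 (U2 p) (dir \<pi>2 p w) = 0"
    using s.contact_plane_iff1 by simp
qed

text \<open>\<open>p\<close> lies on the Lewy curve of \<open>(\<pi>1 r, \<pi>2 s)\<close>, which has direction \<open>v\<close> there; \<open>r\<close> and \<open>s\<close> witness
  \<open>\<pi>2 p \<in> H1 (\<pi>1 r)\<close> and \<open>\<pi>1 p \<in> H2 (\<pi>2 s)\<close> and single out branches of these possibly self-intersecting
  paths.\<close>

definition configuration :: "real^3 \<Rightarrow> real^3 \<Rightarrow> real^3 \<Rightarrow> real^3 \<Rightarrow> bool" where
  "configuration p r s v \<longleftrightarrow> p \<in> N \<and> r \<in> N \<and> s \<in> N \<and> \<pi>2 r = \<pi>2 p \<and> \<pi>1 s = \<pi>1 p \<and> v \<notin> contact_plane p \<and>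
     det2 (U2 r) (dir \<pi>2 p v) = 0 \<and> det2 (U1 s) (dir \<pi>1 p v) = 0"

text \<open>Fixing the first four components as \<open>(x, y, 0, 0)\<close> gives the Lewy curve of \<open>(x, y)\<close>, and the last one
  parametrizes it.\<close>

definition config_map :: "real^3 \<Rightarrow> (real^3) \<times> (real^3) \<times> (real^3) \<Rightarrow> (real^2) \<times> (real^2) \<times> (real^2) \<times> (real^2) \<times> real" where
  "config_map v = (\<lambda>(p, r, s). (\<pi>1 r, \<pi>2 s, \<pi>1 s - \<pi>1 p, \<pi>2 r - \<pi>2 p, v \<bullet> p))"

text \<open>\<open>v\<close> spans the intersection of a plane through \<open>D2\<close> and a plane through \<open>D1\<close>.\<close>

lemma configuration_direction:
  assumes conf: "configuration p r s v" and kl': "dir \<pi>1 p dp = l *\<^sub>R U1 s" "dir \<pi>2 p dp = k *\<^sub>R U2 r"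
  obtains m where "dp = m *\<^sub>R v"
proof -
  have c: "p \<in> N" "r \<in> N" "s \<in> N" "\<pi>2 r = \<pi>2 p" "\<pi>1 s = \<pi>1 p" "v \<notin> contact_plane p"
     "det2 (U2 r) (dir \<pi>2 p v) = 0" "det2 (U1 s) (dir \<pi>1 p v) = 0"
    using assms by (auto simp: configuration_def)
  obtain m where m: "dir \<pi>1 p v = m *\<^sub>R U1 s"
    using det2_eq_0D[OF c(8) U1_neq_0[OF c(3)]] by blast
  obtain m' where m': "dir \<pi>2 p v = m' *\<^sub>R U2 r"
    using det2_eq_0D[OF c(7) U2_neq_0[OF c(2)]] by blast
  have "m \<noteq> 0"
    using c(6) m contact_plane_iff1[OF c(1), of v] by (auto simp: det2.zero_right)
  have "dir \<pi>1 p (dp - (l / m) *\<^sub>R v) = 0"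
    using kl' m \<open>m \<noteq> 0\<close> by (simp add: dir_diff[OF smooth_\<pi>1[OF c(1)]] dir_scale[OF smooth_\<pi>1[OF c(1)]])
  then obtain n where n: "dp - (l / m) *\<^sub>R v = n *\<^sub>R Y p"
    using ker_\<pi>1[OF c(1)] by blast
  have "dir \<pi>2 p (dp - (l / m) *\<^sub>R v) = n *\<^sub>R U2 p"
    unfolding n using c by (simp add: U2_def dir_scale[OF smooth_\<pi>2])
  moreover have "dir \<pi>2 p (dp - (l / m) *\<^sub>R v) = (k - l / m * m') *\<^sub>R U2 r"
    using kl' m' by (simp add: dir_diff[OF smooth_\<pi>2[OF c(1)]] dir_scale[OF smooth_\<pi>2[OF c(1)]] algebra_simps)
  ultimately have "n *\<^sub>R U2 p = (k - l / m * m') *\<^sub>R U2 r"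
    by simp
  \<comment> \<open>Pairing with the projection of v kills \<open>U2 r\<close>, along which v
    projects, but not \<open>U2 p\<close>, because v is transverse to the contact plane.\<close>
  then have "n * det2 (U2 p) (dir \<pi>2 p v) = (k - l / m * m') * det2 (U2 r) (dir \<pi>2 p v)"
    by (metis det2.scaleR_left real_scaleR_def)
  then have "n = 0"
    using c(6,7) contact_plane_iff2[OF c(1)] by simp
  then have "dp = (l / m) *\<^sub>R v"
    using n by simp
  then show thesis
    by (rule that)
qed

text \<open>Both sides have dimension 9. A kernel vector of the derivative moves r along its
  \<open>D2\<close> leaf and s along its \<open>D1\<close> leaf; then p can move only along v, and
  the last component, the inner product with v, excludes this too.\<close>

lemma config_map_inverse:
  assumes "configuration p r s v"
  obtains G V where "open V" "config_map v (p, r, s) \<in> V" "smooth_on V G" "G (config_map v (p, r, s)) = (p, r, s)"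
    "\<And>z. z \<in> V \<Longrightarrow> G z \<in> N \<times> N \<times> N" "\<And>z. z \<in> V \<Longrightarrow> config_map v (G z) = z"
proof -
  have c: "p \<in> N" "r \<in> N" "s \<in> N" "\<pi>2 r = \<pi>2 p" "\<pi>1 s = \<pi>1 p" "v \<notin> contact_plane p"
     "det2 (U2 r) (dir \<pi>2 p v) = 0" "det2 (U1 s) (dir \<pi>1 p v) = 0"
    using assms by (auto simp: configuration_def)
  have sm: "smooth_at (p, r, s) (\<lambda>x. \<pi>1 (fst x))" "smooth_at (p, r, s) (\<lambda>x. \<pi>2 (fst x))"
    "smooth_at (p, r, s) (\<lambda>x. \<pi>1 (fst (snd x)))" "smooth_at (p, r, s) (\<lambda>x. \<pi>2 (fst (snd x)))"
    "smooth_at (p, r, s) (\<lambda>x. \<pi>1 (snd (snd x)))" "smooth_at (p, r, s) (\<lambda>x. \<pi>2 (snd (snd x)))"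
    by (rule smooth_at_compose[where f = fst] smooth_at_compose[where f = "\<lambda>x. fst (snd x)"]
        smooth_at_compose[where f = "\<lambda>x. snd (snd x)"];
        use c in \<open>auto intro!: smooth_\<pi>1 smooth_\<pi>2 smooth_at_fst smooth_at_snd smooth_at_ident\<close>)+
  have cm: "config_map v = (\<lambda>x. (\<pi>1 (fst (snd x)), \<pi>2 (snd (snd x)), \<pi>1 (snd (snd x)) - \<pi>1 (fst x),
      \<pi>2 (fst (snd x)) - \<pi>2 (fst x), v \<bullet> fst x))"
    by (auto simp: config_map_def)
  have smc: "smooth_at (p, r, s) (config_map v)"
    unfolding cm by (intro sm smooth_intros)
  have h: "((\<lambda>x. f (fst x)) has_derivative (\<lambda>x. dir f p (fst x))) (at (p, r, s))"
    "((\<lambda>x. f (fst (snd x))) has_derivative (\<lambda>x. dir f r (fst (snd x)))) (at (p, r, s))"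
    "((\<lambda>x. f (snd (snd x))) has_derivative (\<lambda>x. dir f s (snd (snd x)))) (at (p, r, s))"
    if "smooth_at p f" "smooth_at r f" "smooth_at s f" for f :: "real^3 \<Rightarrow> real^2"
  proof -
    have b: "bounded_linear (\<lambda>x::(real^3) \<times> (real^3) \<times> (real^3). fst (snd x))"
      "bounded_linear (\<lambda>x::(real^3) \<times> (real^3) \<times> (real^3). snd (snd x))"
      by (intro bounded_linear_fst_comp bounded_linear_snd_comp bounded_linear_snd bounded_linear_fst)+
    show "((\<lambda>x. f (fst x)) has_derivative (\<lambda>x. dir f p (fst x))) (at (p, r, s))"
      by (rule has_derivative_compose[OF bounded_linear_imp_has_derivative[OF bounded_linear_fst]])
        (use that[THEN smooth_at_has_derivative] in simp)
    show "((\<lambda>x. f (fst (snd x))) has_derivative (\<lambda>x. dir f r (fst (snd x)))) (at (p, r, s))"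
      by (rule has_derivative_compose[OF bounded_linear_imp_has_derivative[OF b(1)]])
        (use that[THEN smooth_at_has_derivative] in simp)
    show "((\<lambda>x. f (snd (snd x))) has_derivative (\<lambda>x. dir f s (snd (snd x)))) (at (p, r, s))"
      by (rule has_derivative_compose[OF bounded_linear_imp_has_derivative[OF b(2)]])
        (use that[THEN smooth_at_has_derivative] in simp)
  qed
  have "(config_map v has_derivative (\<lambda>x. (dir \<pi>1 r (fst (snd x)), dir \<pi>2 s (snd (snd x)),
      dir \<pi>1 s (snd (snd x)) - dir \<pi>1 p (fst x), dir \<pi>2 r (fst (snd x)) - dir \<pi>2 p (fst x), v \<bullet> fst x))) (at (p, r, s))"
    unfolding cm using c
    by (intro has_derivative_Pair has_derivative_diff h smooth_\<pi>1 smooth_\<pi>2)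
      (auto intro!: derivative_eq_intros)
  from has_derivative_imp_dir[OF this]
  have d: "dir (config_map v) (p, r, s) (dp, dr, ds) = (dir \<pi>1 r dr, dir \<pi>2 s ds,
      dir \<pi>1 s ds - dir \<pi>1 p dp, dir \<pi>2 r dr - dir \<pi>2 p dp, v \<bullet> dp)" for dp dr ds
    by simp
  have bij: "bij (dir (config_map v) (p, r, s))"
  proof (rule inj_linear_bij[OF linear_dir[OF smc]])
    fix x assume 0: "dir (config_map v) (p, r, s) x = 0"
    obtain dp dr ds where x: "x = (dp, dr, ds)"
      using prod_cases3 by blast
    have eqs: "dir \<pi>1 r dr = 0" "dir \<pi>2 s ds = 0" "dir \<pi>1 s ds = dir \<pi>1 p dp" "dir \<pi>2 r dr = dir \<pi>2 p dp" "v \<bullet> dp = 0"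
      using 0 unfolding x d by (simp_all add: zero_prod_def)
    obtain k l where kl: "dr = k *\<^sub>R Y r" "ds = l *\<^sub>R X s"
      using eqs ker_\<pi>1 ker_\<pi>2 c by blast
    then have kl': "dir \<pi>2 p dp = k *\<^sub>R U2 r" "dir \<pi>1 p dp = l *\<^sub>R U1 s"
      using eqs c by (simp_all add: U1_def U2_def dir_scale[OF smooth_\<pi>1] dir_scale[OF smooth_\<pi>2])
    obtain m where dp: "dp = m *\<^sub>R v"
      using configuration_direction[OF assms kl'(2,1)] by blast
    have "v \<bullet> v \<noteq> 0"
      using c(6) subspace_0[OF subspace_contact_plane[OF c(1)]] by auto
    with dp eqs(5) have "dp = 0"
      by simp
    then have "k = 0" "l = 0"
      using kl' U2_neq_0[OF c(2)] U1_neq_0[OF c(3)] dir_zero[OF smooth_\<pi>2[OF c(1)]] dir_zero[OF smooth_\<pi>1[OF c(1)]]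
      by simp_all
    then show "x = 0"
      using x kl \<open>dp = 0\<close> by (simp add: zero_prod_def)
  qed simp
  have open3: "open (N \<times> N \<times> N)" "(p, r, s) \<in> N \<times> N \<times> N"
    using open_N c by (auto simp: open_Times)
  show thesis
  proof (rule smooth_inverse_function_theorem[OF smc bij open3])
    fix G U V
    assume G: "open V" "config_map v (p, r, s) \<in> V" "smooth_on V G" "(p, r, s) \<in> U" "U \<subseteq> N \<times> N \<times> N"
    "\<And>x. x \<in> U \<Longrightarrow> G (config_map v x) = x" "\<And>y. y \<in> V \<Longrightarrow> G y \<in> U" "\<And>y. y \<in> V \<Longrightarrow> config_map v (G y) = y"
    show thesis
      by (rule that[OF G(1-3) G(6)[OF G(4)] subsetD[OF G(5) G(7)] G(8)])
  qed
qed

text \<open>The incident pairs are the image of the 3-dimensional N in a space of dimension 4, hence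
  a negligible set.\<close>

lemma nonincident_near:
  assumes "open W" "z \<in> W"
  obtains x y where "(x, y) \<in> W" "\<not> incident N \<pi>1 \<pi>2 x y"
proof -
  have "(\<lambda>q. (\<pi>1 q, \<pi>2 q)) differentiable_on N"
    unfolding differentiable_on_def
  proof
    fix q assume q: "q \<in> N"
    show "(\<lambda>q. (\<pi>1 q, \<pi>2 q)) differentiable at q within N"
      by (rule differentiable_at_withinI[OF smooth_at_differentiable[OF smooth_at_Pair[OF smooth_\<pi>1[OF q] smooth_\<pi>2[OF q]]]])
  qed
  then have neg: "negligible ((\<lambda>q. (\<pi>1 q, \<pi>2 q)) ` N)"
    by (intro negligible_differentiable_image_lowdim) simp
  have "\<not> negligible W"
    by (rule open_not_negligible[OF assms(1)]) (use assms(2) in blast)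
  then have "\<not> W \<subseteq> (\<lambda>q. (\<pi>1 q, \<pi>2 q)) ` N"
    using negligible_subset[OF neg] by blast
  then obtain w where "w \<in> W" "w \<notin> (\<lambda>q. (\<pi>1 q, \<pi>2 q)) ` N"
    by blast
  then have "(fst w, snd w) \<in> W" "\<not> incident N \<pi>1 \<pi>2 (fst w) (snd w)"
    by (auto simp: incident_def H2_def prod_eq_iff image_iff)
  then show thesis
    by (rule that)
qed

lemma lewy_curve_iff:
  "p \<in> lewy_curve N \<pi>1 \<pi>2 x y \<longleftrightarrow>
    p \<in> N \<and> (\<exists>r\<in>N. \<pi>1 r = x \<and> \<pi>2 r = \<pi>2 p) \<and> (\<exists>s\<in>N. \<pi>2 s = y \<and> \<pi>1 s = \<pi>1 p)"
  unfolding lewy_curve_def H1_def H2_def by (auto simp: image_iff)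

lemma lewy_curvesI:
  "r \<in> N \<Longrightarrow> s \<in> N \<Longrightarrow> \<not> incident N \<pi>1 \<pi>2 (\<pi>1 r) (\<pi>2 s) \<Longrightarrow>
    lewy_curve N \<pi>1 \<pi>2 (\<pi>1 r) (\<pi>2 s) \<in> lewy_curves N \<pi>1 \<pi>2"
  unfolding lewy_curves_def by blast

abbreviation lewy :: "(real^3) set set" where "lewy \<equiv> lewy_curves N \<pi>1 \<pi>2"

text \<open>The pair \<open>(\<pi>1 r, \<pi>2 s)\<close> may be incident because of some remote
  point of N, so c is not known to lie on a Lewy curve. Inverting \<open>config_map\<close> makes
  the curve depend smoothly on the pair, and nearby nonincident pairs give true Lewy jets that
  converge to the jet of c.\<close>

lemma configuration_curves:
  assumes conf: "configuration p r s v"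
  obtains c rc sc :: "real \<Rightarrow> real^3" and k :: real and pn vn an :: "nat \<Rightarrow> real^3" where "smooth_at 0 c" "smooth_at 0 rc" "smooth_at 0 sc"
    "c 0 = p" "rc 0 = r" "sc 0 = s" "k \<noteq> 0" "dir c 0 1 = k *\<^sub>R v"
    "eventually (\<lambda>t. c t \<in> N \<and> rc t \<in> N \<and> sc t \<in> N \<and> \<pi>1 (rc t) = \<pi>1 r \<and> \<pi>2 (sc t) = \<pi>2 s \<and>
       \<pi>1 (sc t) = \<pi>1 (c t) \<and> \<pi>2 (rc t) = \<pi>2 (c t)) (nhds 0)"
    "\<forall>n. path_jet lewy (pn n) (vn n) (an n)"
    "pn \<longlonglongrightarrow> p" "vn \<longlonglongrightarrow> k *\<^sub>R v" "an \<longlonglongrightarrow> dir2 c 0 1 1"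
proof -
  have cf: "p \<in> N" "r \<in> N" "s \<in> N" "\<pi>2 r = \<pi>2 p" "\<pi>1 s = \<pi>1 p" "v \<notin> contact_plane p"
     "det2 (U2 r) (dir \<pi>2 p v) = 0" "det2 (U1 s) (dir \<pi>1 p v) = 0"
    using assms by (auto simp: configuration_def)
  define z0 where "z0 = config_map v (p, r, s)"
  obtain G V where G: "open V" "z0 \<in> V" "smooth_on V G" "G z0 = (p, r, s)"
    "\<And>z. z \<in> V \<Longrightarrow> G z \<in> N \<times> N \<times> N" "\<And>z. z \<in> V \<Longrightarrow> config_map v (G z) = z"
    unfolding z0_def
  proof (rule config_map_inverse[OF conf], goal_cases)
    case prems: (1 G V)
    show ?case
      by (rule prems(1)[OF prems(2-)])
  qed
  \<comment> \<open>Only the last coordinate of \<open>config_map\<close> varies along a curve; the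
    pair of leaf points and the two differences, which are 0, stay frozen.\<close>
  define e :: "(real^2) \<times> (real^2) \<times> (real^2) \<times> (real^2) \<times> real" where "e = (0, 0, 0, 0, 1)"
  define Z :: "(real^2) \<times> (real^2) \<Rightarrow> (real^2) \<times> (real^2) \<times> (real^2) \<times> (real^2) \<times> real"
    where "Z w = (fst w, snd w, 0, 0, v \<bullet> p)" for w
  have Z0: "Z (\<pi>1 r, \<pi>2 s) = z0"
    using cf by (simp add: Z_def z0_def config_map_def)
  have smG: "smooth_at z G" if "z \<in> V" for z
    using smooth_on_imp_smooth_at[OF G(3,1) that] .
  have hjet: "has_jet (\<lambda>t. z + t *\<^sub>R e) z e 0" for z
  proof -
    have sm: "smooth_at t (\<lambda>t. z + t *\<^sub>R e)" for t
      by (intro smooth_intros)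
    have "((\<lambda>t. z + t *\<^sub>R e) has_derivative (\<lambda>s. s *\<^sub>R e)) (at t)" for t
      by (auto intro!: derivative_eq_intros)
    from has_derivative_imp_dir[OF this] have "dir (\<lambda>t. z + t *\<^sub>R e) t 1 = e" for t
      by simp
    then show ?thesis
      using sm by (simp add: has_jet_def)
  qed
  have Gjet: "has_jet (\<lambda>t. G (z + t *\<^sub>R e)) (G z) (dir G z e) (dir2 G z e e)" if "z \<in> V" for z
    using has_jet_compose[OF hjet smG[OF that]] by (simp add: dir_zero[OF smG[OF that]])
  note cjet = has_jet_linear[OF bounded_linear_fst Gjet]
  have ev: "eventually (\<lambda>t. z + t *\<^sub>R e \<in> V) (nhds 0)" if "z \<in> V" for z
    using eventually_smooth_at_in_open[of 0 "\<lambda>t. z + t *\<^sub>R e" V] hjet[of z] G(1) that by (simp add: has_jet_def)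
  have prp: "fst (G (Z w + t *\<^sub>R e)) \<in> N \<and> fst (snd (G (Z w + t *\<^sub>R e))) \<in> N \<and> snd (snd (G (Z w + t *\<^sub>R e))) \<in> N \<and>
      \<pi>1 (fst (snd (G (Z w + t *\<^sub>R e)))) = fst w \<and> \<pi>2 (snd (snd (G (Z w + t *\<^sub>R e)))) = snd w \<and>
      \<pi>1 (snd (snd (G (Z w + t *\<^sub>R e)))) = \<pi>1 (fst (G (Z w + t *\<^sub>R e))) \<and>
      \<pi>2 (fst (snd (G (Z w + t *\<^sub>R e)))) = \<pi>2 (fst (G (Z w + t *\<^sub>R e))) \<and>
      v \<bullet> fst (G (Z w + t *\<^sub>R e)) = v \<bullet> p + t" if "Z w + t *\<^sub>R e \<in> V" for w t
    using G(5)[OF that] G(6)[OF that]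
    by (cases "G (Z w + t *\<^sub>R e)") (auto simp: config_map_def Z_def e_def)
  \<comment> \<open>The last coordinate is the time, so the velocity has inner product 1 with v.
    This keeps the velocities, and with them the factor m below, away from 0.\<close>
  have speed: "v \<bullet> fst (dir G (Z w) e) = 1" if w: "Z w \<in> V" for w
  proof -
    have "has_jet (\<lambda>t. v \<bullet> fst (G (Z w + t *\<^sub>R e))) (v \<bullet> fst (G (Z w))) (v \<bullet> fst (dir G (Z w) e)) (v \<bullet> fst (dir2 G (Z w) e e))"
      by (rule has_jet_linear[OF bounded_linear_inner_right cjet[OF w]])
    moreover have "eventually (\<lambda>t. v \<bullet> fst (G (Z w + t *\<^sub>R e)) = v \<bullet> p + t) (nhds 0)"
      using ev[OF w] by eventually_elim (use prp in blast)
    ultimately have "has_jet (\<lambda>t. v \<bullet> p + t) (v \<bullet> fst (G (Z w))) (v \<bullet> fst (dir G (Z w) e)) (v \<bullet> fst (dir2 G (Z w) e e))"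
      by (rule has_jet_cong)
    moreover have "((\<lambda>t. v \<bullet> p + t) has_derivative (\<lambda>s. s)) (at 0)"
      by (auto intro!: derivative_eq_intros)
    from has_derivative_imp_dir[OF this] have "dir (\<lambda>t. v \<bullet> p + t) 0 1 = 1" .
    ultimately show ?thesis
      by (simp add: has_jet_def)
  qed
  define c where "c t = fst (G (z0 + t *\<^sub>R e))" for t
  define rc where "rc t = fst (snd (G (z0 + t *\<^sub>R e)))" for t
  define sc where "sc t = snd (snd (G (z0 + t *\<^sub>R e)))" for t
  have evc: "eventually (\<lambda>t. c t \<in> N \<and> rc t \<in> N \<and> sc t \<in> N \<and> \<pi>1 (rc t) = \<pi>1 r \<and> \<pi>2 (sc t) = \<pi>2 s \<and>
       \<pi>1 (sc t) = \<pi>1 (c t) \<and> \<pi>2 (rc t) = \<pi>2 (c t)) (nhds 0)"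
    using ev[OF G(2)] unfolding c_def rc_def sc_def
    by eventually_elim (use prp[of "(\<pi>1 r, \<pi>2 s)"] Z0 in auto)
  have jets: "has_jet c p (fst (dir G z0 e)) (fst (dir2 G z0 e e))"
    using cjet[OF G(2)] G(4) by (simp add: c_def[abs_def])
  have jr: "has_jet rc r (fst (snd (dir G z0 e))) (fst (snd (dir2 G z0 e e)))"
    using has_jet_linear[OF bounded_linear_fst has_jet_linear[OF bounded_linear_snd Gjet[OF G(2)]]] G(4)
    by (simp add: rc_def[abs_def])
  have js: "has_jet sc s (snd (snd (dir G z0 e))) (snd (snd (dir2 G z0 e e)))"
    using has_jet_linear[OF bounded_linear_snd has_jet_linear[OF bounded_linear_snd Gjet[OF G(2)]]] G(4)
    by (simp add: sc_def[abs_def])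
  have const: "dir h q w = 0" if "has_jet b q w a" "smooth_at q h" "eventually (\<lambda>t. h (b t) = k) (nhds 0)"
    for h :: "real^3 \<Rightarrow> real^2" and b q w a k
    using has_jet_cong[OF has_jet_compose[OF that(1,2)] that(3)] by (simp add: has_jet_def)
  have same: "dir h q w = dir h q' w'" if "has_jet b q w a" "smooth_at q h" "has_jet b' q' w' a'" "smooth_at q' h"
    "eventually (\<lambda>t. h (b t) = h (b' t)) (nhds 0)"
    for h :: "real^3 \<Rightarrow> real^2" and b q w a q' b' w' a'
    using has_jet_cong[OF has_jet_compose[OF that(1,2)] that(5)] has_jet_compose[OF that(3,4)] by (simp add: has_jet_def)
  have evs: "eventually (\<lambda>t. \<pi>1 (rc t) = \<pi>1 r) (nhds 0)" "eventually (\<lambda>t. \<pi>2 (sc t) = \<pi>2 s) (nhds 0)"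
    "eventually (\<lambda>t. \<pi>1 (sc t) = \<pi>1 (c t)) (nhds 0)" "eventually (\<lambda>t. \<pi>2 (rc t) = \<pi>2 (c t)) (nhds 0)"
    using evc by (auto elim: eventually_mono)
  obtain k where k: "fst (snd (dir G z0 e)) = k *\<^sub>R Y r"
    using const[OF jr smooth_\<pi>1[OF cf(2)] evs(1)] ker_\<pi>1[OF cf(2)] by blast
  obtain l where l: "snd (snd (dir G z0 e)) = l *\<^sub>R X s"
    using const[OF js smooth_\<pi>2[OF cf(3)] evs(2)] ker_\<pi>2[OF cf(3)] by blast
  have "dir \<pi>1 p (fst (dir G z0 e)) = l *\<^sub>R U1 s"
    using same[OF js smooth_\<pi>1[OF cf(3)] jets smooth_\<pi>1[OF cf(1)] evs(3)]
    by (simp add: l U1_def dir_scale[OF smooth_\<pi>1[OF cf(3)]])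
  moreover have "dir \<pi>2 p (fst (dir G z0 e)) = k *\<^sub>R U2 r"
    using same[OF jr smooth_\<pi>2[OF cf(2)] jets smooth_\<pi>2[OF cf(1)] evs(4)]
    by (simp add: k U2_def dir_scale[OF smooth_\<pi>2[OF cf(2)]])
  ultimately obtain m where m: "fst (dir G z0 e) = m *\<^sub>R v"
    using configuration_direction[OF conf] by blast
  have "m \<noteq> 0"
    using speed[of "(\<pi>1 r, \<pi>2 s)"] G(2) by (auto simp: Z0 m)
  have "\<exists>w. Z w \<in> V \<and> dist w (\<pi>1 r, \<pi>2 s) < inverse (real (Suc n)) \<and> \<not> incident N \<pi>1 \<pi>2 (fst w) (snd w)" for n
  proof -
    have "continuous_on UNIV Z"
      unfolding Z_def by (intro continuous_intros)
    then have "open (Z -` V \<inter> ball (\<pi>1 r, \<pi>2 s) (inverse (real (Suc n))))"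
      using open_vimage[OF G(1)] by blast
    moreover have "(\<pi>1 r, \<pi>2 s) \<in> Z -` V \<inter> ball (\<pi>1 r, \<pi>2 s) (inverse (real (Suc n)))"
      using G(2) Z0 by simp
    ultimately obtain x y where "(x, y) \<in> Z -` V \<inter> ball (\<pi>1 r, \<pi>2 s) (inverse (real (Suc n)))"
      "\<not> incident N \<pi>1 \<pi>2 x y"
      by (rule nonincident_near)
    then show ?thesis
      by (intro exI[of _ "(x, y)"]) (auto simp: dist_commute)
  qed
  then obtain w where w: "\<And>n. Z (w n) \<in> V" "\<And>n. dist (w n) (\<pi>1 r, \<pi>2 s) < inverse (real (Suc n))"
    "\<And>n. \<not> incident N \<pi>1 \<pi>2 (fst (w n)) (snd (w n))"
    by metis
  have wlim: "w \<longlonglongrightarrow> (\<pi>1 r, \<pi>2 s)"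
    by (rule metric_tendsto_imp_tendsto[OF LIMSEQ_inverse_real_of_nat])
      (use w(2) in \<open>auto intro!: always_eventually less_imp_le simp: dist_real_def\<close>)
  have "(\<lambda>n. Z (w n)) \<longlonglongrightarrow> Z (\<pi>1 r, \<pi>2 s)"
    unfolding Z_def by (intro tendsto_intros wlim)
  then have Zlim: "(\<lambda>n. Z (w n)) \<longlonglongrightarrow> z0"
    by (simp add: Z0)
  have "path_jet lewy (fst (G (Z (w n)))) (fst (dir G (Z (w n)) e)) (fst (dir2 G (Z (w n)) e e))" for n
    unfolding path_jet_def
  proof (intro conjI bexI exI)
    show "fst (dir G (Z (w n)) e) \<noteq> 0"
      using speed[OF w(1)[of n]] by auto
    show "has_jet (\<lambda>t. fst (G (Z (w n) + t *\<^sub>R e))) (fst (G (Z (w n)))) (fst (dir G (Z (w n)) e)) (fst (dir2 G (Z (w n)) e e))"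
      by (rule cjet[OF w(1)])
    show "eventually (\<lambda>t. fst (G (Z (w n) + t *\<^sub>R e)) \<in> lewy_curve N \<pi>1 \<pi>2 (fst (w n)) (snd (w n))) (nhds 0)"
      using ev[OF w(1)[of n]]
    proof eventually_elim
      case (elim t)
      from prp[OF this] show ?case
        unfolding lewy_curve_iff by blast
    qed
    have "Z (w n) + 0 *\<^sub>R e \<in> V"
      using w(1) by simp
    from prp[OF this] show "lewy_curve N \<pi>1 \<pi>2 (fst (w n)) (snd (w n)) \<in> lewy"
      using w(3)[of n] lewy_curvesI by metis
  qed
  then have pj: "\<forall>n. path_jet lewy (fst (G (Z (w n)))) (fst (dir G (Z (w n)) e)) (fst (dir2 G (Z (w n)) e e))" ..
  have "isCont (\<lambda>z. fst (G z)) z0" "isCont (\<lambda>z. fst (dir G z e)) z0" "isCont (\<lambda>z. fst (dir2 G z e e)) z0"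
    using smG[OF G(2)] by (intro smooth_at_isCont smooth_at_fst smooth_at_dir_const, assumption)+
  note lims = this[THEN isCont_tendsto_compose, OF Zlim]
  show thesis
  proof (rule that[OF _ _ _ _ _ _ \<open>m \<noteq> 0\<close> _ evc pj])
    show "smooth_at 0 c" "smooth_at 0 rc" "smooth_at 0 sc" "c 0 = p" "rc 0 = r" "sc 0 = s" "dir c 0 1 = m *\<^sub>R v"
      using jets jr js m by (simp_all add: has_jet_def)
    show "(\<lambda>n. fst (G (Z (w n)))) \<longlonglongrightarrow> p" "(\<lambda>n. fst (dir G (Z (w n)) e)) \<longlonglongrightarrow> m *\<^sub>R v"
      "(\<lambda>n. fst (dir2 G (Z (w n)) e e)) \<longlonglongrightarrow> dir2 c 0 1 1"
      using lims jets G(4) m by (simp_all add: has_jet_def)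
  qed
qed

end

section \<open>Lewy jets versus model curves, and regular times\<close>

lemma eventually_reparametrize:
  fixes P :: "real \<Rightarrow> bool"
  assumes "eventually P (nhds 0)"
  shows "eventually (\<lambda>t. P (k * t + m / 2 * t\<^sup>2)) (nhds 0)"
proof -
  have "((\<lambda>t::real. k * t + m / 2 * t\<^sup>2) \<longlongrightarrow> k * 0 + m / 2 * 0\<^sup>2) (nhds 0)"
    by (intro tendsto_intros filterlim_ident)
  then show ?thesis
    using assms by (auto simp: filterlim_iff)
qed

lemma lewy_curves_swap: "lewy_curves N \<pi>2 \<pi>1 = lewy_curves N \<pi>1 \<pi>2"
proof -
  have "lewy_curve N \<pi>2 \<pi>1 y x = lewy_curve N \<pi>1 \<pi>2 x y" for x y
    unfolding lewy_curve_def H1_def H2_def by auto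
  moreover have "incident N \<pi>2 \<pi>1 y x \<longleftrightarrow> incident N \<pi>1 \<pi>2 x y" for x y
    unfolding incident_def H2_def by auto
  ultimately show ?thesis
    unfolding lewy_curves_def by auto
qed

text \<open>A set of reals that contains none of its limit points is discrete, and by the Lindelof
  property countable.\<close>

lemma uncountable_imp_islimpt:
  fixes T :: "real set"
  assumes "uncountable T"
  obtains t where "t \<in> T" "t islimpt T"
proof (rule ccontr)
  assume "\<not> thesis"
  then have "\<forall>t\<in>T. \<exists>S. open S \<and> t \<in> S \<and> (\<forall>s\<in>T. s \<in> S \<longrightarrow> s = t)"
    using that unfolding islimpt_def by metis
  then obtain S where S: "\<And>t. t \<in> T \<Longrightarrow> open (S t) \<and> t \<in> S t \<and> (\<forall>s\<in>T. s \<in> S t \<longrightarrow> s = t)"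
    by metis
  obtain F where F: "F \<subseteq> S ` T" "countable F" "\<Union>F = \<Union>(S ` T)"
    by (rule Lindelof[of "S ` T"]) (use S in auto)
  have "T \<subseteq> (\<lambda>B. THE t. t \<in> T \<and> t \<in> B) ` F"
  proof
    fix t assume t: "t \<in> T"
    then have "t \<in> \<Union>F"
      using F(3) S by blast
    then obtain B u where B: "B \<in> F" "t \<in> B" "u \<in> T" "B = S u"
      using F(1) by blast
    have eq: "x = u" if "x \<in> T \<and> x \<in> B" for x
      using S[OF B(3)] that B(4) by blast
    have "(THE t. t \<in> T \<and> t \<in> B) = t"
    proof (rule the_equality)
      show "t \<in> T \<and> t \<in> B"
        using t B(2) by blast
      show "x = t" if "x \<in> T \<and> x \<in> B" for x
        using eq[OF that] eq[of t] t B(2) by blast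
    qed
    then show "t \<in> (\<lambda>B. THE t. t \<in> T \<and> t \<in> B) ` F"
      using imageI[OF B(1), of "\<lambda>B. THE t. t \<in> T \<and> t \<in> B"] by simp
  qed
  then have "countable T"
    using F(2) countable_subset by blast
  with assms show False by blast
qed

text \<open>The difference quotients along the sequence of zeros all vanish, and they converge to
  the derivative.\<close>

lemma dir_eq_0_of_zeros:
  fixes \<phi> :: "real \<Rightarrow> 'a::real_normed_vector" and tn :: "nat \<Rightarrow> real"
  assumes "smooth_at t \<phi>" "\<phi> t = 0" "\<And>n. \<phi> (tn n) = 0" "\<And>n. tn n \<noteq> t" "tn \<longlonglongrightarrow> t"
  shows "dir \<phi> t 1 = 0"
proof -
  define d where "d = dir \<phi> t 1"
  have "(\<phi> has_derivative (\<lambda>h. h *\<^sub>R d)) (at t)"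
    using has_jet_imp_has_vector_derivative[OF assms(1)] by (simp add: has_vector_derivative_def d_def)
  then have "((\<lambda>y. norm (\<phi> y - \<phi> t - (y - t) *\<^sub>R d) / norm (y - t)) \<longlongrightarrow> 0) (at t)"
    by (simp add: has_derivative_iff_norm)
  moreover have "filterlim tn (at t) sequentially"
    using assms by (auto simp: filterlim_at intro: always_eventually)
  ultimately have "(\<lambda>n. norm (\<phi> (tn n) - \<phi> t - (tn n - t) *\<^sub>R d) / norm (tn n - t)) \<longlonglongrightarrow> 0"
    by (rule filterlim_compose)
  moreover have "norm (\<phi> (tn n) - \<phi> t - (tn n - t) *\<^sub>R d) / norm (tn n - t) = norm d" for n
    using assms by simp
  ultimately have "norm d = 0"
    by (simp add: LIMSEQ_const_iff)
  then show ?thesis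
    by (simp add: d_def)
qed

context double_fibration
begin

text \<open>The model curve is a limit of Lewy jets with the same limiting direction, so
  \<open>path_jet_limit_unique\<close> identifies its acceleration with a modulo v. After a change
  of parameter the given jet is that of a curve that comes with companions in the two
  leaves.\<close>

lemma lewy_jet_model:
  assumes X: "smooth_line_field (path_Q lewy) (path_X lewy)"
    and conf: "configuration p r s v" and jet: "path_jet lewy p v a"
  obtains c rc sc :: "real \<Rightarrow> real^3" where "has_jet c p v a" "smooth_at 0 rc" "smooth_at 0 sc" "rc 0 = r" "sc 0 = s"
    "eventually (\<lambda>t. c t \<in> N \<and> rc t \<in> N \<and> sc t \<in> N \<and> \<pi>1 (rc t) = \<pi>1 r \<and> \<pi>2 (sc t) = \<pi>2 s \<and>
       \<pi>1 (sc t) = \<pi>1 (c t) \<and> \<pi>2 (rc t) = \<pi>2 (c t)) (nhds 0)"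
proof -
  obtain c rc sc :: "real \<Rightarrow> real^3" and k :: real and pn vn an :: "nat \<Rightarrow> real^3" where
    c: "smooth_at 0 c" "smooth_at 0 rc" "smooth_at 0 sc"
    "c 0 = p" "rc 0 = r" "sc 0 = s" "k \<noteq> 0" "dir c 0 1 = k *\<^sub>R v"
    "eventually (\<lambda>t. c t \<in> N \<and> rc t \<in> N \<and> sc t \<in> N \<and> \<pi>1 (rc t) = \<pi>1 r \<and> \<pi>2 (sc t) = \<pi>2 s \<and>
       \<pi>1 (sc t) = \<pi>1 (c t) \<and> \<pi>2 (rc t) = \<pi>2 (c t)) (nhds 0)"
    "\<forall>n. path_jet lewy (pn n) (vn n) (an n)"
    "pn \<longlonglongrightarrow> p" "vn \<longlonglongrightarrow> k *\<^sub>R v" "an \<longlonglongrightarrow> dir2 c 0 1 1"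
    by (rule configuration_curves[OF conf])
  have "path_jet lewy p (k *\<^sub>R v) (k\<^sup>2 *\<^sub>R a)"
    using path_jet_reparametrize[OF jet c(7), of 0] by simp
  from path_jet_limit_unique[OF X spec[OF c(10)] c(11-13) this]
  obtain m where m: "dir2 c 0 1 1 = k\<^sup>2 *\<^sub>R a + m *\<^sub>R k *\<^sub>R v"
    by blast
  have "has_jet c p (k *\<^sub>R v) (k\<^sup>2 *\<^sub>R a + m *\<^sub>R k *\<^sub>R v)"
    using c m by (simp add: has_jet_def)
  \<comment> \<open>Scaling time by 1 / k leaves the tangential excess (m / k) v in the
    acceleration. The second-order coefficient -m / k^2, multiplied by the velocity k v, cancels
    it.\<close>
  from has_jet_reparametrize[OF this, of "1 / k" "- m / k\<^sup>2"]
  have j: "has_jet (\<lambda>t. c (1 / k * t + - m / k\<^sup>2 / 2 * t\<^sup>2)) p v a"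
    using c(7) by (simp add: power2_eq_square scaleR_add_right)
  have sm: "smooth_at 0 (\<lambda>t. h (1 / k * t + - m / k\<^sup>2 / 2 * t\<^sup>2))" if "smooth_at 0 h" for h :: "real \<Rightarrow> real^3"
    using has_jet_reparametrize[of h "h 0" "dir h 0 1" "dir2 h 0 1 1" "1 / k" "- m / k\<^sup>2"] that
    unfolding has_jet_def by blast
  show thesis
    by (rule that[OF j sm[OF c(2)] sm[OF c(3)] _ _ eventually_reparametrize[OF c(9)]]) (use c in simp_all)
qed

lemma lewy_jet_dense:
  assumes conf: "configuration p r s v" and W: "open W" "(p, v) \<in> W"
  obtains p1 v1 a1 where "path_jet lewy p1 v1 a1" "(p1, v1) \<in> W"
proof -
  obtain c rc sc :: "real \<Rightarrow> real^3" and k :: real and pn vn an :: "nat \<Rightarrow> real^3" where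
    "smooth_at 0 c" "smooth_at 0 rc" "smooth_at 0 sc"
    "c 0 = p" "rc 0 = r" "sc 0 = s" and c1: "k \<noteq> 0" and "dir c 0 1 = k *\<^sub>R v"
    "eventually (\<lambda>t. c t \<in> N \<and> rc t \<in> N \<and> sc t \<in> N \<and> \<pi>1 (rc t) = \<pi>1 r \<and> \<pi>2 (sc t) = \<pi>2 s \<and>
       \<pi>1 (sc t) = \<pi>1 (c t) \<and> \<pi>2 (rc t) = \<pi>2 (c t)) (nhds 0)" and
    c2: "\<forall>n. path_jet lewy (pn n) (vn n) (an n)"
    "pn \<longlonglongrightarrow> p" "vn \<longlonglongrightarrow> k *\<^sub>R v" and "an \<longlonglongrightarrow> dir2 c 0 1 1"
    by (rule configuration_curves[OF conf])
  note c = c1 spec[OF c2(1)] c2(2,3)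
  have "(\<lambda>n. (pn n, (1 / k) *\<^sub>R vn n)) \<longlonglongrightarrow> (p, (1 / k) *\<^sub>R k *\<^sub>R v)"
    by (intro tendsto_intros c)
  then have "(\<lambda>n. (pn n, (1 / k) *\<^sub>R vn n)) \<longlonglongrightarrow> (p, v)"
    using c(1) by simp
  from topological_tendstoD[OF this W] obtain n where "(pn n, (1 / k) *\<^sub>R vn n) \<in> W"
    by (auto simp: eventually_sequentially)
  with path_jet_reparametrize[OF c(2)[of n], of "1 / k" 0] c(1) show thesis
    by (intro that) auto
qed

text \<open>Curvature of the projected leaf through s with respect to the parameter of the flow of
  \<open>X\<close>, not arc length.\<close>

definition curvature1 :: "real^3 \<Rightarrow> real" where
  "curvature1 s = det2 (U1 s) (dir U1 s (X s))"

lemma dir2_\<pi>2_X: "s \<in> N \<Longrightarrow> dir2 \<pi>2 s (X s) w + dir \<pi>2 s (dir X s w) = 0"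
proof -
  assume s: "s \<in> N"
  have "eventually (\<lambda>q. q \<in> N) (nhds s)"
    using open_N s by (auto simp: eventually_nhds)
  then have "eventually (\<lambda>q. dir \<pi>2 q (X q) = 0) (nhds s)"
    by eventually_elim (use \<pi>2_X_eq_0[of _ 1] in simp)
  from dir_cong[OF _ this] have "dir (\<lambda>q. dir \<pi>2 q (X q)) s w = 0"
    using s by (simp add: smooth_at_dir smooth_at_ident smooth_\<pi>2 smooth_X)
  moreover have "dir (\<lambda>q. q) s w = w"
    by (rule has_derivative_imp_dir) (rule has_derivative_ident)
  ultimately show ?thesis
    using dir_dir_comp[OF smooth_\<pi>2 smooth_at_ident smooth_X, OF s s, of w] by simp
qed

lemma dir_U1: "s \<in> N \<Longrightarrow> dir U1 s w = dir2 \<pi>1 s (X s) w + dir \<pi>1 s (dir X s w)"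
proof -
  assume s: "s \<in> N"
  have "dir (\<lambda>q. q) s w = w"
    by (rule has_derivative_imp_dir) (rule has_derivative_ident)
  then show ?thesis
    unfolding U1_def[abs_def] using dir_dir_comp[OF smooth_\<pi>1 smooth_at_ident smooth_X, OF s s, of w] by simp
qed

text \<open>The curve \<open>\<pi>1 \<circ> c\<close> runs in the path \<open>H2\<close> of the point \<open>\<pi>2 s\<close>, whose curvature at \<open>\<pi>1 s\<close> only
  depends on \<open>s\<close>.\<close>

lemma lewy_curvature:
  assumes X: "smooth_line_field (path_Q lewy) (path_X lewy)"
    and conf: "configuration p r s v" and jet: "path_jet lewy p v a"
    and l: "dir \<pi>1 p v = l *\<^sub>R U1 s"
  shows "det2 (U1 s) (dir2 \<pi>1 p v v + dir \<pi>1 p a) = l\<^sup>2 * curvature1 s"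
proof -
  obtain c rc sc :: "real \<Rightarrow> real^3" where c: "has_jet c p v a" "smooth_at 0 sc" "sc 0 = s"
    "eventually (\<lambda>t. c t \<in> N \<and> rc t \<in> N \<and> sc t \<in> N \<and> \<pi>1 (rc t) = \<pi>1 r \<and> \<pi>2 (sc t) = \<pi>2 s \<and>
       \<pi>1 (sc t) = \<pi>1 (c t) \<and> \<pi>2 (rc t) = \<pi>2 (c t)) (nhds 0)"
    by (rule lewy_jet_model[OF X conf jet])
  have pN: "p \<in> N" and sN: "s \<in> N"
    using conf by (auto simp: configuration_def)
  define w where "w = dir sc 0 1"
  define b where "b = dir2 sc 0 1 1"
  have sj: "has_jet sc s w b"
    using c by (simp add: has_jet_def w_def b_def)
  have "eventually (\<lambda>t. \<pi>1 (c t) = \<pi>1 (sc t)) (nhds 0)"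
    using c(4) by eventually_elim simp
  from has_jet_unique[OF has_jet_cong[OF has_jet_compose[OF c(1) smooth_\<pi>1[OF pN]] this]
      has_jet_compose[OF sj smooth_\<pi>1[OF sN]]]
  have e1: "dir \<pi>1 p v = dir \<pi>1 s w" "dir2 \<pi>1 p v v + dir \<pi>1 p a = dir2 \<pi>1 s w w + dir \<pi>1 s b"
    by auto
  have "eventually (\<lambda>t. \<pi>2 (sc t) = \<pi>2 s) (nhds 0)"
    using c(4) by eventually_elim simp
  from has_jet_cong[OF has_jet_compose[OF sj smooth_\<pi>2[OF sN]] this]
  have e2: "dir \<pi>2 s w = 0" "dir2 \<pi>2 s w w + dir \<pi>2 s b = 0"
    by (simp_all add: has_jet_def)
  obtain k where k: "w = k *\<^sub>R X s"
    using e2(1) ker_\<pi>2[OF sN] by blast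
  then have "l *\<^sub>R U1 s = k *\<^sub>R U1 s"
    using e1(1) l by (simp add: U1_def dir_scale[OF smooth_\<pi>1[OF sN]])
  then have "w = l *\<^sub>R X s"
    using k U1_neq_0[OF sN] by simp
  note w = this
  have dd: "dir2 g s w w = l\<^sup>2 *\<^sub>R dir2 g s (X s) (X s)" if "smooth_at s g" for g :: "real^3 \<Rightarrow> real^2"
    unfolding w dir2_scale[OF that] by (simp add: power2_eq_square)
  \<comment> \<open>\<open>\<pi>2\<close> is constant along \<open>sc\<close> and along the integral
    curves of \<open>X\<close>. Their velocities at s differ by the factor l, so their accelerations
    differ by the factor l^2 modulo \<open>X\<close>.\<close>
  have "dir \<pi>2 s (b - l\<^sup>2 *\<^sub>R dir X s (X s)) = 0"
    using e2(2) dir2_\<pi>2_X[OF sN, of "X s"]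
    by (simp add: dd smooth_\<pi>2[OF sN] dir_diff dir_scale eq_neg_iff_add_eq_0[symmetric])
  then obtain m where m: "b - l\<^sup>2 *\<^sub>R dir X s (X s) = m *\<^sub>R X s"
    using ker_\<pi>2[OF sN] by blast
  then have "b = l\<^sup>2 *\<^sub>R dir X s (X s) + m *\<^sub>R X s"
    by (simp add: algebra_simps)
  then have "dir2 \<pi>1 s w w + dir \<pi>1 s b = l\<^sup>2 *\<^sub>R dir U1 s (X s) + m *\<^sub>R U1 s"
    by (simp add: dd smooth_\<pi>1[OF sN] dir_add dir_scale dir_U1[OF sN] U1_def scaleR_add_right)
  then show ?thesis
    by (simp add: e1 curvature1_def det2.add_right det2.scaleR_right)
qed

text \<open>A vector killed by the derivative of \<open>\<pi>2\<close> is a multiple of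
  \<open>X s\<close>, and \<omega> detects it since
  \<open>\<omega> \<bullet> U1 s \<noteq> 0\<close>. So one function on the first leaf space and two
  on the second form coordinates on N.\<close>

lemma chart:
  assumes s: "s \<in> N" and \<omega>: "\<omega> \<bullet> U1 s \<noteq> 0" and W: "open W" "s \<in> W"
  obtains G V U where "open V" "(\<omega> \<bullet> \<pi>1 s, \<pi>2 s) \<in> V" "smooth_on V G"
    "open U" "s \<in> U" "U \<subseteq> N \<inter> W" "\<forall>q\<in>U. (\<omega> \<bullet> \<pi>1 q, \<pi>2 q) \<in> V \<and> G (\<omega> \<bullet> \<pi>1 q, \<pi>2 q) = q"
    "\<forall>z\<in>V. G z \<in> U \<and> \<omega> \<bullet> \<pi>1 (G z) = fst z \<and> \<pi>2 (G z) = snd z"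
proof -
  have sm: "smooth_at s (\<lambda>q. (\<omega> \<bullet> \<pi>1 q, \<pi>2 q))"
    by (intro smooth_intros smooth_\<pi>1 smooth_\<pi>2 s)
  have d: "dir (\<lambda>q. (\<omega> \<bullet> \<pi>1 q, \<pi>2 q)) s w = (\<omega> \<bullet> dir \<pi>1 s w, dir \<pi>2 s w)" for w
    using smooth_\<pi>1[OF s] smooth_\<pi>2[OF s]
    by (simp add: dir_Pair smooth_at_inner smooth_at_const dir_linear_comp[OF bounded_linear_inner_right])
  have "bij (dir (\<lambda>q. (\<omega> \<bullet> \<pi>1 q, \<pi>2 q)) s)"
  proof (rule inj_linear_bij[OF linear_dir[OF sm]])
    fix w assume "dir (\<lambda>q. (\<omega> \<bullet> \<pi>1 q, \<pi>2 q)) s w = 0"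
    then have w: "\<omega> \<bullet> dir \<pi>1 s w = 0" "dir \<pi>2 s w = 0"
      by (simp_all add: d zero_prod_def)
    then obtain k where k: "w = k *\<^sub>R X s"
      using ker_\<pi>2[OF s] by blast
    then have "k * (\<omega> \<bullet> U1 s) = 0"
      using w(1) by (simp add: U1_def dir_scale[OF smooth_\<pi>1[OF s]])
    then show "w = 0"
      using \<omega> k by simp
  qed simp
  note bij = this
  have open2: "open (N \<inter> W)" "s \<in> N \<inter> W"
    using open_N W s by auto
  show thesis
  proof (rule smooth_inverse_function_theorem[OF sm bij open2])
    fix G U V
    assume G: "open U" "s \<in> U" "U \<subseteq> N \<inter> W" "open V" "(\<omega> \<bullet> \<pi>1 s, \<pi>2 s) \<in> V"
      "smooth_on V G" "\<And>x. x \<in> U \<Longrightarrow> (\<omega> \<bullet> \<pi>1 x, \<pi>2 x) \<in> V"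
      "\<And>x. x \<in> U \<Longrightarrow> G (\<omega> \<bullet> \<pi>1 x, \<pi>2 x) = x" "\<And>y. y \<in> V \<Longrightarrow> G y \<in> U"
      "\<And>y. y \<in> V \<Longrightarrow> (\<omega> \<bullet> \<pi>1 (G y), \<pi>2 (G y)) = y"
    show thesis
    proof (rule that[OF G(4-6) G(1-3)])
      show "\<forall>q\<in>U. (\<omega> \<bullet> \<pi>1 q, \<pi>2 q) \<in> V \<and> G (\<omega> \<bullet> \<pi>1 q, \<pi>2 q) = q"
        using G(7,8) by blast
      show "\<forall>z\<in>V. G z \<in> U \<and> \<omega> \<bullet> \<pi>1 (G z) = fst z \<and> \<pi>2 (G z) = snd z"
      proof
        fix z assume "z \<in> V"
        from G(9,10)[OF this] show "G z \<in> U \<and> \<omega> \<bullet> \<pi>1 (G z) = fst z \<and> \<pi>2 (G z) = snd z"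
          by (metis fst_conv snd_conv)
      qed
    qed
  qed
qed

text \<open>If points of one leaf of \<open>D1\<close> project to a curve along a sequence of times, then the curve
  is tangent to the projected leaf in the limit.\<close>

lemma tangent_of_accumulation:
  fixes sn :: "nat \<Rightarrow> real^3" and tn :: "nat \<Rightarrow> real"
  assumes s: "s \<in> N" and b: "smooth_at t b" and b0: "\<pi>1 s = b t"
    and sn: "\<And>n. \<pi>2 (sn n) = \<pi>2 s" "\<And>n. \<pi>1 (sn n) = b (tn n)" "sn \<longlonglongrightarrow> s"
    and tn: "\<And>n. tn n \<noteq> t" "tn \<longlonglongrightarrow> t"
  shows "det2 (U1 s) (dir b t 1) = 0"
proof -
  define \<omega> where "\<omega> = U1 s"
  have "\<omega> \<bullet> U1 s \<noteq> 0"
    using U1_neq_0[OF s] by (simp add: \<omega>_def)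
  then obtain G V U where G': "open V" "(\<omega> \<bullet> \<pi>1 s, \<pi>2 s) \<in> V" "smooth_on V G"
    "open U" "s \<in> U" "U \<subseteq> N \<inter> UNIV"
    "\<forall>q\<in>U. (\<omega> \<bullet> \<pi>1 q, \<pi>2 q) \<in> V \<and> G (\<omega> \<bullet> \<pi>1 q, \<pi>2 q) = q"
    "\<forall>z\<in>V. G z \<in> U \<and> \<omega> \<bullet> \<pi>1 (G z) = fst z \<and> \<pi>2 (G z) = snd z"
    by (rule chart[OF s _ open_UNIV UNIV_I])
  note G = G'(1-6) bspec[OF G'(7)] bspec[OF G'(8)]
  \<comment> \<open>The point of the leaf through s that has the same first coordinate as
    \<open>b h\<close>. Once \<open>sn n\<close> lies in the chart it is this point for
    \<open>h = tn n\<close>, so the defect \<phi> vanishes there.\<close>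
  define \<sigma> where "\<sigma> h = G (\<omega> \<bullet> b h, \<pi>2 s)" for h
  define \<phi> where "\<phi> h = b h - \<pi>1 (\<sigma> h)" for h
  have Gs: "G (\<omega> \<bullet> b t, \<pi>2 s) = s" "(\<omega> \<bullet> b t, \<pi>2 s) \<in> V"
    using G(7)[OF G(5)] b0 by auto
  have sb: "smooth_at t (\<lambda>h. (\<omega> \<bullet> b h, \<pi>2 s))"
    by (intro smooth_intros b)
  have \<sigma>: "smooth_at t \<sigma>"
    unfolding \<sigma>_def using smooth_on_imp_smooth_at[OF G(3,1) Gs(2)] by (rule smooth_at_compose[OF _ sb])
  have \<sigma>t: "\<sigma> t = s"
    by (simp add: \<sigma>_def Gs)
  have s\<pi>1: "smooth_at (\<sigma> t) \<pi>1" and s\<pi>2: "smooth_at (\<sigma> t) \<pi>2"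
    using smooth_\<pi>1[OF s] smooth_\<pi>2[OF s] by (simp_all add: \<sigma>t)
  have c\<pi>1: "smooth_at t (\<lambda>h. \<pi>1 (\<sigma> h))"
    by (rule smooth_at_compose[OF s\<pi>1 \<sigma>])
  have \<phi>: "smooth_at t \<phi>"
    unfolding \<phi>_def by (intro smooth_at_diff b c\<pi>1)
  have "eventually (\<lambda>n. sn n \<in> U) sequentially"
    using topological_tendstoD[OF sn(3) G(4,5)] .
  then obtain n0 where n0: "\<And>n. n \<ge> n0 \<Longrightarrow> sn n \<in> U"
    by (auto simp: eventually_sequentially)
  have zero: "\<phi> (tn (n + n0)) = 0" for n
  proof -
    have "G (\<omega> \<bullet> b (tn (n + n0)), \<pi>2 s) = sn (n + n0)"
      using G(7)[OF n0[of "n + n0"]] sn(1,2)[of "n + n0"] by simp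
    then show ?thesis
      by (simp add: \<phi>_def \<sigma>_def sn(2))
  qed
  have "dir \<phi> t 1 = 0"
    by (rule dir_eq_0_of_zeros[where tn = "\<lambda>n. tn (n + n0)", OF \<phi>])
      (use tn b0 zero LIMSEQ_ignore_initial_segment[OF tn(2), of n0] in \<open>simp_all add: \<phi>_def \<sigma>t\<close>)
  moreover have "dir \<phi> t 1 = dir b t 1 - dir \<pi>1 s (dir \<sigma> t 1)"
    unfolding \<phi>_def
    by (intro has_derivative_imp_dir has_derivative_diff smooth_at_has_derivative[OF b])
      (use has_derivative_compose[OF smooth_at_has_derivative[OF \<sigma>] smooth_at_has_derivative[OF s\<pi>1]] \<sigma>t in simp)
  moreover have "dir \<pi>2 s (dir \<sigma> t 1) = 0"
  proof -
    have "eventually (\<lambda>h. \<pi>2 (\<sigma> h) = \<pi>2 s) (nhds t)"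
      using eventually_smooth_at_in_open[OF sb G(1) Gs(2)]
      by eventually_elim (use G(8) in \<open>force simp: \<sigma>_def\<close>)
    from dir_cong[OF smooth_at_compose[OF s\<pi>2 \<sigma>] this] have "dir (\<lambda>h. \<pi>2 (\<sigma> h)) t 1 = 0"
      by simp
    then show ?thesis
      using dir_compose[OF s\<pi>2 \<sigma>, of 1] \<sigma>t by simp
  qed
  then obtain k where "dir \<sigma> t 1 = k *\<^sub>R X s"
    using ker_\<pi>2[OF s] by blast
  ultimately have "dir b t 1 = k *\<^sub>R U1 s"
    by (simp add: U1_def dir_scale[OF smooth_\<pi>1[OF s]])
  then show ?thesis
    by (simp add: det2.scaleR_right)
qed

end

lemma (in double_fibration) tangent_of_accumulation_swap:
  fixes rn :: "nat \<Rightarrow> real^3" and tn :: "nat \<Rightarrow> real"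
  assumes r: "r \<in> N" and b: "smooth_at t b" and b0: "\<pi>2 r = b t"
    and rn: "\<And>n. \<pi>1 (rn n) = \<pi>1 r" "\<And>n. \<pi>2 (rn n) = b (tn n)" "rn \<longlonglongrightarrow> r"
    and tn: "\<And>n. tn n \<noteq> t" "tn \<longlonglongrightarrow> t"
  shows "det2 (U2 r) (dir b t 1) = 0"
proof -
  interpret s: double_fibration N \<pi>2 \<pi>1 Y X by (rule swap)
  show ?thesis
    using s.tangent_of_accumulation[OF assms] by (simp add: s.U1_def U2_def)
qed

context double_fibration
begin

text \<open>Every time has witnesses r and s, but they need not depend continuously on it. N is a
  countable union of compact sets and there are uncountably many times, so uncountably many of them
  have witnesses in one fixed pair of compact sets. At a limit point of these times the witnesses
  converge along a subsequence, and \<open>tangent_of_accumulation\<close> gives the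
  tangency.\<close>

lemma regular_times:
  fixes c :: "real \<Rightarrow> real^3" and e :: real
  assumes c: "smooth_at 0 c" and \<gamma>: "\<gamma> \<in> lewy" "eventually (\<lambda>t. c t \<in> \<gamma>) (nhds 0)"
    and tr: "eventually (\<lambda>t. dir c t 1 \<notin> contact_plane (c t)) (nhds 0)" and "e > 0"
  obtains t r s where "\<bar>t\<bar> < e" "configuration (c t) r s (dir c t 1)"
proof -
  obtain x y where xy: "\<gamma> = lewy_curve N \<pi>1 \<pi>2 x y"
    using \<gamma>(1) by (auto simp: lewy_curves_def)
  obtain d where d: "d > 0" "\<And>t. \<bar>t\<bar> < d \<Longrightarrow> smooth_at t c \<and> c t \<in> \<gamma> \<and> dir c t 1 \<notin> contact_plane (c t)"
    using eventually_conj[OF eventually_smooth_at[OF c] eventually_conj[OF \<gamma>(2) tr]]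
    by (auto simp: eventually_nhds_metric)
  define I where "I = {- min d e <..< min d e}"
  have I: "smooth_at t c" "c t \<in> \<gamma>" "dir c t 1 \<notin> contact_plane (c t)" "\<bar>t\<bar> < e" if "t \<in> I" for t
  proof -
    have "\<bar>t\<bar> < d" "\<bar>t\<bar> < e"
      using that by (auto simp: I_def abs_less_iff)
    with d(2) show "smooth_at t c" "c t \<in> \<gamma>" "dir c t 1 \<notin> contact_plane (c t)" "\<bar>t\<bar> < e"
      by blast+
  qed
  have "uncountable I"
  proof -
    have "- min d e < min d e"
      using d(1) \<open>e > 0\<close> by (simp add: min_def)
    then show ?thesis
      unfolding I_def by (simp only: uncountable_open_interval)
  qed
  obtain K :: "nat \<Rightarrow> (real^3) set" where K: "\<And>n. compact (K n)" "\<And>n. K n \<subseteq> N" "\<Union>(range K) = N"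
  proof (rule open_Union_compact_subsets[OF open_N], goal_cases)
    case prems: (1 C)
    show ?case
      by (rule prems(1)[OF prems(2,3,5)])
  qed
  define T where "T i j = {t \<in> I. (\<exists>r\<in>K i. \<pi>1 r = x \<and> \<pi>2 r = \<pi>2 (c t)) \<and> (\<exists>s\<in>K j. \<pi>2 s = y \<and> \<pi>1 s = \<pi>1 (c t))}" for i j
  have "I \<subseteq> (\<Union>i j. T i j)"
  proof
    fix t assume t: "t \<in> I"
    then obtain r s where "r \<in> N" "\<pi>1 r = x" "\<pi>2 r = \<pi>2 (c t)" "s \<in> N" "\<pi>2 s = y" "\<pi>1 s = \<pi>1 (c t)"
      using I(2)[OF t] unfolding xy lewy_curve_iff by blast
    then show "t \<in> (\<Union>i j. T i j)"
      using t K(3) unfolding T_def by blast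
  qed
  then have "\<exists>i j. uncountable (T i j)"
  proof (rule contrapos_pp)
    assume "\<not> (\<exists>i j. uncountable (T i j))"
    then have "countable (\<Union>i j. T i j)"
      by (intro countable_UN) auto
    then show "\<not> I \<subseteq> (\<Union>i j. T i j)"
      using \<open>uncountable I\<close> countable_subset by blast
  qed
  then obtain i j where "uncountable (T i j)" by blast
  then obtain t where t: "t \<in> T i j" "t islimpt T i j"
    by (rule uncountable_imp_islimpt)
  then obtain tn where tn: "\<And>n::nat. tn n \<in> T i j" "\<And>n. tn n \<noteq> t" "tn \<longlonglongrightarrow> t"
    unfolding islimpt_sequential by blast
  have tI: "t \<in> I"
    using t by (simp add: T_def)
  have "\<forall>n. \<exists>r s. r \<in> K i \<and> s \<in> K j \<and> \<pi>1 r = x \<and> \<pi>2 r = \<pi>2 (c (tn n)) \<and> \<pi>2 s = y \<and> \<pi>1 s = \<pi>1 (c (tn n))"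
    using tn(1) unfolding T_def by blast
  then obtain rn sn where rs: "\<And>n. rn n \<in> K i" "\<And>n. sn n \<in> K j" "\<And>n. \<pi>1 (rn n) = x"
    "\<And>n. \<pi>2 (rn n) = \<pi>2 (c (tn n))" "\<And>n. \<pi>2 (sn n) = y" "\<And>n. \<pi>1 (sn n) = \<pi>1 (c (tn n))"
    by metis
  obtain r f where r: "r \<in> K i" "strict_mono f" "(rn \<circ> f) \<longlonglongrightarrow> r"
    using K(1)[of i] rs(1) unfolding compact_def by metis
  obtain s g where s: "s \<in> K j" "strict_mono g" "((sn \<circ> f) \<circ> g) \<longlonglongrightarrow> s"
    using K(1)[of j] rs(2) unfolding compact_def by (metis comp_apply)
  define h where "h = f \<circ> g"
  have h: "strict_mono h"
    unfolding h_def using r(2) s(2) by (rule strict_mono_o)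
  have rl: "(\<lambda>n. rn (h n)) \<longlonglongrightarrow> r"
    using LIMSEQ_subseq_LIMSEQ[OF r(3) s(2)] by (simp add: h_def comp_def)
  have sl: "(\<lambda>n. sn (h n)) \<longlonglongrightarrow> s"
    using s(3) by (simp add: h_def comp_def)
  have tl: "(\<lambda>n. tn (h n)) \<longlonglongrightarrow> t"
    using LIMSEQ_subseq_LIMSEQ[OF tn(3) h] by (simp add: comp_def)
  have N: "c t \<in> N" "r \<in> N" "s \<in> N"
    using I(2)[OF tI] r s K(2) unfolding xy lewy_curve_iff by auto
  have cl: "(\<lambda>n. c (tn (h n))) \<longlonglongrightarrow> c t"
    by (rule isCont_tendsto_compose[OF smooth_at_isCont[OF I(1)[OF tI]] tl])
  note cont = smooth_at_isCont[THEN isCont_tendsto_compose]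
  have r1: "\<pi>1 r = x"
    using cont[OF smooth_\<pi>1[OF N(2)] rl] LIMSEQ_unique[OF _ tendsto_const] by (auto simp: rs)
  have r2: "\<pi>2 r = \<pi>2 (c t)"
    using cont[OF smooth_\<pi>2[OF N(2)] rl] cont[OF smooth_\<pi>2[OF N(1)] cl] LIMSEQ_unique by (auto simp: rs)
  have s2: "\<pi>2 s = y"
    using cont[OF smooth_\<pi>2[OF N(3)] sl] LIMSEQ_unique[OF _ tendsto_const] by (auto simp: rs)
  have s1: "\<pi>1 s = \<pi>1 (c t)"
    using cont[OF smooth_\<pi>1[OF N(3)] sl] cont[OF smooth_\<pi>1[OF N(1)] cl] LIMSEQ_unique by (auto simp: rs)
  have sm: "smooth_at t (\<lambda>t. \<pi>1 (c t))" "smooth_at t (\<lambda>t. \<pi>2 (c t))"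
    using I(1)[OF tI] smooth_\<pi>1[OF N(1)] smooth_\<pi>2[OF N(1)] by (auto intro: smooth_at_compose)
  have "det2 (U1 s) (dir (\<lambda>t. \<pi>1 (c t)) t 1) = 0"
    by (rule tangent_of_accumulation[OF N(3) sm(1) s1 _ _ sl _ tl]) (use rs s2 tn in auto)
  moreover have "det2 (U2 r) (dir (\<lambda>t. \<pi>2 (c t)) t 1) = 0"
    by (rule tangent_of_accumulation_swap[OF N(2) sm(2) r2 _ _ rl _ tl]) (use rs r1 tn in auto)
  ultimately have "configuration (c t) r s (dir c t 1)"
    unfolding configuration_def using N r2 s1 I(1,3)[OF tI] dir_compose[OF smooth_\<pi>1[OF N(1)] I(1)[OF tI]]
      dir_compose[OF smooth_\<pi>2[OF N(1)] I(1)[OF tI]] by simp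
  then show thesis
    by (rule that[OF I(4)[OF tI]])
qed

end

context double_fibration
begin

lemma transverse_open:
  assumes "p \<in> N" "v \<notin> contact_plane p"
  shows "eventually (\<lambda>q. fst q \<in> N \<and> snd q \<notin> contact_plane (fst q)) (nhds (p, v))"
proof -
  have "smooth_at (p, v) (\<lambda>q. det2 (U1 (fst q)) (dir \<pi>1 (fst q) (snd q)))"
    using assms(1)
    by (intro smooth_intros smooth_at_dir smooth_at_compose[where f = fst and g = U1]) (auto intro: smooth_U1 smooth_\<pi>1 smooth_intros)
  from eventually_smooth_at_neq[OF this, of 0] assms
  have "eventually (\<lambda>q. det2 (U1 (fst q)) (dir \<pi>1 (fst q) (snd q)) \<noteq> 0) (nhds (p, v))"
    by (simp add: contact_plane_iff1)
  moreover have "eventually (\<lambda>q. fst q \<in> N) (nhds (p, v))"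
    using eventually_smooth_at_in_open[OF smooth_at_fst[OF smooth_at_ident] open_N, of "(p, v)"] assms by simp
  ultimately show ?thesis
    by eventually_elim (simp add: contact_plane_iff1)
qed

text \<open>By the contact condition \<open>U2\<close> rotates along the \<open>D1\<close> leaf of
  r, so base point and direction of \<open>U2\<close> together are local coordinates on N. The point
  r1 is found by inverting them.\<close>

lemma leaf_point:
  assumes r: "r \<in> N" and w0: "w0 \<noteq> 0" "det2 (U2 r) w0 = 0" and W: "open W" "r \<in> W"
  shows "eventually (\<lambda>z. \<exists>r1\<in>N \<inter> W. \<pi>2 r1 = fst z \<and> det2 (U2 r1) (snd z) = 0) (nhds (\<pi>2 r, w0))"
proof -
  obtain k where k: "w0 = k *\<^sub>R U2 r"
    using det2_eq_0D[OF w0(2) U2_neq_0[OF r]] by blast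
  then have k0: "k \<noteq> 0"
    using w0 by auto
  have in0: "w0 \<bullet> U2 r \<noteq> 0"
    using k k0 U2_neq_0[OF r] by simp
  \<comment> \<open>The second component is the tangent of the angle from \<open>w0\<close> to
    \<open>U2 q\<close>, a coordinate for directions near that of \<open>w0\<close>.\<close>
  define F where "F q = (\<pi>2 q, det2 w0 (U2 q) / (w0 \<bullet> U2 q))" for q
  have sd: "smooth_at r (\<lambda>q. det2 w0 (U2 q))" "smooth_at r (\<lambda>q. w0 \<bullet> U2 q)"
    by (intro smooth_intros smooth_U2 r)+
  have sF: "smooth_at r F"
    unfolding F_def using in0 by (intro smooth_intros sd smooth_\<pi>2 r)
  have zero: "det2 w0 (U2 r) = 0"
    by (simp add: k det2.scaleR_left)
  have "((\<lambda>q. det2 w0 (U2 q)) has_derivative (\<lambda>h. det2 w0 (dir U2 r h))) (at r)"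
    by (rule bounded_linear.has_derivative[OF det2.bounded_linear_right smooth_at_has_derivative[OF smooth_U2[OF r]]])
  from has_derivative_divide[OF this smooth_at_has_derivative[OF sd(2)] in0]
  have "((\<lambda>q. det2 w0 (U2 q) / (w0 \<bullet> U2 q)) has_derivative (\<lambda>h. det2 w0 (dir U2 r h) / (w0 \<bullet> U2 r))) (at r)"
    by (simp add: zero in0)
  from has_derivative_imp_dir[OF has_derivative_Pair[OF smooth_at_has_derivative[OF smooth_\<pi>2[OF r]] this]]
  have dF: "dir F r h = (dir \<pi>2 r h, det2 w0 (dir U2 r h) / (w0 \<bullet> U2 r))" for h
    by (simp add: F_def[abs_def])
  have "bij (dir F r)"
  proof (rule inj_linear_bij[OF linear_dir[OF sF]])
    fix h assume "dir F r h = 0"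
    then have h: "dir \<pi>2 r h = 0" "det2 w0 (dir U2 r h) = 0"
      using in0 by (simp_all add: dF zero_prod_def)
    then obtain c where c: "h = c *\<^sub>R X r"
      using ker_\<pi>2[OF r] by blast
    then have "k * c * det2 (U2 r) (dir U2 r (X r)) = 0"
      using h(2) by (auto simp: k dir_scale[OF smooth_U2[OF r]] det2.scaleR_left det2.scaleR_right)
    then show "h = 0"
      using k0 c contact2[OF r] by (simp add: U2_def[abs_def])
  qed simp
  note bij = this
  have "eventually (\<lambda>q. w0 \<bullet> U2 q \<noteq> 0) (nhds r)"
    by (rule eventually_smooth_at_neq[OF sd(2) in0])
  then obtain W' where W': "open W'" "r \<in> W'" "\<And>q. q \<in> W' \<Longrightarrow> w0 \<bullet> U2 q \<noteq> 0"
    by (auto simp: eventually_nhds)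
  have open3: "open (N \<inter> W \<inter> W')" "r \<in> N \<inter> W \<inter> W'"
    using open_N W W' r by auto
  show ?thesis
  proof (rule smooth_inverse_function_theorem[OF sF bij open3])
    fix G U V
    assume G: "open V" "F r \<in> V" "U \<subseteq> N \<inter> W \<inter> W'" "\<And>y. y \<in> V \<Longrightarrow> G y \<in> U" "\<And>y. y \<in> V \<Longrightarrow> F (G y) = y"
    have sg: "smooth_at (\<pi>2 r, w0) (\<lambda>z. (fst z, det2 w0 (snd z) / (w0 \<bullet> snd z)))"
      using w0 by (intro smooth_intros) simp
    have "eventually (\<lambda>z. (fst z, det2 w0 (snd z) / (w0 \<bullet> snd z)) \<in> V) (nhds (\<pi>2 r, w0))"
      using eventually_smooth_at_in_open[OF sg G(1)] G(2) by (simp add: F_def zero)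
    moreover have "eventually (\<lambda>z. w0 \<bullet> snd z \<noteq> 0) (nhds (\<pi>2 r, w0))"
      by (rule eventually_smooth_at_neq) (use w0 in \<open>auto intro!: smooth_intros\<close>)
    ultimately show ?thesis
    proof eventually_elim
      case (elim z)
      define r1 where "r1 = G (fst z, det2 w0 (snd z) / (w0 \<bullet> snd z))"
      have r1: "r1 \<in> N \<inter> W" "w0 \<bullet> U2 r1 \<noteq> 0"
        using G(3) G(4)[OF elim(1)] W'(3) unfolding r1_def by blast+
      have Fr1: "F r1 = (fst z, det2 w0 (snd z) / (w0 \<bullet> snd z))"
        unfolding r1_def by (rule G(5)[OF elim(1)])
      then have "det2 w0 (U2 r1) * (w0 \<bullet> snd z) = det2 w0 (snd z) * (w0 \<bullet> U2 r1)"
        using r1(2) elim(2) by (simp add: F_def field_simps)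
      \<comment> \<open>The subtraction formula for the tangent with denominators cleared: equal
        tangents mean parallel vectors.\<close>
      moreover have "det2 w0 (snd z) * (w0 \<bullet> U2 r1) - det2 w0 (U2 r1) * (w0 \<bullet> snd z)
          = (w0 \<bullet> w0) * det2 (U2 r1) (snd z)"
        by (simp add: det2_def inner_vec_def sum_2 algebra_simps)
      ultimately have "det2 (U2 r1) (snd z) = 0"
        using w0 by simp
      then show ?case
        using Fr1 r1(1) by (auto simp: F_def)
    qed
  qed
qed

end

section \<open>Maps between Lewy path geometries\<close>

locale lewy_map = S: double_fibration N \<pi>1 \<pi>2 X Y + T: double_fibration N' \<pi>1' \<pi>2' X' Y'
  for N \<pi>1 \<pi>2 X Y N' \<pi>1' \<pi>2' X' Y' +
  fixes f :: "real^3 \<Rightarrow> real^3"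
  assumes smooth_f: "p \<in> N \<Longrightarrow> smooth_at p f" and f_in: "p \<in> N \<Longrightarrow> f p \<in> N'"
    and bij_f: "p \<in> N \<Longrightarrow> bij (dir f p)"
    and Q: "openin (top_of_set (PT_minus N S.contact_plane)) (path_Q S.lewy)"
    and QX: "smooth_line_field (path_Q S.lewy) (path_X S.lewy)"
    and Q': "openin (top_of_set (PT_minus N' T.contact_plane)) (path_Q T.lewy)"
    and QX': "smooth_line_field (path_Q T.lewy) (path_X T.lewy)"
    and maps: "maps_path_geometry f S.lewy T.lewy"
begin

lemma path_jet_transverse:
  "path_jet S.lewy p v a \<Longrightarrow> p \<in> N \<and> v \<notin> S.contact_plane p"
proof -
  assume h: "path_jet S.lewy p v a"
  then have "v \<noteq> 0"
    by (simp add: path_jet_def)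
  from path_Q_transverse[OF Q S.subspace_contact_plane path_jet_in_path_Q[OF h] this]
  show "p \<in> N \<and> v \<notin> S.contact_plane p"
    by simp
qed

lemma path_jet_image:
  assumes "path_jet S.lewy p v a"
  shows "path_jet T.lewy (f p) (dir f p v) (dir2 f p v v + dir f p a)"
proof -
  have p: "p \<in> N" using path_jet_transverse[OF assms] by simp
  show ?thesis
    by (rule maps_path_geometry_path_jet[OF maps QX' smooth_f[OF p] bij_f[OF p] assms])
qed

lemma eventually_path_jet:
  assumes "path_jet S.lewy p v a"
  shows "eventually (\<lambda>q. \<exists>b. path_jet S.lewy (fst q) (snd q) b) (nhds (p, v))"
proof -
  have pv: "p \<in> N" "v \<notin> S.contact_plane p" "v \<noteq> 0" "(p, line_of v) \<in> path_Q S.lewy"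
    using path_jet_transverse[OF assms] path_jet_in_path_Q[OF assms] assms by (auto simp: path_jet_def)
  from path_Q_locally_open[OF Q pv(4,3)] S.transverse_open[OF pv(1,2)]
  show ?thesis
  proof eventually_elim
    case (elim q)
    then have "(fst q, line_of (snd q)) \<in> path_Q S.lewy" "snd q \<noteq> 0"
      using subspace_0[OF S.subspace_contact_plane] by auto
    then show ?case
      using path_jet_exists by blast
  qed
qed

text \<open>A true Lewy jet near (p, v) is mapped to a jet of a target Lewy curve, which has regular
  times arbitrarily close to 0. A local inverse of f pulls position and velocity at such a time back
  to a pair near (p, v). That pair carries a Lewy jet because \<open>path_Q\<close> is open, not
  because the pulled-back curve is known to be a path.\<close>

lemma regular_dense:
  assumes conf: "S.configuration p r s v" and W: "open W" "(p, v) \<in> W"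
  obtains p1 v1 a1 r' s' where "path_jet S.lewy p1 v1 a1" "(p1, v1) \<in> W"
    "T.configuration (f p1) r' s' (dir f p1 v1)"
proof -
  obtain p0 v0 a0 where pj: "path_jet S.lewy p0 v0 a0" and in_W: "(p0, v0) \<in> W"
    by (rule S.lewy_jet_dense[OF conf W])
  have p0: "p0 \<in> N"
    using path_jet_transverse[OF pj] by simp
  obtain \<gamma> c where c: "\<gamma> \<in> T.lewy" "has_jet c (f p0) (dir f p0 v0) (dir2 f p0 v0 v0 + dir f p0 a0)"
    "eventually (\<lambda>t. c t \<in> \<gamma>) (nhds 0)" and v0: "dir f p0 v0 \<noteq> 0"
    using path_jet_image[OF pj] by (auto simp: path_jet_def)
  have sc: "smooth_at 0 c" "c 0 = f p0" "dir c 0 1 = dir f p0 v0"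
    using c(2) by (auto simp: has_jet_def)
  have tr: "eventually (\<lambda>t. dir c t 1 \<notin> T.contact_plane (c t)) (nhds 0)"
    using eventually_lift_in_tangential_lift[OF c(2) v0 c(3)]
      eventually_smooth_at_neq[OF smooth_at_dir_const[OF sc(1)], of 1 0, unfolded sc(3), OF v0]
  proof eventually_elim
    case (elim t)
    then have "(c t, line_of (dir c t 1)) \<in> path_Q T.lewy"
      using c(1) by (auto simp: path_Q_def lift_def)
    from path_Q_transverse(2)[OF Q' T.subspace_contact_plane this elim(2)] show ?case .
  qed
  show thesis
  proof (rule smooth_inverse_function_theorem[OF smooth_f[OF p0] bij_f[OF p0] S.open_N p0])
    fix g U V
    assume G: "open U" "p0 \<in> U" "U \<subseteq> N" "open V" "f p0 \<in> V" "smooth_on V g" "\<And>x. x \<in> U \<Longrightarrow> g (f x) = x"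
      "\<And>y. y \<in> V \<Longrightarrow> g y \<in> U" "\<And>y. y \<in> V \<Longrightarrow> f (g y) = y"
    have sg: "smooth_at y g" if "y \<in> V" for y
      using smooth_on_imp_smooth_at[OF G(6,4) that] .
    have fg: "dir f (g y) (dir g y w) = w" if y: "y \<in> V" for y w
    proof -
      have "smooth_at (g y) f"
        using G(3) G(8)[OF y] smooth_f by blast
      moreover have "eventually (\<lambda>y. f (g y) = y) (nhds y)"
        using G(4,9) y by (auto simp: eventually_nhds)
      from dir_cong[OF smooth_at_compose[OF \<open>smooth_at (g y) f\<close> sg[OF y]] this]
      have "dir (\<lambda>y. f (g y)) y w = w"
        by simp
      ultimately show ?thesis
        using dir_compose[OF _ sg[OF y], of f w] by simp
    qed
    have gf: "dir g (f p0) (dir f p0 v0) = v0"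
    proof -
      have "dir f p0 (dir g (f p0) (dir f p0 v0)) = dir f p0 v0"
        using fg[OF G(5)] G(7)[OF G(2)] by simp
      then show ?thesis
        using bij_is_inj[OF bij_f[OF p0]] by (simp add: inj_eq)
    qed
    have sgc: "smooth_at (c 0) g"
      using sg[OF G(5)] by (simp add: sc)
    have spv: "smooth_at 0 (\<lambda>t. (g (c t), dir g (c t) (dir c t 1)))"
      by (intro smooth_at_Pair smooth_at_compose[OF sgc sc(1)] smooth_at_dir[OF sgc sc(1)] smooth_at_dir_const sc(1))
    have pv0: "(g (c 0), dir g (c 0) (dir c 0 1)) = (p0, v0)"
      using gf G(7)[OF G(2)] by (simp add: sc)
    have "eventually (\<lambda>q. q \<in> W \<and> (\<exists>b. path_jet S.lewy (fst q) (snd q) b)) (nhds (p0, v0))"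
      using eventually_path_jet[OF pj] eventually_nhds_in_open[OF W(1) in_W] by eventually_elim simp
    then have "eventually (\<lambda>t. (g (c t), dir g (c t) (dir c t 1)) \<in> W \<and>
        (\<exists>b. path_jet S.lewy (g (c t)) (dir g (c t) (dir c t 1)) b)) (nhds 0)"
      using smooth_at_tendsto_nhds[OF spv] unfolding pv0 by (auto simp: filterlim_iff)
    moreover have "eventually (\<lambda>t. c t \<in> V) (nhds 0)"
      using eventually_smooth_at_in_open[OF sc(1) G(4)] G(5) by (simp add: sc)
    ultimately have "eventually (\<lambda>t. (g (c t), dir g (c t) (dir c t 1)) \<in> W \<and>
        (\<exists>b. path_jet S.lewy (g (c t)) (dir g (c t) (dir c t 1)) b) \<and> c t \<in> V) (nhds 0)"
      by eventually_elim simp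
    then obtain e where e: "e > 0" "\<And>t. dist t 0 < e \<Longrightarrow> (g (c t), dir g (c t) (dir c t 1)) \<in> W \<and>
        (\<exists>b. path_jet S.lewy (g (c t)) (dir g (c t) (dir c t 1)) b) \<and> c t \<in> V"
      unfolding eventually_nhds_metric by blast
    obtain t r' s' where t: "\<bar>t\<bar> < e" "T.configuration (c t) r' s' (dir c t 1)"
      by (rule T.regular_times[OF sc(1) c(1,3) tr e(1)])
    have "dist t 0 < e"
      using t(1) by (simp add: dist_real_def)
    note et = e(2)[OF this]
    then obtain b where b: "path_jet S.lewy (g (c t)) (dir g (c t) (dir c t 1)) b"
      by blast
    show thesis
      by (rule that[OF b, of r' s']) (use et t(2) G(9) fg in simp_all)
  qed
qed

abbreviation g1 :: "real^3 \<Rightarrow> real^2" where "g1 \<equiv> \<lambda>q. \<pi>1' (f q)"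

lemma smooth_g1: "p \<in> N \<Longrightarrow> smooth_at p g1"
  by (rule smooth_at_compose[OF T.smooth_\<pi>1[OF f_in] smooth_f])

lemma dir_g1: "p \<in> N \<Longrightarrow> dir g1 p v = dir \<pi>1' (f p) (dir f p v)"
  by (rule dir_compose[OF T.smooth_\<pi>1[OF f_in] smooth_f])

text \<open>The branch s' is kept while the direction varies. By \<open>leaf_point\<close> the point
  r' can be adjusted to restore a configuration for every nearby direction whose projection is still
  tangent to the branch, and \<open>lewy_curvature\<close> then involves s' only.\<close>

lemma image_curvature:
  assumes p: "p \<in> N" and conf: "T.configuration (f p) r' s' (dir f p v)"
  shows "eventually (\<lambda>v1. \<forall>a1 l. path_jet S.lewy p v1 a1 \<longrightarrow> dir g1 p v1 = l *\<^sub>R T.U1 s' \<longrightarrow>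
    det2 (T.U1 s') (dir2 g1 p v1 v1 + dir g1 p a1) = l\<^sup>2 * T.curvature1 s') (nhds v)"
proof -
  have cf: "f p \<in> N'" "r' \<in> N'" "s' \<in> N'" "\<pi>2' r' = \<pi>2' (f p)" "\<pi>1' s' = \<pi>1' (f p)"
     "dir f p v \<notin> T.contact_plane (f p)" "det2 (T.U2 r') (dir \<pi>2' (f p) (dir f p v)) = 0"
    using conf by (auto simp: T.configuration_def)
  have "dir \<pi>2' (f p) (dir f p v) \<noteq> 0"
  proof
    assume "dir \<pi>2' (f p) (dir f p v) = 0"
    then have "det2 (T.U2 (f p)) (dir \<pi>2' (f p) (dir f p v)) = 0"
      by (simp only: det2.zero_right)
    with cf(6) show False
      unfolding T.contact_plane_iff2[OF cf(1)] by (rule notE)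
  qed
  from T.leaf_point[OF cf(2) this cf(7) open_UNIV UNIV_I]
  have lp: "eventually (\<lambda>z. \<exists>r1\<in>N' \<inter> UNIV. \<pi>2' r1 = fst z \<and> det2 (T.U2 r1) (snd z) = 0)
      (nhds (\<pi>2' (f p), dir \<pi>2' (f p) (dir f p v)))"
    by (simp only: cf(4))
  have sv: "smooth_at v (\<lambda>v1. dir f p v1)"
    by (intro smooth_at_dir smooth_f[OF p] smooth_intros)
  have sv2: "smooth_at v (\<lambda>v1. (\<pi>2' (f p), dir \<pi>2' (f p) (dir f p v1)))"
    by (intro smooth_at_Pair smooth_at_dir T.smooth_\<pi>2[OF cf(1)] sv smooth_intros)
  have "eventually (\<lambda>v1. \<exists>r1\<in>N'. \<pi>2' r1 = \<pi>2' (f p) \<and> det2 (T.U2 r1) (dir \<pi>2' (f p) (dir f p v1)) = 0) (nhds v)"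
    using smooth_at_tendsto_nhds[OF sv2] lp by (auto simp: filterlim_iff)
  moreover have "eventually (\<lambda>v1. dir f p v1 \<notin> T.contact_plane (f p)) (nhds v)"
  proof -
    have "smooth_at v (\<lambda>v1. det2 (T.U1 (f p)) (dir \<pi>1' (f p) (dir f p v1)))"
      by (intro smooth_at_det2 smooth_at_dir T.smooth_\<pi>1[OF cf(1)] sv smooth_intros)
    from eventually_smooth_at_neq[OF this, of 0] cf(6) show ?thesis
      by (simp add: T.contact_plane_iff1[OF cf(1)])
  qed
  ultimately show ?thesis
  proof eventually_elim
    case (elim v1)
    then obtain r1 where r1: "r1 \<in> N'" "\<pi>2' r1 = \<pi>2' (f p)" "det2 (T.U2 r1) (dir \<pi>2' (f p) (dir f p v1)) = 0"
      by blast
    show ?case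
    proof (intro allI impI)
      fix a1 l assume pj: "path_jet S.lewy p v1 a1" and l: "dir g1 p v1 = l *\<^sub>R T.U1 s'"
      have l': "dir \<pi>1' (f p) (dir f p v1) = l *\<^sub>R T.U1 s'"
        using l by (simp add: dir_g1[OF p])
      have "T.configuration (f p) r1 s' (dir f p v1)"
        unfolding T.configuration_def using cf r1 elim(2) l' by (simp add: det2.scaleR_right)
      from T.lewy_curvature[OF QX' this path_jet_image[OF pj] l']
      show "det2 (T.U1 s') (dir2 g1 p v1 v1 + dir g1 p a1) = l\<^sup>2 * T.curvature1 s'"
        by (simp add: dir2_compose[OF T.smooth_\<pi>1[OF f_in[OF p]] smooth_f[OF p]] dir_g1[OF p]
            dir_add[OF T.smooth_\<pi>1[OF cf(1)]] add.assoc)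
    qed
  qed
qed

end

lemma vec2_eqI:
  fixes \<omega> a b :: "real^2"
  assumes "\<omega> \<noteq> 0" "\<omega> \<bullet> a = \<omega> \<bullet> b" "det2 \<omega> a = det2 \<omega> b"
  shows "a = b"
proof -
  have "\<omega> \<bullet> (a - b) = 0" "det2 \<omega> (a - b) = 0"
    using assms by (simp_all add: inner_diff_right det2.diff_right)
  then obtain k where "a - b = k *\<^sub>R \<omega>" "\<omega> \<bullet> (a - b) = 0"
    using det2_eq_0D[OF _ assms(1)] by metis
  then show ?thesis
    using assms(1) by simp
qed

section \<open>Lewy curves in adapted charts\<close>

text \<open>Coordinates (x, y) on N, where y is the point of the second leaf space and (x, u) are
  the components of \<open>\<pi>1\<close> along \<omega> and, through \<open>det2\<close>, across
  it. Incidence becomes the equation u = u(x, y): for fixed y it describes the path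
  \<open>H2\<close>, for fixed (x, u) the path \<open>H1\<close>.\<close>

locale fibration_chart = double_fibration N \<pi>1 \<pi>2 X Y for N \<pi>1 \<pi>2 X Y +
  fixes \<omega> :: "real^2" and G :: "real \<times> (real^2) \<Rightarrow> real^3" and V :: "(real \<times> (real^2)) set" and U :: "(real^3) set"
  assumes open_V: "open V" and smooth_on_G: "smooth_on V G" and open_U: "open U" and U_N: "U \<subseteq> N"
    and to_chart: "q \<in> U \<Longrightarrow> (\<omega> \<bullet> \<pi>1 q, \<pi>2 q) \<in> V \<and> G (\<omega> \<bullet> \<pi>1 q, \<pi>2 q) = q"
    and from_chart: "z \<in> V \<Longrightarrow> G z \<in> U \<and> \<omega> \<bullet> \<pi>1 (G z) = fst z \<and> \<pi>2 (G z) = snd z"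
    and \<omega>_neq_0: "\<omega> \<noteq> 0"
begin

definition Phi :: "real^3 \<Rightarrow> real \<times> (real^2)" where "Phi q = (\<omega> \<bullet> \<pi>1 q, \<pi>2 q)"
definition u :: "real \<times> (real^2) \<Rightarrow> real" where "u z = det2 \<omega> (\<pi>1 (G z))"

text \<open>\<open>n\<close> spans the direction of the path \<open>H1\<close> of \<open>\<pi>1 (G z)\<close> at \<open>snd z\<close>.\<close>

definition n :: "real \<times> (real^2) \<Rightarrow> real^2" where
  "n z = - dir u z (0, axis 2 1) *\<^sub>R axis 1 1 + dir u z (0, axis 1 1) *\<^sub>R axis 2 1"

lemma G_in_N: "z \<in> V \<Longrightarrow> G z \<in> N" using from_chart U_N by blast
lemma Phi_G: "z \<in> V \<Longrightarrow> Phi (G z) = z" using from_chart[of z] by (simp add: Phi_def prod_eq_iff)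
lemma Phi_in_V: "q \<in> U \<Longrightarrow> Phi q \<in> V" and G_Phi: "q \<in> U \<Longrightarrow> G (Phi q) = q"
  using to_chart by (auto simp: Phi_def)
lemma smooth_G: "z \<in> V \<Longrightarrow> smooth_at z G" using smooth_on_imp_smooth_at[OF smooth_on_G open_V] .

lemma smooth_Phi: "q \<in> N \<Longrightarrow> smooth_at q Phi"
  unfolding Phi_def[abs_def] by (intro smooth_intros smooth_\<pi>1 smooth_\<pi>2)

lemma dir_Phi: "q \<in> N \<Longrightarrow> dir Phi q w = (\<omega> \<bullet> dir \<pi>1 q w, dir \<pi>2 q w)"
  unfolding Phi_def[abs_def] using smooth_\<pi>1 smooth_\<pi>2
  by (simp add: dir_Pair smooth_at_inner smooth_at_const dir_linear_comp[OF bounded_linear_inner_right])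

lemma dir_Phi_G: assumes z: "z \<in> V" shows "dir Phi (G z) (dir G z w) = w"
proof -
  have "eventually (\<lambda>z. Phi (G z) = z) (nhds z)"
    using open_V z Phi_G by (auto simp: eventually_nhds)
  from dir_cong[OF smooth_at_compose[OF smooth_Phi[OF G_in_N[OF z]] smooth_G[OF z]] this]
  show ?thesis
    using dir_compose[OF smooth_Phi[OF G_in_N[OF z]] smooth_G[OF z], of w] by (simp add: dir_ident)
qed

lemma dir_G_Phi: assumes z: "z \<in> V" shows "dir G z (dir Phi (G z) w) = w"
proof -
  have "eventually (\<lambda>q. G (Phi q) = q) (nhds (G z))"
    using open_U from_chart[OF z] G_Phi by (auto simp: eventually_nhds)
  moreover have "smooth_at (Phi (G z)) G"
    using smooth_G[OF z] by (simp add: Phi_G[OF z])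
  ultimately show ?thesis
    using dir_compose[OF _ smooth_Phi[OF G_in_N[OF z]], of G w]
      dir_cong[OF smooth_at_compose[OF _ smooth_Phi[OF G_in_N[OF z]]], of G "\<lambda>q. q"]
    by (simp add: Phi_G[OF z] dir_ident)
qed

lemma chart_coords: "z \<in> V \<Longrightarrow> \<omega> \<bullet> dir \<pi>1 (G z) (dir G z w) = fst w"
  "z \<in> V \<Longrightarrow> dir \<pi>2 (G z) (dir G z w) = snd w"
  using dir_Phi_G[of z w] by (auto simp: dir_Phi[OF G_in_N] prod_eq_iff)

lemma smooth_\<pi>1_G: "z \<in> V \<Longrightarrow> smooth_at z (\<lambda>z. \<pi>1 (G z))"
  by (rule smooth_at_compose[where f = G, OF smooth_\<pi>1[OF G_in_N] smooth_G])

lemma smooth_u: "z \<in> V \<Longrightarrow> smooth_at z u"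
  unfolding u_def[abs_def] by (intro smooth_intros smooth_\<pi>1_G)

lemma dir_u: "z \<in> V \<Longrightarrow> dir u z w = det2 \<omega> (dir \<pi>1 (G z) (dir G z w))"
  unfolding u_def[abs_def]
  by (simp add: dir_linear_comp[OF det2.bounded_linear_right smooth_\<pi>1_G]
      dir_compose[OF smooth_\<pi>1[OF G_in_N] smooth_G])

lemma smooth_n: "z \<in> V \<Longrightarrow> smooth_at z n"
  unfolding n_def[abs_def] by (intro smooth_intros smooth_at_dir_const smooth_u)

text \<open>\<open>n\<close> is the gradient of u in y turned by a right angle, which converts the
  inner product with the gradient into \<open>det2\<close>.\<close>

lemma dir_u_y: assumes z: "z \<in> V" shows "dir u z (0, w) = det2 w (n z)"
proof -
  have w: "(0 :: real, w) = (w $ 1) *\<^sub>R (0, axis 1 1) + (w $ 2) *\<^sub>R (0, axis 2 1)"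
    by (simp add: vec_eq_iff forall_2 axis_def)
  show ?thesis
    unfolding w dir_add[OF smooth_u[OF z]] dir_scale[OF smooth_u[OF z]]
    by (simp add: n_def det2_def axis_def)
qed

lemma dir_u_split: "z \<in> V \<Longrightarrow> dir u z (a, w) = a * dir u z (1, 0) + det2 w (n z)"
proof -
  assume z: "z \<in> V"
  have "(a, w) = a *\<^sub>R (1, 0) + (0, w)"
    by simp
  then show ?thesis
    by (simp only: dir_add[OF smooth_u[OF z]] dir_scale[OF smooth_u[OF z]] dir_u_y[OF z] real_scaleR_def)
qed

text \<open>In the chart \<open>Y\<close> is \<open>(0, U2)\<close>, and u is constant along it to
  first order because \<open>\<pi>1\<close> is.\<close>

lemma n_parallel_U2: assumes z: "z \<in> V" shows "det2 (U2 (G z)) (n z) = 0"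
proof -
  have "dir Phi (G z) (Y (G z)) = (0, U2 (G z))"
    using \<pi>1_Y_eq_0[OF G_in_N[OF z], of 1] by (simp add: dir_Phi[OF G_in_N[OF z]] U2_def)
  then have "dir G z (0, U2 (G z)) = Y (G z)"
    using dir_G_Phi[OF z, of "Y (G z)"] by simp
  then have "dir u z (0, U2 (G z)) = 0"
    using \<pi>1_Y_eq_0[OF G_in_N[OF z], of 1] by (simp add: dir_u[OF z] det2.zero_right)
  then show ?thesis
    by (simp add: dir_u_y[OF z])
qed

lemma n_neq_0: assumes z: "z \<in> V" shows "n z \<noteq> 0"
proof
  assume 0: "n z = 0"
  obtain w where w: "det2 (U2 (G z)) w \<noteq> 0"
    by (rule det2_nondegenerate[OF U2_neq_0[OF G_in_N[OF z]]])
  have "det2 \<omega> (dir \<pi>1 (G z) (dir G z (0, w))) = 0"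
    using dir_u_y[OF z, of w] by (simp add: 0 dir_u[OF z] det2.zero_right)
  then have "dir \<pi>1 (G z) (dir G z (0, w)) = 0"
    using chart_coords(1)[OF z, of "(0, w)"] by (intro vec2_eqI[OF \<omega>_neq_0]) (simp_all add: det2.zero_right)
  then obtain k where "dir G z (0, w) = k *\<^sub>R Y (G z)"
    using ker_\<pi>1[OF G_in_N[OF z]] by blast
  then have "w = k *\<^sub>R U2 (G z)"
    using chart_coords(2)[OF z, of "(0, w)"] by (simp add: U2_def dir_scale[OF smooth_\<pi>2[OF G_in_N[OF z]]])
  with w show False
    by (simp add: det2.scaleR_right)
qed

lemma det2_U2_iff: "z \<in> V \<Longrightarrow> det2 (U2 (G z)) w = 0 \<longleftrightarrow> det2 w (n z) = 0"
proof -
  assume z: "z \<in> V"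
  obtain k where k: "n z = k *\<^sub>R U2 (G z)"
    using det2_eq_0D[OF n_parallel_U2[OF z] U2_neq_0[OF G_in_N[OF z]]] by blast
  then have "k \<noteq> 0"
    using n_neq_0[OF z] by auto
  then show ?thesis
    using det2_swap[of w "U2 (G z)"] by (simp add: k det2.scaleR_right)
qed

lemma dir_G_X: assumes z: "z \<in> V" obtains k where "k \<noteq> 0" "dir G z (1, 0) = k *\<^sub>R X (G z)"
proof -
  have "dir \<pi>2 (G z) (dir G z (1, 0)) = 0"
    using chart_coords(2)[OF z, of "(1, 0)"] by simp
  then obtain k where k: "dir G z (1, 0) = k *\<^sub>R X (G z)"
    using ker_\<pi>2[OF G_in_N[OF z]] by blast
  moreover have "k \<noteq> 0"
    using chart_coords(1)[OF z, of "(1, 0)"] k dir_zero[OF smooth_\<pi>1[OF G_in_N[OF z]]] by auto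
  ultimately show thesis
    by (intro that)
qed

text \<open>The x-direction of the chart is that of \<open>X\<close>, along which \<open>U2\<close>
  rotates. The parallel field \<open>n\<close> must rotate too: multiplying a field by a function
  changes its derivative only by a multiple of the field.\<close>

lemma contact_chart: assumes z: "z \<in> V" shows "det2 (n z) (dir n z (1, 0)) \<noteq> 0"
proof
  assume 0: "det2 (n z) (dir n z (1, 0)) = 0"
  obtain k where k: "k \<noteq> 0" "dir G z (1, 0) = k *\<^sub>R X (G z)"
    by (rule dir_G_X[OF z])
  obtain m where m: "n z = m *\<^sub>R U2 (G z)"
    using det2_eq_0D[OF n_parallel_U2[OF z] U2_neq_0[OF G_in_N[OF z]]] by blast
  then have "m \<noteq> 0"
    using n_neq_0[OF z] by auto
  obtain c where c: "dir n z (1, 0) = c *\<^sub>R n z"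
    by (rule det2_eq_0D[OF 0 n_neq_0[OF z]])
  have sU: "smooth_at z (\<lambda>z. U2 (G z))"
    by (rule smooth_at_compose[OF smooth_U2[OF G_in_N[OF z]] smooth_G[OF z]])
  have "eventually (\<lambda>z. det2 (U2 (G z)) (n z) = 0) (nhds z)"
    using open_V z n_parallel_U2 by (auto simp: eventually_nhds)
  from dir_cong[OF smooth_at_det2[OF sU smooth_n[OF z]] this]
  have "det2 (U2 (G z)) (dir n z (1, 0)) + det2 (dir U2 (G z) (dir G z (1, 0))) (n z) = 0"
    using dir_det2[OF sU smooth_n[OF z], of "(1, 0)"]
      dir_compose[OF smooth_U2[OF G_in_N[OF z]] smooth_G[OF z], of "(1, 0)"] by simp
  then have "k * (m * det2 (dir U2 (G z) (X (G z))) (U2 (G z))) = 0"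
    by (simp add: c m k dir_scale[OF smooth_U2[OF G_in_N[OF z]]] det2.scaleR_left det2.scaleR_right)
  then have "det2 (U2 (G z)) (dir U2 (G z) (X (G z))) = 0"
    using k(1) \<open>m \<noteq> 0\<close> det2_swap[of "U2 (G z)"] by simp
  then show False
    using contact2[OF G_in_N[OF z]] by (simp add: U2_def[abs_def])
qed

text \<open>The leaf through \<open>zs\<close> gives a path in the first leaf space that meets that
  point (x, u) with the slope du/dx of the direction (1, y'). The shifted point lies on the
  \<open>D1\<close> leaf of z and has its \<open>n\<close> parallel to y'. Transversality to the
  contact plane is \<open>det2 y' (n z) \<noteq> 0\<close>, which rules out \<rho> = 0.\<close>

definition chart_config :: "real \<times> (real^2) \<Rightarrow> real \<Rightarrow> real \<times> (real^2) \<Rightarrow> real^2 \<Rightarrow> bool" where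
  "chart_config z \<rho> zs y' \<longleftrightarrow> z \<in> V \<and> (fst z + \<rho>, snd z) \<in> V \<and> zs \<in> V \<and> fst zs = fst z \<and> u zs = u z \<and>
     dir u zs (1, 0) = dir u z (1, y') \<and> det2 y' (n (fst z + \<rho>, snd z)) = 0 \<and> det2 y' (n z) \<noteq> 0"

lemma chart_configuration:
  assumes "chart_config z \<rho> zs y'"
  shows "configuration (G z) (G (fst z + \<rho>, snd z)) (G zs) (dir G z (1, y'))"
proof -
  have c: "z \<in> V" "(fst z + \<rho>, snd z) \<in> V" "zs \<in> V" "fst zs = fst z" "u zs = u z"
     "dir u zs (1, 0) = dir u z (1, y')" "det2 y' (n (fst z + \<rho>, snd z)) = 0" "det2 y' (n z) \<noteq> 0"
    using assms by (auto simp: chart_config_def)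
  have "\<pi>1 (G zs) = \<pi>1 (G z)"
    using c(4,5) from_chart[OF c(1)] from_chart[OF c(3)] by (intro vec2_eqI[OF \<omega>_neq_0]) (simp_all add: u_def)
  moreover have "dir \<pi>1 (G z) (dir G z (1, y')) = dir \<pi>1 (G zs) (dir G zs (1, 0))"
    using c(6) chart_coords(1)[OF c(1)] chart_coords(1)[OF c(3)]
    by (intro vec2_eqI[OF \<omega>_neq_0]) (simp_all add: dir_u[OF c(1)] dir_u[OF c(3)])
  moreover obtain k where "dir G zs (1, 0) = k *\<^sub>R X (G zs)"
    using dir_G_X[OF c(3)] by blast
  ultimately show ?thesis
    unfolding configuration_def
    using c from_chart[OF c(1)] from_chart[OF c(2)] chart_coords(2)[OF c(1)]
    by (simp add: G_in_N contact_plane_iff2 det2_U2_iff U1_def[symmetric] dir_scale[OF smooth_\<pi>1[OF G_in_N[OF c(3)]]] det2.scaleR_right)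
qed

text \<open>Splitting off \<open>x2\<close> times the velocity amounts to using x as curve
  parameter. Each of the two paths yields an identity along the curve, and its second derivative is
  one linear equation for \<open>Y2\<close>.\<close>

lemma chart_jet:
  assumes QX: "smooth_line_field (path_Q lewy) (path_X lewy)"
    and conf: "chart_config z \<rho> zs y'" and pj: "path_jet lewy (G z) (dir G z (1, y')) a"
  obtains x2 Y2 where "a = dir2 G z (1, y') (1, y') + dir G z (0, Y2) + x2 *\<^sub>R dir G z (1, y')"
    "det2 Y2 (n z) = dir2 u zs (1, 0) (1, 0) - dir2 u z (1, y') (1, y')"
    "det2 Y2 (n (fst z + \<rho>, snd z)) = - dir2 u (fst z + \<rho>, snd z) (0, y') (0, y')"
proof -
  define zr where "zr = (fst z + \<rho>, snd z)"
  have cc: "z \<in> V" "zr \<in> V" "zs \<in> V" "fst zs = fst z" "u zs = u z"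
     "dir u zs (1, 0) = dir u z (1, y')" "det2 y' (n zr) = 0" "det2 y' (n z) \<noteq> 0"
    using conf by (auto simp: chart_config_def zr_def)
  have conf': "configuration (G z) (G zr) (G zs) (dir G z (1, y'))"
    using chart_configuration[OF conf] by (simp add: zr_def)
  obtain c rc sc :: "real \<Rightarrow> real^3" where c: "has_jet c (G z) (dir G z (1, y')) a" "smooth_at 0 rc" "smooth_at 0 sc"
    "rc 0 = G zr" "sc 0 = G zs"
    "eventually (\<lambda>t. c t \<in> N \<and> rc t \<in> N \<and> sc t \<in> N \<and> \<pi>1 (rc t) = \<pi>1 (G zr) \<and> \<pi>2 (sc t) = \<pi>2 (G zs) \<and>
       \<pi>1 (sc t) = \<pi>1 (c t) \<and> \<pi>2 (rc t) = \<pi>2 (c t)) (nhds 0)"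
    by (rule lewy_jet_model[OF QX conf' pj])
  have sc0: "smooth_at 0 c" "c 0 = G z"
    using c(1) by (auto simp: has_jet_def)
  have evU: "eventually (\<lambda>t. c t \<in> U) (nhds 0)" "eventually (\<lambda>t. rc t \<in> U) (nhds 0)" "eventually (\<lambda>t. sc t \<in> U) (nhds 0)"
    using eventually_smooth_at_in_open[OF _ open_U] sc0 c(2-5) from_chart cc(1-3) by metis+
  define zc where "zc t = Phi (c t)" for t
  define d where "d = dir2 Phi (G z) (dir G z (1, y')) (dir G z (1, y')) + dir Phi (G z) a"
  have jzc: "has_jet zc z (1, y') d"
    using has_jet_compose[OF c(1) smooth_Phi[OF G_in_N[OF cc(1)]]]
    by (simp add: zc_def[abs_def] d_def Phi_G[OF cc(1)] dir_Phi_G[OF cc(1)])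
  define x2 where "x2 = fst d"
  define Y2 where "Y2 = snd d - x2 *\<^sub>R y'"
  have d: "d = x2 *\<^sub>R (1, y') + (0, Y2)"
    by (simp add: x2_def Y2_def prod_eq_iff)
  have "eventually (\<lambda>t. G (zc t) = c t) (nhds 0)"
    using evU(1) by eventually_elim (simp add: zc_def G_Phi)
  from has_jet_unique[OF has_jet_cong[OF has_jet_compose[OF jzc smooth_G[OF cc(1)]] this] c(1)]
  have "a = dir2 G z (1, y') (1, y') + dir G z d"
    by simp
  then have 1: "a = dir2 G z (1, y') (1, y') + dir G z (0, Y2) + x2 *\<^sub>R dir G z (1, y')"
    unfolding d dir_add[OF smooth_G[OF cc(1)]] dir_scale[OF smooth_G[OF cc(1)]] by (simp add: algebra_simps)
  \<comment> \<open>the path of \<open>\<pi>2 (G zs)\<close> is the graph of \<open>u\<close> with the second argument frozen\<close>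
  have "eventually (\<lambda>t. u (zc t) = u (fst (zc t), snd zs)) (nhds 0)"
    using c(6) evU(1,3)
  proof eventually_elim
    case (elim t)
    have "(fst (zc t), snd zs) = Phi (sc t)"
      using elim from_chart[OF cc(3)] by (simp add: zc_def Phi_def)
    then show ?case
      using elim by (simp add: u_def zc_def G_Phi)
  qed
  moreover have jzs: "has_jet (\<lambda>t. (fst (zc t), snd zs)) zs (1, 0) (x2, 0)"
  proof -
    have bl: "bounded_linear (\<lambda>w::real \<times> (real^2). (fst w, 0::real^2))"
      by (intro bounded_linear_Pair bounded_linear_fst bounded_linear_zero)
    have "smooth_at z (\<lambda>w::real \<times> (real^2). (fst w, snd zs))"
      by (intro smooth_intros)
    moreover have "((\<lambda>w. (fst w, snd zs)) has_derivative (\<lambda>w. (fst w, 0))) (at w0)" for w0 :: "real \<times> (real^2)"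
      by (auto intro!: derivative_eq_intros)
    from has_derivative_imp_dir[OF this] have "dir (\<lambda>w::real \<times> (real^2). (fst w, snd zs)) w0 w = (fst w, 0)" for w0 w .
    ultimately show ?thesis
      using has_jet_compose[OF jzc, of "\<lambda>w. (fst w, snd zs)"] cc(4) by (simp add: x2_def prod_eq_iff[of _ zs] cong: prod.cong)
        (metis prod.collapse)
  qed
  ultimately have "dir2 u z (1, y') (1, y') + dir u z d = dir2 u zs (1, 0) (1, 0) + dir u zs (x2, 0)"
    using has_jet_unique[OF has_jet_cong[OF has_jet_compose[OF jzc smooth_u[OF cc(1)]]] has_jet_compose[OF jzs smooth_u[OF cc(3)]]]
    by blast
  moreover have "dir u z d = x2 * dir u z (1, y') + det2 Y2 (n z)"
    unfolding d dir_add[OF smooth_u[OF cc(1)]] dir_scale[OF smooth_u[OF cc(1)]] dir_u_y[OF cc(1)] by simp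
  moreover have "dir u zs (x2, 0) = x2 * dir u z (1, y')"
    using dir_u_split[OF cc(3), of x2 0] cc(6) by (simp add: det2.zero_left)
  ultimately have 2: "det2 Y2 (n z) = dir2 u zs (1, 0) (1, 0) - dir2 u z (1, y') (1, y')"
    by simp
  \<comment> \<open>the path of \<open>\<pi>1 (G zr)\<close> is the level set of \<open>u\<close> with the first argument frozen\<close>
  have ev: "eventually (\<lambda>t. u (fst zr, snd (zc t)) = u zr) (nhds 0)"
    using c(6) evU(2)
  proof eventually_elim
    case (elim t)
    have "(fst zr, snd (zc t)) = Phi (rc t)"
      using elim from_chart[OF cc(2)] by (simp add: zc_def Phi_def)
    then show ?case
      using elim by (simp add: u_def G_Phi)
  qed
  have jzr: "has_jet (\<lambda>t. (fst zr, snd (zc t))) zr (0, y') (0, snd d)"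
  proof -
    have "smooth_at z (\<lambda>w::real \<times> (real^2). (fst zr, snd w))"
      by (intro smooth_intros)
    moreover have "((\<lambda>w. (fst zr, snd w)) has_derivative (\<lambda>w. (0, snd w))) (at w0)" for w0 :: "real \<times> (real^2)"
      by (auto intro!: derivative_eq_intros)
    from has_derivative_imp_dir[OF this] have "dir (\<lambda>w::real \<times> (real^2). (fst zr, snd w)) w0 w = (0, snd w)" for w0 w .
    ultimately show ?thesis
      using has_jet_compose[OF jzc, of "\<lambda>w. (fst zr, snd w)"] by (simp add: zr_def)
  qed
  from has_jet_cong[OF has_jet_compose[OF jzr smooth_u[OF cc(2)]] ev]
  have "dir2 u zr (0, y') (0, y') + det2 (snd d) (n zr) = 0"
    by (simp add: has_jet_def dir_u_y[OF cc(2)])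
  moreover have "det2 (snd d) (n zr) = det2 Y2 (n zr)"
    using cc(7) by (simp add: d det2.add_left det2.scaleR_left)
  ultimately have 3: "det2 Y2 (n zr) = - dir2 u zr (0, y') (0, y')"
    by simp
  show thesis
    by (rule that[OF 1 2 3[unfolded zr_def]])
qed

end

section \<open>The curvature function of a pencil of directions and its blow-up\<close>

lemma smooth_at_dir2:
  fixes f :: "'b::euclidean_space \<Rightarrow> 'c::real_normed_vector"
  assumes f: "smooth_at (k x) f" and k: "smooth_at x k" and v: "smooth_at x v" and w: "smooth_at x w"
  shows "smooth_at x (\<lambda>x. dir2 f (k x) (v x) (w x))"
proof -
  have "smooth_at x (\<lambda>x. \<Sum>b\<in>Basis. (v x \<bullet> b) *\<^sub>R dir2 f (k x) b (w x))"
    by (rule smooth_at_sum, rule smooth_at_scaleR[OF smooth_at_inner[OF v smooth_at_const] smooth_at_dir[OF smooth_at_dir_const[OF f] k w]])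
  moreover have "eventually (\<lambda>y. smooth_at (k y) f) (nhds x)"
    by (rule eventually_smooth_at_comp[OF f smooth_at_isCont[OF k]])
  then have "eventually (\<lambda>x. (\<Sum>b\<in>Basis. (v x \<bullet> b) *\<^sub>R dir2 f (k x) b (w x)) = dir2 f (k x) (v x) (w x)) (nhds x)"
    by eventually_elim (rule dir2_linear_fst[symmetric])
  ultimately show ?thesis
    by (rule smooth_at_cong)
qed

text \<open>In a chart \<open>(x, y)\<close> where \<open>\<pi>2\<close> is \<open>y\<close> and \<open>\<pi>1\<close> is \<open>(x, u)\<close>, the Lewy curves through \<open>z\<close> with tangent
  in the plane \<open>ker (\<nu> \<circ> dg)\<close> are parametrized by \<open>\<rho>\<close>, where \<open>(x + \<rho>, y)\<close> is the point that determines the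
  plane through \<open>D1\<close>. With \<open>x\<close> as curve parameter, such a curve has velocity \<open>(1, y')\<close> and acceleration \<open>(0, y'')\<close>;
  \<open>A1\<close> and \<open>A2\<close> are the values of \<open>det2 y'' (n z)\<close> and \<open>det2 y'' (n (zr z \<rho>))\<close> obtained by differentiating the
  equations of the two paths twice, and \<open>h\<close> is a normalized curvature of its image under \<open>g\<close>.\<close>

locale chart_functions =
  fixes u :: "real \<times> (real^2) \<Rightarrow> real" and n g :: "real \<times> (real^2) \<Rightarrow> real^2"
    and F :: "real \<times> real \<times> real \<Rightarrow> real"
begin

definition zr :: "real \<times> (real^2) \<Rightarrow> real \<Rightarrow> real \<times> (real^2)" where
  "zr z \<rho> = (fst z + \<rho>, snd z)"
text \<open>Solves the condition that the image velocity is orthogonal to \<nu>: (1, y') spans the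
  intersection of the plane annihilated by \<open>\<nu> \<bullet> dir g z\<close> with the plane
  spanned by (1, 0) and \<open>(0, n (zr z \<rho>))\<close>.\<close>

definition lam :: "real \<times> (real^2) \<Rightarrow> real^2 \<Rightarrow> real \<Rightarrow> real" where
  "lam z \<nu> \<rho> = - (\<nu> \<bullet> dir g z (1, 0)) / (\<nu> \<bullet> dir g z (0, n (zr z \<rho>)))"
definition y' :: "real \<times> (real^2) \<Rightarrow> real^2 \<Rightarrow> real \<Rightarrow> real^2" where
  "y' z \<nu> \<rho> = lam z \<nu> \<rho> *\<^sub>R n (zr z \<rho>)"
definition slope :: "real \<times> (real^2) \<Rightarrow> real^2 \<Rightarrow> real \<Rightarrow> real" where
  "slope z \<nu> \<rho> = dir u z (1, y' z \<nu> \<rho>)"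
definition A1 :: "real \<times> (real^2) \<Rightarrow> real^2 \<Rightarrow> real \<Rightarrow> real" where
  "A1 z \<nu> \<rho> = F (fst z, u z, slope z \<nu> \<rho>) - dir2 u z (1, y' z \<nu> \<rho>) (1, y' z \<nu> \<rho>)"
definition A2 :: "real \<times> (real^2) \<Rightarrow> real^2 \<Rightarrow> real \<Rightarrow> real" where
  "A2 z \<nu> \<rho> = - dir2 u (zr z \<rho>) (0, y' z \<nu> \<rho>) (0, y' z \<nu> \<rho>)"
text \<open>Cramer's rule for \<open>det2 y'' (n z) = A1\<close> and
  \<open>det2 y'' (n (zr z \<rho>)) = A2\<close>. The determinant in the denominator vanishes at
  \<rho> = 0.\<close>

definition y'' :: "real \<times> (real^2) \<Rightarrow> real^2 \<Rightarrow> real \<Rightarrow> real^2" where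
  "y'' z \<nu> \<rho> = (1 / det2 (n (zr z \<rho>)) (n z)) *\<^sub>R (A1 z \<nu> \<rho> *\<^sub>R n (zr z \<rho>) - A2 z \<nu> \<rho> *\<^sub>R n z)"
definition image_velocity :: "real \<times> (real^2) \<Rightarrow> real^2 \<Rightarrow> real \<Rightarrow> real^2" where
  "image_velocity z \<nu> \<rho> = dir g z (1, y' z \<nu> \<rho>)"
definition image_acceleration :: "real \<times> (real^2) \<Rightarrow> real^2 \<Rightarrow> real \<Rightarrow> real^2" where
  "image_acceleration z \<nu> \<rho> = dir2 g z (1, y' z \<nu> \<rho>) (1, y' z \<nu> \<rho>) + dir g z (0, y'' z \<nu> \<rho>)"
text \<open>Independent of the parametrization: multiples of the velocity are orthogonal to \<nu>,
  and numerator and denominator both scale quadratically with the velocity.\<close>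

definition h :: "real \<times> (real^2) \<Rightarrow> real^2 \<Rightarrow> real \<Rightarrow> real" where
  "h z \<nu> \<rho> = (\<nu> \<bullet> image_acceleration z \<nu> \<rho>) / (det2 \<nu> (image_velocity z \<nu> \<rho>))\<^sup>2"

definition admissible :: "real \<times> (real^2) \<Rightarrow> real^2 \<Rightarrow> real \<Rightarrow> bool" where
  "admissible z \<nu> \<rho> \<longleftrightarrow> smooth_at z u \<and> smooth_at (zr z \<rho>) u \<and> smooth_at z n \<and> smooth_at (zr z \<rho>) n \<and> smooth_at z g \<and>
     smooth_at (fst z, u z, slope z \<nu> \<rho>) F \<and> \<nu> \<bullet> dir g z (0, n (zr z \<rho>)) \<noteq> 0 \<and>
     det2 (n (zr z \<rho>)) (n z) \<noteq> 0 \<and> det2 \<nu> (image_velocity z \<nu> \<rho>) \<noteq> 0"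

lemma smooth_chart_functions:
  assumes "smooth_at z u" "smooth_at (zr z \<rho>) n" "smooth_at z g" "\<nu> \<bullet> dir g z (0, n (zr z \<rho>)) \<noteq> 0"
  shows "smooth_at (z, \<nu>, \<rho>) (\<lambda>w. zr (fst w) (snd (snd w)))"
    "smooth_at (z, \<nu>, \<rho>) (\<lambda>w. n (zr (fst w) (snd (snd w))))"
    "smooth_at (z, \<nu>, \<rho>) (\<lambda>w. fst (snd w) \<bullet> dir g (fst w) (0, n (zr (fst w) (snd (snd w)))))"
    "smooth_at (z, \<nu>, \<rho>) (\<lambda>w. y' (fst w) (fst (snd w)) (snd (snd w)))"
    "smooth_at (z, \<nu>, \<rho>) (\<lambda>w. slope (fst w) (fst (snd w)) (snd (snd w)))"
    "smooth_at (z, \<nu>, \<rho>) (\<lambda>w. image_velocity (fst w) (fst (snd w)) (snd (snd w)))"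
proof -
  have p: "smooth_at (z, \<nu>, \<rho>) (\<lambda>w. fst w)" "smooth_at (z, \<nu>, \<rho>) (\<lambda>w. fst (snd w))" "smooth_at (z, \<nu>, \<rho>) (\<lambda>w. snd (snd w))"
    by (intro smooth_intros)+
  show szr: "smooth_at (z, \<nu>, \<rho>) (\<lambda>w. zr (fst w) (snd (snd w)))"
    unfolding zr_def by (intro smooth_intros)
  show snr: "smooth_at (z, \<nu>, \<rho>) (\<lambda>w. n (zr (fst w) (snd (snd w))))"
    by (rule smooth_at_compose[where g = n, OF _ szr]) (simp add: assms)
  have dg: "smooth_at (z, \<nu>, \<rho>) (\<lambda>w. dir g (fst w) (k w))" if "smooth_at (z, \<nu>, \<rho>) k" for k
    by (rule smooth_at_dir[OF _ p(1) that]) (simp add: assms)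
  show sd: "smooth_at (z, \<nu>, \<rho>) (\<lambda>w. fst (snd w) \<bullet> dir g (fst w) (0, n (zr (fst w) (snd (snd w)))))"
    by (intro smooth_at_inner p dg smooth_at_Pair smooth_at_const snr)
  show sy: "smooth_at (z, \<nu>, \<rho>) (\<lambda>w. y' (fst w) (fst (snd w)) (snd (snd w)))"
    unfolding y'_def lam_def
    by (intro smooth_at_scaleR smooth_at_divide smooth_at_minus smooth_at_inner p dg smooth_at_const sd snr) (simp add: assms)
  show "smooth_at (z, \<nu>, \<rho>) (\<lambda>w. slope (fst w) (fst (snd w)) (snd (snd w)))"
    unfolding slope_def by (rule smooth_at_dir[OF _ p(1)]) (auto intro!: smooth_at_Pair smooth_at_const sy assms)
  show "smooth_at (z, \<nu>, \<rho>) (\<lambda>w. image_velocity (fst w) (fst (snd w)) (snd (snd w)))"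
    unfolding image_velocity_def by (intro dg smooth_at_Pair smooth_at_const sy)
qed

lemma admissible_open:
  assumes adm: "admissible z \<nu> \<rho>"
  shows "eventually (\<lambda>w. admissible (fst w) (fst (snd w)) (snd (snd w))) (nhds (z, \<nu>, \<rho>))"
proof -
  have a: "smooth_at z u" "smooth_at (zr z \<rho>) u" "smooth_at z n" "smooth_at (zr z \<rho>) n" "smooth_at z g"
     "smooth_at (fst z, u z, slope z \<nu> \<rho>) F" "\<nu> \<bullet> dir g z (0, n (zr z \<rho>)) \<noteq> 0"
     "det2 (n (zr z \<rho>)) (n z) \<noteq> 0" "det2 \<nu> (image_velocity z \<nu> \<rho>) \<noteq> 0"
    using adm by (auto simp: admissible_def)
  note s = smooth_chart_functions[OF a(1,4,5,7)]
  have p: "smooth_at (z, \<nu>, \<rho>) (\<lambda>w. fst w)" "smooth_at (z, \<nu>, \<rho>) (\<lambda>w. fst (snd w))"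
    by (intro smooth_intros)+
  have su: "smooth_at (z, \<nu>, \<rho>) (\<lambda>w. u (fst w))" and sn: "smooth_at (z, \<nu>, \<rho>) (\<lambda>w. n (fst w))"
    by (rule smooth_at_compose[OF _ p(1)], simp add: a)+
  have ev: "eventually (\<lambda>w. smooth_at (k w) q) (nhds (z, \<nu>, \<rho>))"
    if "smooth_at (k (z, \<nu>, \<rho>)) q" "smooth_at (z, \<nu>, \<rho>) k" for k and q :: "'q::euclidean_space \<Rightarrow> 'r::real_normed_vector"
    using eventually_smooth_at_comp[OF that(1) smooth_at_isCont[OF that(2)]] .
  have sF: "smooth_at (z, \<nu>, \<rho>) (\<lambda>w. (fst (fst w), u (fst w), slope (fst w) (fst (snd w)) (snd (snd w))))"
    by (intro smooth_at_Pair smooth_at_fst p su s)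
  show ?thesis
    unfolding admissible_def
    by (intro eventually_conj ev[OF _ p(1)] ev[OF _ s(1)] ev[OF _ sF] eventually_smooth_at_neq[OF s(3)]
        eventually_smooth_at_neq[OF smooth_at_det2[OF s(2) sn]] eventually_smooth_at_neq[OF smooth_at_det2[OF p(2) s(6)]])
      (simp_all add: a)
qed

lemma smooth_h:
  assumes adm: "admissible z \<nu> \<rho>"
  shows "smooth_at (z, \<nu>, \<rho>) (\<lambda>w. h (fst w) (fst (snd w)) (snd (snd w)))"
proof -
  have a: "smooth_at z u" "smooth_at (zr z \<rho>) u" "smooth_at z n" "smooth_at (zr z \<rho>) n" "smooth_at z g"
     "smooth_at (fst z, u z, slope z \<nu> \<rho>) F" "\<nu> \<bullet> dir g z (0, n (zr z \<rho>)) \<noteq> 0"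
     "det2 (n (zr z \<rho>)) (n z) \<noteq> 0" "det2 \<nu> (image_velocity z \<nu> \<rho>) \<noteq> 0"
    using adm by (auto simp: admissible_def)
  note s = smooth_chart_functions[OF a(1,4,5,7)]
  have p: "smooth_at (z, \<nu>, \<rho>) (\<lambda>w. fst w)" "smooth_at (z, \<nu>, \<rho>) (\<lambda>w. fst (snd w))"
    by (intro smooth_intros)+
  have su: "smooth_at (z, \<nu>, \<rho>) (\<lambda>w. u (fst w))" and sn: "smooth_at (z, \<nu>, \<rho>) (\<lambda>w. n (fst w))"
    by (rule smooth_at_compose[OF _ p(1)], simp add: a)+
  have sF: "smooth_at (z, \<nu>, \<rho>) (\<lambda>w. (fst (fst w), u (fst w), slope (fst w) (fst (snd w)) (snd (snd w))))"
    by (intro smooth_at_Pair smooth_at_fst p su s)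
  have sv: "smooth_at (z, \<nu>, \<rho>) (\<lambda>w. (c, y' (fst w) (fst (snd w)) (snd (snd w))))" for c :: real
    by (intro smooth_at_Pair smooth_at_const s)
  have sA1: "smooth_at (z, \<nu>, \<rho>) (\<lambda>w. A1 (fst w) (fst (snd w)) (snd (snd w)))"
    unfolding A1_def
    by (intro smooth_at_diff smooth_at_compose[where g = F, OF _ sF] smooth_at_dir2[OF _ p(1) sv sv]) (simp_all add: a)
  have sA2: "smooth_at (z, \<nu>, \<rho>) (\<lambda>w. A2 (fst w) (fst (snd w)) (snd (snd w)))"
    unfolding A2_def
    by (intro smooth_at_minus smooth_at_dir2[OF _ s(1) sv sv]) (simp_all add: a)
  have sy: "smooth_at (z, \<nu>, \<rho>) (\<lambda>w. y'' (fst w) (fst (snd w)) (snd (snd w)))"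
    unfolding y''_def
    by (intro smooth_at_scaleR smooth_at_divide smooth_at_const smooth_at_diff smooth_at_det2 s sA1 sA2 sn) (simp add: a)
  have sB: "smooth_at (z, \<nu>, \<rho>) (\<lambda>w. image_acceleration (fst w) (fst (snd w)) (snd (snd w)))"
    unfolding image_acceleration_def
    by (intro smooth_at_add smooth_at_dir2[OF _ p(1) sv sv] smooth_at_dir[OF _ p(1) smooth_at_Pair[OF smooth_at_const sy]]) (simp_all add: a)
  show ?thesis
    unfolding h_def
    by (intro smooth_at_divide smooth_at_inner smooth_at_power smooth_at_det2 p sB s) (simp add: a)
qed

text \<open>The curves become infinitely curved as \<open>\<rho> \<rightarrow> 0\<close>: \<open>\<rho> y''\<close> has a nonzero limit in the direction of \<open>D2\<close>.\<close>

lemma blow_up: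
  assumes u: "smooth_at z u" and n: "smooth_at z n" and g: "smooth_at z g"
    and F: "isCont F (fst z, u z, dir u z (1, 0))" "F (fst z, u z, dir u z (1, 0)) = dir2 u z (1, 0) (1, 0)"
    and uy: "eventually (\<lambda>z. \<forall>w. dir u z (0, w) = det2 w (n z)) (nhds z)"
    and contact: "det2 (n z) (dir n z (1, 0)) \<noteq> 0"
    and \<nu>: "\<nu> \<bullet> dir g z (1, 0) \<noteq> 0" "\<nu> \<bullet> dir g z (0, n z) \<noteq> 0"
    and const: "\<rho>1 > 0" "\<And>\<rho>. 0 < \<rho> \<Longrightarrow> \<rho> < \<rho>1 \<Longrightarrow> h z \<nu> \<rho> = k \<and> det2 \<nu> (image_velocity z \<nu> \<rho>) \<noteq> 0"
  shows False
proof -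
  define R where "R = at_right (0::real)"
  have R: "R \<noteq> bot" "R \<le> nhds 0"
    unfolding R_def by (simp_all add: at_within_le_nhds)
  define n0 where "n0 = n z"
  define nx where "nx = dir n z (1, 0)"
  define c where "c = det2 n0 nx"
  define l0 where "l0 = lam z \<nu> 0"
  have c: "c \<noteq> 0"
    using contact by (simp add: c_def n0_def nx_def)
  have zr0: "zr z 0 = z"
    by (simp add: zr_def)
  have jz: "has_jet (zr z) z (1, 0) 0"
  proof -
    have "smooth_at \<rho> (zr z)" for \<rho>
      unfolding zr_def[abs_def] by (intro smooth_intros)
    moreover have "((\<lambda>\<rho>. zr z \<rho>) has_derivative (\<lambda>s. (s, 0))) (at \<rho>)" for \<rho>
      unfolding zr_def by (auto intro!: derivative_eq_intros)
    from has_derivative_imp_dir[OF this] have "dir (zr z) \<rho> s = (s, 0)" for \<rho> s .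
    ultimately show ?thesis
      by (simp add: has_jet_def zr0)
  qed
  have sz: "smooth_at 0 (zr z)"
    using jz by (simp add: has_jet_def)
  have lim0: "(f \<longlongrightarrow> f 0) R" if "smooth_at 0 f" for f :: "real \<Rightarrow> 'x::real_normed_vector"
    using smooth_at_tendsto_nhds[OF that] tendsto_mono[OF R(2)] by blast
  have snr: "smooth_at 0 (\<lambda>\<rho>. n (zr z \<rho>))"
    by (rule smooth_at_compose[where g = n, OF _ sz]) (simp add: zr0 n)
  have lzr: "(zr z \<longlongrightarrow> z) R"
    using lim0[OF sz] by (simp add: zr0)
  have lnr: "((\<lambda>\<rho>. n (zr z \<rho>)) \<longlongrightarrow> n0) R"
    using lim0[OF snr] by (simp add: zr0 n0_def)
  have lin_g: "((\<lambda>\<rho>. dir g z (f \<rho>)) \<longlongrightarrow> dir g z l) R" if "(f \<longlongrightarrow> l) R" for f l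
    using bounded_linear.tendsto[OF _ that, of "dir g z"] linear_dir[OF g] by (simp add: linear_conv_bounded_linear)
  have lin_u: "((\<lambda>\<rho>. dir u z (f \<rho>)) \<longlongrightarrow> dir u z l) R" if "(f \<longlongrightarrow> l) R" for f l
    using bounded_linear.tendsto[OF _ that, of "dir u z"] linear_dir[OF u] by (simp add: linear_conv_bounded_linear)
  have ll: "((\<lambda>\<rho>. lam z \<nu> \<rho>) \<longlongrightarrow> l0) R"
    unfolding lam_def l0_def using \<nu>(2)
    by (intro tendsto_intros lin_g lnr) (simp_all add: zr0 n0_def lnr[unfolded n0_def])
  have l0: "l0 * (\<nu> \<bullet> dir g z (0, n0)) = - (\<nu> \<bullet> dir g z (1, 0))"
    using \<nu>(2) by (simp add: l0_def lam_def zr0 n0_def)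
  define y0 where "y0 = l0 *\<^sub>R n0"
  have ly: "((\<lambda>\<rho>. y' z \<nu> \<rho>) \<longlongrightarrow> y0) R"
    unfolding y'_def y0_def by (intro tendsto_intros ll lnr)
  have lv: "((\<lambda>\<rho>. (a, y' z \<nu> \<rho>)) \<longlongrightarrow> (a, y0)) R" for a :: real
    by (intro tendsto_intros ly)
  have uy0: "dir u z (0, w) = det2 w n0" for w
    using eventually_nhds_x_imp_x[OF uy] by (simp add: n0_def)
  have split: "(1 :: real, w) = (1, 0) + (0, w)" for w :: "real^2"
    by simp
  \<comment> \<open>In the limit y' is parallel to \<open>n z\<close>, along which u is stationary,
    so the slope tends to that of the path of z itself. This is why the value of F is needed at this
    one 1-jet only.\<close>
  have lslope: "((\<lambda>\<rho>. slope z \<nu> \<rho>) \<longlongrightarrow> dir u z (1, 0)) R"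
  proof -
    have "dir u z (1, y0) = dir u z (1, 0)"
      unfolding split[of y0] dir_add[OF u] uy0 by (simp add: y0_def det2.scaleR_left)
    then show ?thesis
      unfolding slope_def using lin_u[OF lv[of 1]] by simp
  qed
  have quad: "((\<lambda>\<rho>. dir2 q (f \<rho>) (v \<rho>) (v \<rho>)) \<longlongrightarrow> dir2 q z w w) R"
    if q: "smooth_at z q" and f: "(f \<longlongrightarrow> z) R" and v: "(v \<longlongrightarrow> w) R" for q :: "real \<times> (real^2) \<Rightarrow> 'x::real_normed_vector" and f v w
  proof -
    have "smooth_at (z, w) (\<lambda>x. dir2 q (fst x) (snd x) (snd x))"
      by (rule smooth_at_dir2) (auto intro!: smooth_intros q)
    from smooth_at_isCont[OF this] have "((\<lambda>\<rho>. dir2 q (fst (f \<rho>, v \<rho>)) (snd (f \<rho>, v \<rho>)) (snd (f \<rho>, v \<rho>))) \<longlongrightarrow> dir2 q (fst (z, w)) (snd (z, w)) (snd (z, w))) R"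
      by (rule isCont_tendsto_compose) (intro tendsto_intros f v)
    then show ?thesis by simp
  qed
  have lA1: "((\<lambda>\<rho>. A1 z \<nu> \<rho>) \<longlongrightarrow> dir2 u z (1, 0) (1, 0) - dir2 u z (1, y0) (1, y0)) R"
    unfolding A1_def F(2)[symmetric]
    by (intro tendsto_diff isCont_tendsto_compose[OF F(1)] tendsto_Pair tendsto_const lslope quad[OF u tendsto_const lv])
  have lA2: "((\<lambda>\<rho>. A2 z \<nu> \<rho>) \<longlongrightarrow> - dir2 u z (0, y0) (0, y0)) R"
    unfolding A2_def by (intro tendsto_minus quad[OF u lzr lv])
  have mixed: "dir2 u z (0, w) (1, 0) = det2 w nx" for w
  proof -
    have "eventually (\<lambda>z. dir u z (0, w) = det2 w (n z)) (nhds z)"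
      using uy by eventually_elim simp
    from dir_cong[OF smooth_at_dir_const[OF u] this] show ?thesis
      by (simp add: nx_def dir_linear_comp[OF det2.bounded_linear_right n])
  qed
  \<comment> \<open>In the difference of the limits of \<open>A1\<close> and \<open>A2\<close> the
    pure second derivatives cancel, and minus twice the mixed one survives. By \<open>mixed\<close>
    it is the contact constant c times \<open>l0\<close>.\<close>
  have "dir2 u z (1, y0) (1, y0) = dir2 u z (1, 0) (1, 0) + 2 * dir2 u z (0, y0) (1, 0) + dir2 u z (0, y0) (0, y0)"
    unfolding split[of y0] dir2_add_left[OF u] dir2_add_right[OF u] dir2_commute[OF u, of "(1, 0)" "(0, y0)"] by simp
  then have diff: "dir2 u z (1, 0) (1, 0) - dir2 u z (1, y0) (1, y0) - - dir2 u z (0, y0) (0, y0) = - 2 * l0 * c"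
    by (simp add: mixed y0_def det2.scaleR_left c_def)
  \<comment> \<open>The determinant of the linear system is 0 at \<rho> = 0, and its derivative
    there is the contact constant up to sign.\<close>
  have ldet: "((\<lambda>\<rho>. det2 (n (zr z \<rho>)) n0 / \<rho>) \<longlongrightarrow> - c) R"
  proof -
    have "has_jet (\<lambda>\<rho>. n (zr z \<rho>)) n0 nx (dir2 n z (1, 0) (1, 0) + dir n z 0)"
      using has_jet_compose[OF jz n] by (simp add: n0_def nx_def)
    from has_jet_linear[OF det2.bounded_linear_left[of n0] this]
    have "((\<lambda>\<rho>. det2 (n (zr z \<rho>)) n0) has_vector_derivative det2 nx n0) (at 0)"
      using has_jet_imp_has_vector_derivative[of 0 "\<lambda>\<rho>. det2 (n (zr z \<rho>)) n0"] by (simp add: has_jet_def)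
    then have "((\<lambda>\<rho>. det2 (n (zr z \<rho>)) n0) has_real_derivative det2 nx n0) (at 0)"
      by (simp add: has_real_derivative_iff_has_vector_derivative)
    then have "((\<lambda>\<rho>. (det2 (n (zr z \<rho>)) n0 - det2 (n (zr z 0)) n0) / (\<rho> - 0)) \<longlongrightarrow> det2 nx n0) (at 0)"
      by (simp only: has_field_derivative_iff)
    then have "((\<lambda>\<rho>. det2 (n (zr z \<rho>)) n0 / \<rho>) \<longlongrightarrow> det2 nx n0) (at 0)"
      by (simp add: zr0 n0_def)
    then show ?thesis
      unfolding R_def c_def using det2_swap[of nx n0] by (auto intro: tendsto_within_subset)
  qed
  have pos: "eventually (\<lambda>\<rho>. 0 < \<rho> \<and> \<rho> < \<rho>1) R"
    unfolding R_def eventually_at_right_field using const(1) by auto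
  have "((\<lambda>\<rho>. (1 / (det2 (n (zr z \<rho>)) n0 / \<rho>)) *\<^sub>R (A1 z \<nu> \<rho> *\<^sub>R n (zr z \<rho>) - A2 z \<nu> \<rho> *\<^sub>R n0)) \<longlongrightarrow>
      (1 / - c) *\<^sub>R ((dir2 u z (1, 0) (1, 0) - dir2 u z (1, y0) (1, y0)) *\<^sub>R n0 - (- dir2 u z (0, y0) (0, y0)) *\<^sub>R n0)) R"
    using c by (intro tendsto_intros ldet lA1 lA2 lnr) simp
  also have "(1 / - c) *\<^sub>R ((dir2 u z (1, 0) (1, 0) - dir2 u z (1, y0) (1, y0)) *\<^sub>R n0 - (- dir2 u z (0, y0) (0, y0)) *\<^sub>R n0)
      = (2 * l0) *\<^sub>R n0"
    unfolding scaleR_left_diff_distrib[symmetric] diff using c by simp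
  finally have ly2: "((\<lambda>\<rho>. \<rho> *\<^sub>R y'' z \<nu> \<rho>) \<longlongrightarrow> (2 * l0) *\<^sub>R n0) R"
    by (rule Lim_transform_eventually) (use pos in \<open>eventually_elim, simp add: y''_def n0_def\<close>)
  have "((\<lambda>\<rho>. \<nu> \<bullet> dir g z (0, \<rho> *\<^sub>R y'' z \<nu> \<rho>)) \<longlongrightarrow> \<nu> \<bullet> dir g z (0, (2 * l0) *\<^sub>R n0)) R"
    by (intro tendsto_inner tendsto_const lin_g tendsto_Pair ly2)
  moreover have "\<nu> \<bullet> dir g z (0, (2 * l0) *\<^sub>R n0) = - 2 * (\<nu> \<bullet> dir g z (1, 0))"
  proof -
    have "(0, (2 * l0) *\<^sub>R n0) = (2 * l0) *\<^sub>R (0 :: real, n0)"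
      by simp
    then show ?thesis
      using l0 by (simp only: dir_scale[OF g] inner_scaleR_right)
  qed
  ultimately have L1: "((\<lambda>\<rho>. \<nu> \<bullet> dir g z (0, \<rho> *\<^sub>R y'' z \<nu> \<rho>)) \<longlongrightarrow> - 2 * (\<nu> \<bullet> dir g z (1, 0))) R"
    by simp
  \<comment> \<open>With h equal to k, the numerator of h is k times a bounded square. Then \<rho>
    times the acceleration term would tend to 0, against the nonzero limit in
    \<open>L1\<close>.\<close>
  have "((\<lambda>\<rho>. \<rho> * (k * (det2 \<nu> (image_velocity z \<nu> \<rho>))\<^sup>2 - \<nu> \<bullet> dir2 g z (1, y' z \<nu> \<rho>) (1, y' z \<nu> \<rho>))) \<longlongrightarrow>
      0 * (k * (det2 \<nu> (dir g z (1, y0)))\<^sup>2 - \<nu> \<bullet> dir2 g z (1, y0) (1, y0))) R"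
    unfolding image_velocity_def
    by (intro tendsto_mult tendsto_diff tendsto_power det2.tendsto tendsto_const tendsto_inner lin_g lv quad[OF g tendsto_const lv]
        lim0[OF smooth_at_ident])
  then have L2: "((\<lambda>\<rho>. \<rho> * (k * (det2 \<nu> (image_velocity z \<nu> \<rho>))\<^sup>2 - \<nu> \<bullet> dir2 g z (1, y' z \<nu> \<rho>) (1, y' z \<nu> \<rho>))) \<longlongrightarrow> 0) R"
    by simp
  have "eventually (\<lambda>\<rho>. \<rho> * (k * (det2 \<nu> (image_velocity z \<nu> \<rho>))\<^sup>2 - \<nu> \<bullet> dir2 g z (1, y' z \<nu> \<rho>) (1, y' z \<nu> \<rho>))
      = \<nu> \<bullet> dir g z (0, \<rho> *\<^sub>R y'' z \<nu> \<rho>)) R"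
    using pos
  proof eventually_elim
    case (elim \<rho>)
    have "h z \<nu> \<rho> = k" "det2 \<nu> (image_velocity z \<nu> \<rho>) \<noteq> 0"
      using const(2)[of \<rho>] elim by auto
    then have "\<nu> \<bullet> image_acceleration z \<nu> \<rho> = k * (det2 \<nu> (image_velocity z \<nu> \<rho>))\<^sup>2"
      by (simp add: h_def field_simps)
    then have "\<nu> \<bullet> dir g z (0, y'' z \<nu> \<rho>) = k * (det2 \<nu> (image_velocity z \<nu> \<rho>))\<^sup>2 - \<nu> \<bullet> dir2 g z (1, y' z \<nu> \<rho>) (1, y' z \<nu> \<rho>)"
      by (simp add: image_acceleration_def inner_add_right)
    moreover have "(0, \<rho> *\<^sub>R y'' z \<nu> \<rho>) = \<rho> *\<^sub>R (0 :: real, y'' z \<nu> \<rho>)"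
      by simp
    ultimately show ?case
      by (simp only: dir_scale[OF g] inner_scaleR_right)
  qed
  from Lim_transform_eventually[OF L2 this] have "((\<lambda>\<rho>. \<nu> \<bullet> dir g z (0, \<rho> *\<^sub>R y'' z \<nu> \<rho>)) \<longlongrightarrow> 0) R" .
  from tendsto_unique[OF R(1) L1 this] \<nu>(1) show False
    by simp
qed

end

section \<open>Constancy of the image curvature\<close>

lemma det2_perp:
  assumes "\<nu> \<noteq> 0" "\<nu> \<bullet> a = 0" "\<nu> \<bullet> b = 0"
  shows "det2 a b = 0"
proof -
  have "(\<nu> \<bullet> \<nu>) * det2 a b = (\<nu> \<bullet> a) * det2 \<nu> b - det2 \<nu> a * (\<nu> \<bullet> b)"
    by (simp add: det2_def inner_vec_def sum_2 algebra_simps)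
  then show ?thesis
    using assms by simp
qed

text \<open>Both \<nu> and \<open>det2 w\<close> measure the component across w. This translates the
  curvature of a target branch with tangent w into the numerator of \<open>h\<close>.\<close>

lemma det2_perp_eq:
  assumes "\<nu> \<bullet> w = 0"
  shows "(w \<bullet> w) * (\<nu> \<bullet> b) = det2 w b * det2 w \<nu>"
proof -
  have "(w \<bullet> w) * (\<nu> \<bullet> b) = det2 w b * det2 w \<nu> + (\<nu> \<bullet> w) * (w \<bullet> b)"
    by (simp add: det2_def inner_vec_def sum_2 algebra_simps)
  then show ?thesis
    using assms by simp
qed

lemma det2_eq_0_imp_eq:
  assumes "det2 a b \<noteq> 0" "det2 v a = det2 w a" "det2 v b = det2 w b"
  shows "v = w"
proof -
  have "det2 (v - w) a = 0" "det2 (v - w) b = 0"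
    using assms by (simp_all add: det2.diff_left)
  moreover have "det2 a b *\<^sub>R (v - w) = det2 (v - w) b *\<^sub>R a - det2 (v - w) a *\<^sub>R b"
    by (simp add: det2_def vec_eq_iff forall_2 algebra_simps)
  ultimately show ?thesis
    using assms(1) by simp
qed

lemma (in double_fibration) configuration_scale:
  assumes "configuration p r s v" "k \<noteq> 0" shows "configuration p r s (k *\<^sub>R v)"
proof -
  have p: "p \<in> N"
    using assms by (simp add: configuration_def)
  have "k *\<^sub>R v \<in> contact_plane p \<Longrightarrow> v \<in> contact_plane p"
    using subspace_scale[OF subspace_contact_plane[OF p], of "k *\<^sub>R v" "1 / k"] assms(2) by simp
  then show ?thesis
    using assms p by (auto simp: configuration_def dir_scale[OF smooth_\<pi>1[OF p]] dir_scale[OF smooth_\<pi>2[OF p]] det2.scaleR_right)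
qed

context fibration_chart
begin

lemma mixed_derivative:
  assumes z: "z \<in> V" shows "dir2 u z (0, w) (1, 0) = det2 w (dir n z (1, 0))"
proof -
  have "eventually (\<lambda>z. dir u z (0, w) = det2 w (n z)) (nhds z)"
    using open_V z dir_u_y by (auto simp: eventually_nhds)
  from dir_cong[OF smooth_at_dir_const[OF smooth_u[OF z]] this] show ?thesis
    by (simp add: dir_linear_comp[OF det2.bounded_linear_right smooth_n[OF z]])
qed

text \<open>For \<open>z = (x, y)\<close>, the 1-jet at \<open>x\<close> of the path \<open>H2\<close> of \<open>y\<close>.\<close>

definition jmap :: "real \<times> (real^2) \<Rightarrow> real \<times> real \<times> real" where
  "jmap z = (fst z, u z, dir u z (1, 0))"

text \<open>Points of N correspond to 1-jets of paths: x and u fix a point up to motion of y along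
  \<open>n z\<close>, and by \<open>contact_chart\<close> the slope distinguishes points along that
  direction.\<close>

lemma jmap_inverse:
  assumes z: "z \<in> V"
  obtains J W where "open W" "jmap z \<in> W" "smooth_on W J" "J (jmap z) = z"
    "\<forall>w\<in>W. J w \<in> V \<and> jmap (J w) = w"
proof -
  have sj: "smooth_at z jmap"
    unfolding jmap_def[abs_def] by (intro smooth_at_Pair smooth_intros smooth_u[OF z] smooth_at_dir_const)
  have dj: "dir jmap z w = (fst w, dir u z w, dir2 u z (1, 0) w)" for w
  proof -
    have "dir fst z w = fst w"
      by (rule has_derivative_imp_dir[OF bounded_linear_imp_has_derivative[OF bounded_linear_fst]])
    then show ?thesis
      unfolding jmap_def[abs_def]
      by (simp add: dir_Pair smooth_at_Pair smooth_u[OF z] smooth_at_dir_const smooth_at_fst[OF smooth_at_ident])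
  qed
  have "bij (dir jmap z)"
  proof (rule inj_linear_bij[OF linear_dir[OF sj]])
    fix w assume "dir jmap z w = 0"
    then have w: "fst w = 0" "dir u z w = 0" "dir2 u z (1, 0) w = 0"
      by (simp_all add: dj zero_prod_def)
    obtain b where b: "w = (0, b)"
      using w(1) by (cases w) simp
    have "det2 (n z) b = 0"
      using w(2) det2_swap[of b] by (simp add: b dir_u_y[OF z])
    then obtain k where k: "b = k *\<^sub>R n z"
      using det2_eq_0D[OF _ n_neq_0[OF z]] by blast
    have "det2 b (dir n z (1, 0)) = 0"
      using w(3) unfolding b dir2_commute[OF smooth_u[OF z], of "(1, 0)"] mixed_derivative[OF z] .
    then have "k = 0"
      using contact_chart[OF z] by (simp add: k det2.scaleR_left)
    then show "w = 0"
      by (simp add: b k zero_prod_def)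
  qed simp
  note bij = this
  show thesis
  proof (rule smooth_inverse_function_theorem[OF sj bij open_V z])
    fix J U' W
    assume *: "z \<in> U'" "U' \<subseteq> V" "open W" "jmap z \<in> W" "smooth_on W J" "\<And>x. x \<in> U' \<Longrightarrow> J (jmap x) = x"
      "\<And>y. y \<in> W \<Longrightarrow> J y \<in> U'" "\<And>y. y \<in> W \<Longrightarrow> jmap (J y) = y"
    show thesis
      by (rule that[OF *(3-5) *(6)[OF *(1)]]) (use * in blast)
  qed
qed

end

text \<open>\<open>J\<close> recovers the point from a 1-jet. It supplies the right-hand side F of
  the equation of the paths and the point \<open>zs\<close> of a configuration with prescribed
  slope.\<close>

locale lewy_chart = lewy_map N \<pi>1 \<pi>2 X Y N' \<pi>1' \<pi>2' X' Y' f + C: fibration_chart N \<pi>1 \<pi>2 X Y \<omega> G V U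
  for N \<pi>1 \<pi>2 X Y N' \<pi>1' \<pi>2' X' Y' f \<omega> G V U +
  fixes J :: "real \<times> real \<times> real \<Rightarrow> real \<times> (real^2)" and W :: "(real \<times> real \<times> real) set"
  assumes open_W: "open W" and smooth_on_J: "smooth_on W J"
    and J: "w \<in> W \<Longrightarrow> J w \<in> V \<and> C.jmap (J w) = w"
begin

text \<open>The paths \<open>H2\<close> solve \<open>u'' = F (x, u, u')\<close>.\<close>

definition gG :: "real \<times> (real^2) \<Rightarrow> real^2" where "gG z = g1 (G z)"
definition F :: "real \<times> real \<times> real \<Rightarrow> real" where "F w = dir2 C.u (J w) (1, 0) (1, 0)"

sublocale H: chart_functions C.u C.n gG F .

lemma smooth_gG: "z \<in> V \<Longrightarrow> smooth_at z gG"
  unfolding gG_def[abs_def] by (rule smooth_at_compose[where f = G, OF smooth_g1[OF C.G_in_N] C.smooth_G])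

lemma dir_gG: "z \<in> V \<Longrightarrow> dir gG z w = dir g1 (G z) (dir G z w)"
  unfolding gG_def[abs_def] by (rule dir_compose[OF smooth_g1[OF C.G_in_N] C.smooth_G])

lemma smooth_F: assumes w: "w \<in> W" shows "smooth_at w F"
  unfolding F_def[abs_def]
  by (rule smooth_at_compose[where f = J, OF smooth_at_dir_const[OF smooth_at_dir_const[OF C.smooth_u]]])
    (use J[OF w] smooth_on_imp_smooth_at[OF smooth_on_J open_W w] in auto)

definition chart_admissible :: "real \<times> (real^2) \<Rightarrow> real^2 \<Rightarrow> real \<Rightarrow> bool" where
  "chart_admissible z \<nu> \<rho> \<longleftrightarrow> z \<in> V \<and> H.zr z \<rho> \<in> V \<and> (fst z, C.u z, H.slope z \<nu> \<rho>) \<in> W \<and>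
     \<nu> \<bullet> dir gG z (1, 0) \<noteq> 0 \<and> \<nu> \<bullet> dir gG z (0, C.n (H.zr z \<rho>)) \<noteq> 0 \<and>
     det2 (C.n (H.zr z \<rho>)) (C.n z) \<noteq> 0 \<and> det2 \<nu> (H.image_velocity z \<nu> \<rho>) \<noteq> 0"

lemma chart_admissible_imp_admissible: "chart_admissible z \<nu> \<rho> \<Longrightarrow> H.admissible z \<nu> \<rho>"
  by (auto simp: chart_admissible_def H.admissible_def intro: C.smooth_u C.smooth_n smooth_gG smooth_F)

lemma chart_admissible_open:
  assumes "chart_admissible z \<nu> \<rho>"
  shows "eventually (\<lambda>w. chart_admissible (fst w) (fst (snd w)) (snd (snd w))) (nhds (z, \<nu>, \<rho>))"
proof -
  have a: "z \<in> V" "H.zr z \<rho> \<in> V" "(fst z, C.u z, H.slope z \<nu> \<rho>) \<in> W" "\<nu> \<bullet> dir gG z (1, 0) \<noteq> 0"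
    "\<nu> \<bullet> dir gG z (0, C.n (H.zr z \<rho>)) \<noteq> 0"
    using assms by (auto simp: chart_admissible_def)
  note s = H.smooth_chart_functions[OF C.smooth_u[OF a(1)] C.smooth_n[OF a(2)] smooth_gG[OF a(1)] a(5)]
  have p: "smooth_at (z, \<nu>, \<rho>) (\<lambda>w. fst w)" "smooth_at (z, \<nu>, \<rho>) (\<lambda>w. fst (snd w))"
    by (intro smooth_intros)+
  have su: "smooth_at (z, \<nu>, \<rho>) (\<lambda>w. C.u (fst w))"
    by (rule smooth_at_compose[OF _ p(1)]) (simp add: C.smooth_u a)
  have sF: "smooth_at (z, \<nu>, \<rho>) (\<lambda>w. (fst (fst w), C.u (fst w), H.slope (fst w) (fst (snd w)) (snd (snd w))))"
    by (intro smooth_at_Pair smooth_at_fst p su s)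
  have sg: "smooth_at (z, \<nu>, \<rho>) (\<lambda>w. fst (snd w) \<bullet> dir gG (fst w) (1, 0))"
    by (intro smooth_at_inner p smooth_at_dir[OF _ p(1)] smooth_at_const) (simp add: smooth_gG a)
  have "eventually (\<lambda>w. fst w \<in> V) (nhds (z, \<nu>, \<rho>))"
    using eventually_smooth_at_in_open[OF p(1) C.open_V] a by simp
  moreover have "eventually (\<lambda>w. H.zr (fst w) (snd (snd w)) \<in> V) (nhds (z, \<nu>, \<rho>))"
    using eventually_smooth_at_in_open[OF s(1) C.open_V] a by simp
  moreover have "eventually (\<lambda>w. (fst (fst w), C.u (fst w), H.slope (fst w) (fst (snd w)) (snd (snd w))) \<in> W) (nhds (z, \<nu>, \<rho>))"
    using eventually_smooth_at_in_open[OF sF open_W] a by simp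
  moreover have "eventually (\<lambda>w. fst (snd w) \<bullet> dir gG (fst w) (1, 0) \<noteq> 0) (nhds (z, \<nu>, \<rho>))"
    using eventually_smooth_at_neq[OF sg] a by simp
  ultimately show ?thesis
    using H.admissible_open[OF chart_admissible_imp_admissible[OF assms]]
    by eventually_elim (simp add: chart_admissible_def H.admissible_def)
qed

lemma lam_neq_0: "\<nu> \<bullet> dir gG z (1, 0) \<noteq> 0 \<Longrightarrow> \<nu> \<bullet> dir gG z (0, C.n (H.zr z \<rho>)) \<noteq> 0 \<Longrightarrow> H.lam z \<nu> \<rho> \<noteq> 0"
  by (simp add: H.lam_def)

lemma image_velocity_perp:
  assumes z: "z \<in> V" and \<nu>: "\<nu> \<bullet> dir gG z (0, C.n (H.zr z \<rho>)) \<noteq> 0"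
  shows "\<nu> \<bullet> H.image_velocity z \<nu> \<rho> = 0"
proof -
  have "(1 :: real, H.y' z \<nu> \<rho>) = (1, 0) + H.lam z \<nu> \<rho> *\<^sub>R (0, C.n (H.zr z \<rho>))"
    by (simp add: H.y'_def)
  then have "H.image_velocity z \<nu> \<rho> = dir gG z (1, 0) + H.lam z \<nu> \<rho> *\<^sub>R dir gG z (0, C.n (H.zr z \<rho>))"
    unfolding H.image_velocity_def by (simp only: dir_add[OF smooth_gG[OF z]] dir_scale[OF smooth_gG[OF z]])
  then show ?thesis
    using \<nu> by (simp add: inner_add_right inner_diff_right H.lam_def)
qed

abbreviation zs :: "real \<times> (real^2) \<Rightarrow> real^2 \<Rightarrow> real \<Rightarrow> real \<times> (real^2)" where
  "zs z \<nu> \<rho> \<equiv> J (fst z, C.u z, H.slope z \<nu> \<rho>)"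

lemma chart_admissible_chart_config:
  assumes "chart_admissible z \<nu> \<rho>"
  shows "C.chart_config z \<rho> (zs z \<nu> \<rho>) (H.y' z \<nu> \<rho>)"
proof -
  have a: "z \<in> V" "H.zr z \<rho> \<in> V" "(fst z, C.u z, H.slope z \<nu> \<rho>) \<in> W" "\<nu> \<bullet> dir gG z (1, 0) \<noteq> 0"
    "\<nu> \<bullet> dir gG z (0, C.n (H.zr z \<rho>)) \<noteq> 0" "det2 (C.n (H.zr z \<rho>)) (C.n z) \<noteq> 0"
    using assms by (auto simp: chart_admissible_def)
  then show ?thesis
    using J[OF a(3)] lam_neq_0[OF a(4,5)]
    by (auto simp: C.chart_config_def C.jmap_def H.zr_def H.slope_def H.y'_def det2.scaleR_left)
qed

lemma curve_direction: "z \<in> V \<Longrightarrow> dir g1 (G z) (dir G z (1, H.y' z \<nu> \<rho>)) = H.image_velocity z \<nu> \<rho>"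
  by (simp add: H.image_velocity_def dir_gG)

text \<open>\<open>Y2\<close> from \<open>chart_jet\<close> and Cramer's formula solve the same
  regular linear system. The tangential term with \<open>x2\<close> disappears because the image
  velocity is orthogonal to \<nu>.\<close>

lemma curve_acceleration:
  assumes chart_admissible: "chart_admissible z \<nu> \<rho>" and pj: "path_jet S.lewy (G z) (dir G z (1, H.y' z \<nu> \<rho>)) a"
  shows "\<nu> \<bullet> (dir2 g1 (G z) (dir G z (1, H.y' z \<nu> \<rho>)) (dir G z (1, H.y' z \<nu> \<rho>)) + dir g1 (G z) a) = \<nu> \<bullet> H.image_acceleration z \<nu> \<rho>"
proof -
  let ?v = "(1, H.y' z \<nu> \<rho>)"
  have a: "z \<in> V" "(fst z, C.u z, H.slope z \<nu> \<rho>) \<in> W" "\<nu> \<bullet> dir gG z (0, C.n (H.zr z \<rho>)) \<noteq> 0"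
    "det2 (C.n (H.zr z \<rho>)) (C.n z) \<noteq> 0"
    using chart_admissible by (auto simp: chart_admissible_def)
  obtain x2 Y2 where Y2: "a = dir2 G z ?v ?v + dir G z (0, Y2) + x2 *\<^sub>R dir G z ?v"
    "det2 Y2 (C.n z) = dir2 C.u (zs z \<nu> \<rho>) (1, 0) (1, 0) - dir2 C.u z ?v ?v"
    "det2 Y2 (C.n (fst z + \<rho>, snd z)) = - dir2 C.u (fst z + \<rho>, snd z) (0, H.y' z \<nu> \<rho>) (0, H.y' z \<nu> \<rho>)"
    by (rule C.chart_jet[OF QX chart_admissible_chart_config[OF chart_admissible] pj])
  have "Y2 = H.y'' z \<nu> \<rho>"
  proof (rule det2_eq_0_imp_eq[OF a(4)])
    show "det2 Y2 (C.n z) = det2 (H.y'' z \<nu> \<rho>) (C.n z)"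
      using a(4) by (simp add: Y2(2) H.y''_def H.A1_def F_def det2.scaleR_left det2.diff_left)
    show "det2 Y2 (C.n (H.zr z \<rho>)) = det2 (H.y'' z \<nu> \<rho>) (C.n (H.zr z \<rho>))"
      using a(4) det2_swap[of "C.n z" "C.n (H.zr z \<rho>)"] Y2(3)
      by (simp add: H.zr_def[symmetric] H.y''_def H.A2_def det2.scaleR_left det2.diff_left det2.add_left)
  qed
  note g = smooth_g1[OF C.G_in_N[OF a(1)]]
  have "dir2 g1 (G z) (dir G z ?v) (dir G z ?v) + dir g1 (G z) a
      = dir2 g1 (G z) (dir G z ?v) (dir G z ?v) + dir g1 (G z) (dir2 G z ?v ?v) + dir g1 (G z) (dir G z (0, Y2)) + x2 *\<^sub>R H.image_velocity z \<nu> \<rho>"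
    by (simp add: Y2(1) dir_add[OF g] dir_scale[OF g] curve_direction[OF a(1)] add.assoc)
  also have "dir2 g1 (G z) (dir G z ?v) (dir G z ?v) + dir g1 (G z) (dir2 G z ?v ?v) = dir2 gG z ?v ?v"
    unfolding gG_def[abs_def] by (rule dir2_compose[OF g C.smooth_G[OF a(1)], symmetric])
  also have "dir g1 (G z) (dir G z (0, Y2)) = dir gG z (0, H.y'' z \<nu> \<rho>)"
    by (simp add: dir_gG[OF a(1)] \<open>Y2 = H.y'' z \<nu> \<rho>\<close>)
  finally show ?thesis
    using image_velocity_perp[OF a(1,3)] by (simp add: H.image_acceleration_def inner_add_right)
qed

text \<open>At a regular direction the target branch s' has a tangent w orthogonal to \<nu>. All
  directions of the pencil have image velocities orthogonal to \<nu>, hence parallel to w, so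
  \<open>image_curvature\<close> applies to nearby \<rho> with the same branch and makes
  \<open>h\<close> locally constant.\<close>

lemma dir_h_eq_0_of_regular:
  assumes chart_admissible: "chart_admissible z \<nu> \<rho>" and pj: "path_jet S.lewy (G z) (dir G z (1, H.y' z \<nu> \<rho>)) a"
    and conf: "T.configuration (f (G z)) r' s' (dir f (G z) (dir G z (1, H.y' z \<nu> \<rho>)))"
  shows "dir (\<lambda>w. H.h (fst w) (fst (snd w)) (snd (snd w))) (z, \<nu>, \<rho>) (0, 0, 1) = 0"
proof -
  define p where "p = G z"
  define v where "v t = dir G z (1, H.y' z \<nu> t)" for t
  have a: "z \<in> V" "H.zr z \<rho> \<in> V" "\<nu> \<bullet> dir gG z (0, C.n (H.zr z \<rho>)) \<noteq> 0" "det2 \<nu> (H.image_velocity z \<nu> \<rho>) \<noteq> 0"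
    using chart_admissible by (auto simp: chart_admissible_def)
  have \<nu>: "\<nu> \<noteq> 0"
    using a(3) by auto
  have pN: "p \<in> N"
    using C.G_in_N[OF a(1)] by (simp add: p_def)
  have line: "has_jet (\<lambda>t. (z, \<nu>, \<rho> + t)) (z, \<nu>, \<rho>) (0, 0, 1) 0"
  proof -
    have "smooth_at t (\<lambda>t. (z, \<nu>, \<rho> + t))" for t
      by (intro smooth_intros)
    moreover have "((\<lambda>t. (z, \<nu>, \<rho> + t)) has_derivative (\<lambda>s. (0, 0, s))) (at t)" for t
      by (auto intro!: derivative_eq_intros)
    from has_derivative_imp_dir[OF this] have "dir (\<lambda>t. (z, \<nu>, \<rho> + t)) t s = (0, 0, s)" for t s .
    ultimately show ?thesis
      by (simp add: has_jet_def)
  qed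
  then have sl: "smooth_at 0 (\<lambda>t. (z, \<nu>, \<rho> + t))"
    by (simp add: has_jet_def)
  have along: "eventually (\<lambda>t. P (z, \<nu>, \<rho> + t)) (nhds 0)" if "eventually P (nhds (z, \<nu>, \<rho>))" for P
    using smooth_at_tendsto_nhds[OF sl] that by (auto simp: filterlim_iff)
  have sy: "smooth_at (z, \<nu>, \<rho>) (\<lambda>w. H.y' (fst w) (fst (snd w)) (snd (snd w)))"
    by (rule H.smooth_chart_functions[OF C.smooth_u[OF a(1)] C.smooth_n[OF a(2)] smooth_gG[OF a(1)] a(3)])
  have "smooth_at 0 (\<lambda>t. H.y' z \<nu> (\<rho> + t))"
    using smooth_at_compose[OF _ sl, of "\<lambda>w. H.y' (fst w) (fst (snd w)) (snd (snd w))"] sy by simp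
  then have sv: "smooth_at 0 (\<lambda>t. v (\<rho> + t))"
    unfolding v_def by (intro smooth_at_dir C.smooth_G a smooth_at_Pair smooth_at_const)
  have pj': "path_jet S.lewy p (v \<rho>) a"
    using pj by (simp add: p_def v_def)
  have lim_pv: "((\<lambda>t. (p, v (\<rho> + t))) \<longlongrightarrow> (p, v \<rho>)) (nhds 0)"
    using smooth_at_tendsto_nhds[OF sv] by (intro tendsto_Pair tendsto_const) simp
  have e1: "eventually (\<lambda>t. \<exists>b. path_jet S.lewy p (v (\<rho> + t)) b) (nhds 0)"
    using eventually_path_jet[OF pj'] lim_pv by (auto simp: filterlim_iff)
  have e2: "eventually (\<lambda>t. \<forall>a1 l. path_jet S.lewy p (v (\<rho> + t)) a1 \<longrightarrow> dir g1 p (v (\<rho> + t)) = l *\<^sub>R T.U1 s' \<longrightarrow>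
    det2 (T.U1 s') (dir2 g1 p (v (\<rho> + t)) (v (\<rho> + t)) + dir g1 p a1) = l\<^sup>2 * T.curvature1 s') (nhds 0)"
    using image_curvature[OF pN conf[folded p_def v_def]] smooth_at_tendsto_nhds[OF sv] by (auto simp: filterlim_iff)
  define w where "w = T.U1 s'"
  have w0: "w \<noteq> 0"
    unfolding w_def using conf by (intro T.U1_neq_0) (simp add: T.configuration_def)
  have dU: "dir g1 p (v t) = H.image_velocity z \<nu> t" for t
    unfolding p_def v_def by (rule curve_direction[OF a(1)])
  have "det2 w (H.image_velocity z \<nu> \<rho>) = 0"
    using conf unfolding T.configuration_def w_def dU[symmetric] dir_g1[OF pN] by (simp add: p_def v_def)
  then obtain l where l: "H.image_velocity z \<nu> \<rho> = l *\<^sub>R w"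
    using det2_eq_0D[OF _ w0] by blast
  then have \<nu>w: "\<nu> \<bullet> w = 0"
    using image_velocity_perp[OF a(1,3)] a(4) by (auto simp: det2.zero_right)
  \<comment> \<open>The value of \<open>h\<close> on the branch: the factor l^2 of the curvature
    cancels against the squared velocity, which leaves an expression in \<nu> and s' only.\<close>
  define K where "K = T.curvature1 s' * det2 w \<nu> / ((w \<bullet> w) * (det2 \<nu> w)\<^sup>2)"
  have ev: "eventually (\<lambda>t. H.h z \<nu> (\<rho> + t) = K) (nhds 0)"
    using e1 e2 along[OF chart_admissible_open[OF chart_admissible]]
  proof eventually_elim
    case (elim t)
    have g: "chart_admissible z \<nu> (\<rho> + t)"
      using elim(3) by simp
    then have b: "\<nu> \<bullet> dir gG z (0, C.n (H.zr z (\<rho> + t))) \<noteq> 0" "det2 \<nu> (H.image_velocity z \<nu> (\<rho> + t)) \<noteq> 0"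
      by (auto simp: chart_admissible_def)
    obtain a1 where a1: "path_jet S.lewy p (v (\<rho> + t)) a1"
      using elim(1) by blast
    obtain l where l: "H.image_velocity z \<nu> (\<rho> + t) = l *\<^sub>R w"
      using det2_eq_0D[OF det2_perp[OF \<nu> \<nu>w image_velocity_perp[OF a(1) b(1)]] w0] by blast
    then have l0: "l \<noteq> 0" "det2 \<nu> w \<noteq> 0"
      using b(2) by (auto simp: det2.scaleR_right)
    have "det2 w (dir2 g1 p (v (\<rho> + t)) (v (\<rho> + t)) + dir g1 p a1) = l\<^sup>2 * T.curvature1 s'"
      using elim(2) a1 l by (simp add: dU w_def)
    with det2_perp_eq[OF \<nu>w, of "dir2 g1 p (v (\<rho> + t)) (v (\<rho> + t)) + dir g1 p a1"]
    have "(w \<bullet> w) * (\<nu> \<bullet> H.image_acceleration z \<nu> (\<rho> + t)) = l\<^sup>2 * T.curvature1 s' * det2 w \<nu>"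
      using curve_acceleration[OF g] a1 unfolding p_def v_def by simp
    then have "\<nu> \<bullet> H.image_acceleration z \<nu> (\<rho> + t) = l\<^sup>2 * T.curvature1 s' * det2 w \<nu> / (w \<bullet> w)"
      using w0 by (simp add: field_simps)
    then show ?case
      using l0 w0 by (simp add: H.h_def K_def l det2.scaleR_right power_mult_distrib)
  qed
  have "has_jet (\<lambda>t. H.h z \<nu> (\<rho> + t)) (H.h z \<nu> \<rho>)
      (dir (\<lambda>w. H.h (fst w) (fst (snd w)) (snd (snd w))) (z, \<nu>, \<rho>) (0, 0, 1))
      (dir2 (\<lambda>w. H.h (fst w) (fst (snd w)) (snd (snd w))) (z, \<nu>, \<rho>) (0, 0, 1) (0, 0, 1)
       + dir (\<lambda>w. H.h (fst w) (fst (snd w)) (snd (snd w))) (z, \<nu>, \<rho>) 0)"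
    using has_jet_compose[OF line H.smooth_h[OF chart_admissible_imp_admissible[OF chart_admissible]]] by simp
  from has_jet_cong[OF this ev] show ?thesis
    by (simp add: has_jet_def)
qed

end

context lewy_chart
begin

text \<open>A nonzero derivative would persist on an open set, where it should meet a regular
  direction. Density is known for pairs (p1, v1), however, while \<open>h\<close> lives on triples
  (z, \<nu>, \<rho>); the map \<Xi> converts a nearby pair and a leaf point adapted to it into a
  triple with the same direction.\<close>

lemma dir_h_eq_0:
  assumes chart_admissible: "chart_admissible z \<nu> \<rho>"
  shows "dir (\<lambda>w. H.h (fst w) (fst (snd w)) (snd (snd w))) (z, \<nu>, \<rho>) (0, 0, 1) = 0"
proof (rule ccontr)
  define hh where "hh w = H.h (fst w) (fst (snd w)) (snd (snd w))" for w
  assume "dir (\<lambda>w. H.h (fst w) (fst (snd w)) (snd (snd w))) (z, \<nu>, \<rho>) (0, 0, 1) \<noteq> 0"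
  then have n0: "dir hh (z, \<nu>, \<rho>) (0, 0, 1) \<noteq> 0"
    by (simp add: hh_def[abs_def])
  have "smooth_at (z, \<nu>, \<rho>) hh"
    unfolding hh_def[abs_def] by (rule H.smooth_h[OF chart_admissible_imp_admissible[OF chart_admissible]])
  from eventually_smooth_at_neq[OF smooth_at_dir_const[OF this] n0]
  have P: "eventually (\<lambda>w. chart_admissible (fst w) (fst (snd w)) (snd (snd w)) \<and> dir hh w (0, 0, 1) \<noteq> 0) (nhds (z, \<nu>, \<rho>))"
    using chart_admissible_open[OF chart_admissible] by eventually_elim simp
  have a: "z \<in> V" "H.zr z \<rho> \<in> V" "\<nu> \<bullet> dir gG z (1, 0) \<noteq> 0" "\<nu> \<bullet> dir gG z (0, C.n (H.zr z \<rho>)) \<noteq> 0"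
    "det2 (C.n (H.zr z \<rho>)) (C.n z) \<noteq> 0" "det2 \<nu> (H.image_velocity z \<nu> \<rho>) \<noteq> 0"
    using chart_admissible by (auto simp: chart_admissible_def)
  define ps where "ps = G z"
  define y where "y = H.y' z \<nu> \<rho>"
  define vs where "vs = dir G z (1, y)"
  define rs where "rs = G (H.zr z \<rho>)"
  have conf: "S.configuration ps rs (G (zs z \<nu> \<rho>)) vs"
    using C.chart_configuration[OF chart_admissible_chart_config[OF chart_admissible]] by (simp add: ps_def rs_def vs_def y_def H.zr_def)
  have N: "ps \<in> N" "rs \<in> N" and in_U: "ps \<in> U" "rs \<in> U"
    using C.from_chart[OF a(1)] C.from_chart[OF a(2)] C.U_N by (auto simp: ps_def rs_def)
  have Phi_ps: "C.Phi ps = z" "C.Phi rs = H.zr z \<rho>"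
    using C.Phi_G a(1,2) by (simp_all add: ps_def rs_def)
  have y0: "y \<noteq> 0" "det2 (S.U2 rs) y = 0"
    using chart_admissible_chart_config[OF chart_admissible] C.det2_U2_iff[OF a(2), of y]
    by (auto simp: C.chart_config_def y_def rs_def H.zr_def det2.zero_left)
  define d where "d q = dir C.Phi (fst q) (snd q)" for q
  define yp where "yp q = (1 / fst (d q)) *\<^sub>R snd (d q)" for q
  define Ug where "Ug q = dir gG (C.Phi (fst q)) (1, yp q)" for q
  \<comment> \<open>Removing the component along the new image velocity makes the plane belonging to
    \<open>nu q\<close> contain the direction of q.\<close>
  define nu where "nu q = \<nu> - ((\<nu> \<bullet> Ug q) / (Ug q \<bullet> Ug q)) *\<^sub>R Ug q" for q
  have d0: "d (ps, vs) = (1, y)"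
    by (simp add: d_def vs_def ps_def C.dir_Phi_G[OF a(1)])
  then have yp0: "yp (ps, vs) = y"
    by (simp add: yp_def)
  have Ug0: "Ug (ps, vs) = H.image_velocity z \<nu> \<rho>"
    by (simp add: Ug_def yp0 Phi_ps H.image_velocity_def y_def)
  then have Ug1: "Ug (ps, vs) \<noteq> 0"
    using a(6) by (auto simp: det2.zero_right)
  have nu0: "nu (ps, vs) = \<nu>"
    by (simp add: nu_def Ug0 image_velocity_perp[OF a(1,4)])
  have sq: "smooth_at (ps, vs) fst" "smooth_at (ps, vs) snd"
    by (simp_all add: smooth_at_bounded_linear bounded_linear_fst bounded_linear_snd)
  have sPhi: "smooth_at (ps, vs) (\<lambda>q. C.Phi (fst q))"
    by (rule smooth_at_compose[where f = fst, OF _ sq(1)]) (simp add: C.smooth_Phi N)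
  have sd: "smooth_at (ps, vs) d"
    unfolding d_def[abs_def] by (rule smooth_at_dir[OF _ sq]) (simp add: C.smooth_Phi N)
  have syp: "smooth_at (ps, vs) yp"
    unfolding yp_def[abs_def]
    by (intro smooth_at_scaleR smooth_at_divide smooth_at_const smooth_at_fst[OF sd] smooth_at_snd[OF sd]) (simp add: d0)
  have sUg: "smooth_at (ps, vs) Ug"
    unfolding Ug_def[abs_def]
    by (intro smooth_at_dir[OF _ sPhi] smooth_at_Pair smooth_at_const syp) (simp add: Phi_ps smooth_gG a)
  have snu: "smooth_at (ps, vs) nu"
    unfolding nu_def[abs_def]
    by (intro smooth_at_diff smooth_at_scaleR smooth_at_divide smooth_at_inner smooth_at_const sUg) (simp add: Ug1)
  define \<Xi> where "\<Xi> q = (C.Phi (fst (fst q)), nu (fst q), fst (C.Phi (snd q)) - fst (C.Phi (fst (fst q))))" for q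
  have lift: "smooth_at ((ps, vs), rs) (\<lambda>q. k (fst q))" if "smooth_at (ps, vs) k" for k :: "_ \<Rightarrow> 'x::real_normed_vector"
    by (rule smooth_at_compose[where f = fst, OF _ smooth_at_fst[OF smooth_at_ident]]) (simp add: that)
  have sPr: "smooth_at ((ps, vs), rs) (\<lambda>q. C.Phi (snd q))"
    by (rule smooth_at_compose[where f = snd, OF _ smooth_at_snd[OF smooth_at_ident]]) (simp add: C.smooth_Phi N)
  have s\<Xi>: "smooth_at ((ps, vs), rs) \<Xi>"
    unfolding \<Xi>_def[abs_def] by (intro smooth_at_Pair smooth_at_diff smooth_at_fst[OF sPr] lift snu sPhi smooth_at_fst[OF lift[OF sPhi]])
  have \<Xi>0: "\<Xi> ((ps, vs), rs) = (z, \<nu>, \<rho>)"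
    by (simp add: \<Xi>_def Phi_ps nu0 H.zr_def)
  have "eventually (\<lambda>q. chart_admissible (fst (\<Xi> q)) (fst (snd (\<Xi> q))) (snd (snd (\<Xi> q))) \<and> dir hh (\<Xi> q) (0, 0, 1) \<noteq> 0) (nhds ((ps, vs), rs))"
    using smooth_at_tendsto_nhds[OF s\<Xi>] P unfolding \<Xi>0 by (auto simp: filterlim_iff)
  moreover have "eventually (\<lambda>q. fst (fst q) \<in> U) (nhds ((ps, vs), rs))"
    using eventually_smooth_at_in_open[OF lift[OF sq(1)] C.open_U] in_U by simp
  moreover have "eventually (\<lambda>q. snd q \<in> U) (nhds ((ps, vs), rs))"
    using eventually_smooth_at_in_open[OF smooth_at_snd[OF smooth_at_ident] C.open_U, of "((ps, vs), rs)"] in_U by simp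
  moreover have "eventually (\<lambda>q. fst (d (fst q)) \<noteq> 0) (nhds ((ps, vs), rs))"
    by (rule eventually_smooth_at_neq[OF lift[OF smooth_at_fst[OF sd]]]) (simp add: d0)
  moreover have "eventually (\<lambda>q. Ug (fst q) \<noteq> 0) (nhds ((ps, vs), rs))"
    by (rule eventually_smooth_at_neq[OF lift[OF sUg]]) (simp add: Ug1)
  ultimately have "eventually (\<lambda>q. chart_admissible (fst (\<Xi> q)) (fst (snd (\<Xi> q))) (snd (snd (\<Xi> q))) \<and> dir hh (\<Xi> q) (0, 0, 1) \<noteq> 0 \<and>
      fst (fst q) \<in> U \<and> snd q \<in> U \<and> fst (d (fst q)) \<noteq> 0 \<and> Ug (fst q) \<noteq> 0) (nhds ((ps, vs), rs))"
    by eventually_elim simp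
  then obtain B where B: "open B" "((ps, vs), rs) \<in> B"
    "\<And>q. q \<in> B \<Longrightarrow> chart_admissible (fst (\<Xi> q)) (fst (snd (\<Xi> q))) (snd (snd (\<Xi> q))) \<and> dir hh (\<Xi> q) (0, 0, 1) \<noteq> 0 \<and>
      fst (fst q) \<in> U \<and> snd q \<in> U \<and> fst (d (fst q)) \<noteq> 0 \<and> Ug (fst q) \<noteq> 0"
    unfolding eventually_nhds by blast
  obtain B1 B2 where B12: "open B1" "open B2" "((ps, vs), rs) \<in> B1 \<times> B2" "B1 \<times> B2 \<subseteq> B"
    by (rule open_prod_elim[OF B(1,2)])
  have s\<pi>: "smooth_at (ps, vs) (\<lambda>q. (\<pi>2 (fst q), yp q))"
    by (intro smooth_at_Pair syp smooth_at_compose[where f = fst, OF _ sq(1)]) (simp add: S.smooth_\<pi>2 N)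
  have "\<pi>2 rs = \<pi>2 ps"
    using conf by (simp add: S.configuration_def)
  \<comment> \<open>Since y' lies along \<open>U2 rs\<close>, rotation along the leaf of
    \<open>rs\<close> follows any nearby direction. The first coordinate of the point so found
    determines the new \<rho>.\<close>
  then have "eventually (\<lambda>q. \<exists>r1\<in>N \<inter> B2. \<pi>2 r1 = \<pi>2 (fst q) \<and> det2 (S.U2 r1) (yp q) = 0) (nhds (ps, vs))"
    using smooth_at_tendsto_nhds[OF s\<pi>] S.leaf_point[OF N(2) y0 B12(2)] B12(3)
    by (auto simp: filterlim_iff yp0)
  then have "eventually (\<lambda>q. q \<in> B1 \<and> (\<exists>r1\<in>N \<inter> B2. \<pi>2 r1 = \<pi>2 (fst q) \<and> det2 (S.U2 r1) (yp q) = 0)) (nhds (ps, vs))"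
    using B12 by (auto intro!: eventually_conj eventually_nhds_in_open)
  then obtain W2 where W2: "open W2" "(ps, vs) \<in> W2"
    "\<And>q. q \<in> W2 \<Longrightarrow> q \<in> B1 \<and> (\<exists>r1\<in>N \<inter> B2. \<pi>2 r1 = \<pi>2 (fst q) \<and> det2 (S.U2 r1) (yp q) = 0)"
    unfolding eventually_nhds by blast
  obtain p1 v1 a1 r' s' where reg: "path_jet S.lewy p1 v1 a1" "(p1, v1) \<in> W2" "T.configuration (f p1) r' s' (dir f p1 v1)"
    by (rule regular_dense[OF conf W2(1,2)])
  obtain r1 where r1: "r1 \<in> B2" "\<pi>2 r1 = \<pi>2 p1" "det2 (S.U2 r1) (yp (p1, v1)) = 0" and in_B1: "(p1, v1) \<in> B1"
    using W2(3)[OF reg(2)] by auto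
  have "((p1, v1), r1) \<in> B"
    using B12(4) r1(1) in_B1 by blast
  note Bq = B(3)[OF this]
  define z1 where "z1 = C.Phi p1"
  define \<nu>1 where "\<nu>1 = nu (p1, v1)"
  define \<rho>1 where "\<rho>1 = fst (C.Phi r1) - fst z1"
  have \<Xi>1: "\<Xi> ((p1, v1), r1) = (z1, \<nu>1, \<rho>1)"
    by (simp add: \<Xi>_def z1_def \<nu>1_def \<rho>1_def)
  have g1: "chart_admissible z1 \<nu>1 \<rho>1" and n1: "dir hh (z1, \<nu>1, \<rho>1) (0, 0, 1) \<noteq> 0" and U1: "p1 \<in> U" "r1 \<in> U"
    and fd: "fst (d (p1, v1)) \<noteq> 0" and Ug2: "Ug (p1, v1) \<noteq> 0"
    using Bq unfolding \<Xi>1 by auto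
  have b: "z1 \<in> V" "H.zr z1 \<rho>1 \<in> V" "\<nu>1 \<bullet> dir gG z1 (1, 0) \<noteq> 0" "\<nu>1 \<bullet> dir gG z1 (0, C.n (H.zr z1 \<rho>1)) \<noteq> 0"
    using g1 by (auto simp: chart_admissible_def)
  have Gz1: "G z1 = p1"
    using C.G_Phi[OF U1(1)] by (simp add: z1_def)
  have zr1: "H.zr z1 \<rho>1 = C.Phi r1"
    using r1(2) by (simp add: H.zr_def \<rho>1_def z1_def C.Phi_def)
  have "det2 (yp (p1, v1)) (C.n (H.zr z1 \<rho>1)) = 0"
    using C.det2_U2_iff[OF b(2), of "yp (p1, v1)"] r1(3) C.G_Phi[OF U1(2)] by (simp add: zr1)
  then have "det2 (C.n (H.zr z1 \<rho>1)) (yp (p1, v1)) = 0"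
    using det2_swap[of "yp (p1, v1)"] by simp
  then obtain m where m: "yp (p1, v1) = m *\<^sub>R C.n (H.zr z1 \<rho>1)"
    using det2_eq_0D[OF _ C.n_neq_0[OF b(2)]] by blast
  have perp: "\<nu>1 \<bullet> Ug (p1, v1) = 0"
    using Ug2 by (simp add: \<nu>1_def nu_def inner_diff_left)
  have "(1 :: real, yp (p1, v1)) = (1, 0) + m *\<^sub>R (0, C.n (H.zr z1 \<rho>1))"
    by (simp add: m)
  then have "Ug (p1, v1) = dir gG z1 (1, 0) + m *\<^sub>R dir gG z1 (0, C.n (H.zr z1 \<rho>1))"
    unfolding Ug_def fst_conv z1_def[symmetric] by (simp only: dir_add[OF smooth_gG[OF b(1)]] dir_scale[OF smooth_gG[OF b(1)]])
  then have "\<nu>1 \<bullet> dir gG z1 (1, 0) + m * (\<nu>1 \<bullet> dir gG z1 (0, C.n (H.zr z1 \<rho>1))) = 0"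
    using perp by (simp add: inner_add_right)
  then have "m = H.lam z1 \<nu>1 \<rho>1"
    using b(4) by (simp add: H.lam_def field_simps)
  then have yp1: "H.y' z1 \<nu>1 \<rho>1 = yp (p1, v1)"
    by (simp add: H.y'_def m)
  \<comment> \<open>The chart wants velocities with x-component 1. Rescaling by 1 / k is harmless
    for path jets and for configurations.\<close>
  define k where "k = fst (d (p1, v1))"
  define v where "v = dir G z1 (1, yp (p1, v1))"
  have "d (p1, v1) = k *\<^sub>R (1, yp (p1, v1))"
    using fd by (simp add: yp_def k_def prod_eq_iff)
  then have "v1 = k *\<^sub>R v"
    using C.dir_G_Phi[OF b(1), of v1] by (simp add: v_def d_def Gz1 dir_scale[OF C.smooth_G[OF b(1)], symmetric])
  moreover have k: "1 / k \<noteq> 0"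
    using fd by (simp add: k_def)
  ultimately have "(1 / k) *\<^sub>R v1 = v"
    by simp
  then have v1: "dir G z1 (1, H.y' z1 \<nu>1 \<rho>1) = (1 / k) *\<^sub>R v1"
    unfolding yp1 v_def by (rule sym)
  have pN: "p1 \<in> N"
    using U1(1) C.U_N by blast
  have "dir hh (z1, \<nu>1, \<rho>1) (0, 0, 1) = 0"
    unfolding hh_def[abs_def]
  proof (rule dir_h_eq_0_of_regular[OF g1])
    show "path_jet S.lewy (G z1) (dir G z1 (1, H.y' z1 \<nu>1 \<rho>1)) ((1 / k)\<^sup>2 *\<^sub>R a1 + 0 *\<^sub>R v1)"
      unfolding v1 Gz1 by (rule path_jet_reparametrize[OF reg(1) k])
    show "T.configuration (f (G z1)) r' s' (dir f (G z1) (dir G z1 (1, H.y' z1 \<nu>1 \<rho>1)))"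
      unfolding v1 Gz1 dir_scale[OF smooth_f[OF pN]] by (rule T.configuration_scale[OF reg(3) k])
  qed
  with n1 show False ..
qed

lemma ker_g1_line:
  assumes p: "p \<in> N" and w: "dir g1 p w = 0" "w \<noteq> 0" and w': "dir g1 p w' = 0"
  obtains k where "w' = k *\<^sub>R w"
proof -
  obtain a b where ab: "dir f p w = a *\<^sub>R Y' (f p)" "dir f p w' = b *\<^sub>R Y' (f p)"
    using w w' T.ker_\<pi>1[OF f_in[OF p]] unfolding dir_g1[OF p] by blast
  have inj: "inj (dir f p)"
    using bij_is_inj[OF bij_f[OF p]] .
  have "a \<noteq> 0"
    using ab(1) w(2) dir_zero[OF smooth_f[OF p]] injD[OF inj, of w 0] by auto
  then have "dir f p w' = dir f p ((b / a) *\<^sub>R w)"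
    using ab by (simp add: dir_scale[OF smooth_f[OF p]])
  then have "w' = (b / a) *\<^sub>R w"
    by (rule injD[OF inj])
  then show thesis
    by (rule that)
qed

text \<open>Most conditions hold at \<rho> = 0 and are open. Two may fail there: the determinant is
  0 but has nonzero derivative by the contact condition, and the image velocity can vanish if the
  limiting direction lies in the kernel.\<close>

lemma chart_admissible_near_0:
  assumes z: "z \<in> V" and jW: "C.jmap z \<in> W"
    and \<nu>: "\<nu> \<bullet> dir gG z (1, 0) \<noteq> 0" "\<nu> \<bullet> dir gG z (0, C.n z) \<noteq> 0"
  obtains \<rho>1 where "\<rho>1 > 0" "\<And>\<rho>. 0 < \<rho> \<Longrightarrow> \<rho> < \<rho>1 \<Longrightarrow> chart_admissible z \<nu> \<rho>"
proof -
  have zr0: "H.zr z 0 = z"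
    by (simp add: H.zr_def)
  have \<nu>0: "\<nu> \<noteq> 0"
    using \<nu> by auto
  have "\<nu> \<bullet> dir gG z (0, C.n (H.zr z 0)) \<noteq> 0" "smooth_at (H.zr z 0) C.n"
    using \<nu> C.smooth_n[OF z] by (simp_all add: zr0)
  note s = H.smooth_chart_functions[OF C.smooth_u[OF z] this(2) smooth_gG[OF z] this(1)]
  have line: "smooth_at 0 (\<lambda>\<rho>. (z, \<nu>, \<rho>))"
    by (intro smooth_intros)
  have restr: "smooth_at 0 (\<lambda>\<rho>. k (z, \<nu>, \<rho>))" if "smooth_at (z, \<nu>, 0) k"
    for k :: "(real \<times> (real^2)) \<times> (real^2) \<times> real \<Rightarrow> 'x::real_normed_vector"
    by (rule smooth_at_compose[where f = "\<lambda>\<rho>. (z, \<nu>, \<rho>)", OF that line])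
  have sl0: "H.slope z \<nu> 0 = dir C.u z (1, 0)"
    using C.dir_u_split[OF z, of 1 "H.y' z \<nu> 0"] by (simp add: H.slope_def H.y'_def zr0 det2.scaleR_left)
  have "smooth_at 0 (\<lambda>\<rho>. (fst z, C.u z, H.slope z \<nu> \<rho>))"
    using restr[OF s(5)] by (intro smooth_at_Pair smooth_at_const) simp
  from eventually_smooth_at_in_open[OF this open_W] jW
  have e1: "eventually (\<lambda>\<rho>. (fst z, C.u z, H.slope z \<nu> \<rho>) \<in> W) (nhds 0)"
    by (simp add: sl0 C.jmap_def)
  have e2: "eventually (\<lambda>\<rho>. H.zr z \<rho> \<in> V) (nhds 0)"
    using eventually_smooth_at_in_open[OF restr[OF s(1)] C.open_V] z by (simp add: zr0)
  have e3: "eventually (\<lambda>\<rho>. \<nu> \<bullet> dir gG z (0, C.n (H.zr z \<rho>)) \<noteq> 0) (nhds 0)"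
    using eventually_smooth_at_neq[OF restr[OF s(3)], of 0] \<nu> by (simp add: zr0)
  have e4: "eventually (\<lambda>\<rho>. det2 (C.n (H.zr z \<rho>)) (C.n z) \<noteq> 0) (at 0)"
  proof -
    have sd: "smooth_at 0 (\<lambda>\<rho>. det2 (C.n (H.zr z \<rho>)) (C.n z))"
      using restr[OF s(2)] by (intro smooth_at_det2 smooth_at_const) simp
    have "dir (\<lambda>\<rho>. H.zr z \<rho>) 0 1 = (1, 0)"
    proof -
      have "((\<lambda>\<rho>. H.zr z \<rho>) has_derivative (\<lambda>s. (s, 0))) (at 0)"
        unfolding H.zr_def by (auto intro!: derivative_eq_intros)
      from has_derivative_imp_dir[OF this] show ?thesis .
    qed
    moreover have "smooth_at 0 (\<lambda>\<rho>. H.zr z \<rho>)"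
      using restr[OF s(1)] by simp
    ultimately have "dir (\<lambda>\<rho>. C.n (H.zr z \<rho>)) 0 1 = dir C.n z (1, 0)"
      using dir_compose[of "H.zr z" 0 C.n 1] C.smooth_n[OF z] by (simp add: zr0)
    then have "dir (\<lambda>\<rho>. det2 (C.n (H.zr z \<rho>)) (C.n z)) 0 1 = det2 (dir C.n z (1, 0)) (C.n z)"
      using restr[OF s(2)] by (simp add: dir_linear_comp[OF det2.bounded_linear_left])
    then have D: "dir (\<lambda>\<rho>. det2 (C.n (H.zr z \<rho>)) (C.n z)) 0 1 \<noteq> 0"
      using C.contact_chart[OF z] det2_swap[of "C.n z"] by simp
    have "((\<lambda>\<rho>. det2 (C.n (H.zr z \<rho>)) (C.n z)) has_real_derivative dir (\<lambda>\<rho>. det2 (C.n (H.zr z \<rho>)) (C.n z)) 0 1) (at 0)"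
      using has_jet_imp_has_vector_derivative[OF sd] by (simp add: has_real_derivative_iff_has_vector_derivative)
    then have "((\<lambda>\<rho>. (det2 (C.n (H.zr z \<rho>)) (C.n z) - det2 (C.n (H.zr z 0)) (C.n z)) / (\<rho> - 0))
        \<longlongrightarrow> dir (\<lambda>\<rho>. det2 (C.n (H.zr z \<rho>)) (C.n z)) 0 1) (at 0)"
      by (simp only: has_field_derivative_iff)
    from tendsto_imp_eventually_ne[OF this D] show ?thesis
      by eventually_elim (auto simp: zr0)
  qed
  have sU: "smooth_at 0 (\<lambda>\<rho>. H.image_velocity z \<nu> \<rho>)"
    using restr[OF s(6)] by simp
  have e5: "eventually (\<lambda>\<rho>. H.image_velocity z \<nu> \<rho> \<noteq> 0) (at 0)"
  proof (cases "H.image_velocity z \<nu> 0 = 0")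
    case False
    from eventually_smooth_at_neq[OF sU this] show ?thesis
      by (simp add: eventually_nhds_conv_at)
  next
    \<comment> \<open>The kernel of the derivative of \<open>g1\<close> is a line, so a second zero
      would give the same direction. But y' is a nonzero multiple of \<open>n (zr z \<rho>)\<close>,
      which is not parallel to \<open>n z\<close> once \<rho> is small and nonzero.\<close>
    case True
    have "eventually (\<lambda>\<rho>. \<nu> \<bullet> dir gG z (0, C.n (H.zr z \<rho>)) \<noteq> 0) (at 0)"
      using e3 by (simp add: eventually_nhds_conv_at)
    with e4 show ?thesis
    proof eventually_elim
      case (elim \<rho>)
      show ?case
      proof
        assume 0: "H.image_velocity z \<nu> \<rho> = 0"
        define w where "w \<rho> = dir G z (1, H.y' z \<nu> \<rho>)" for \<rho>
        have g0: "dir g1 (G z) (w 0) = 0" "dir g1 (G z) (w \<rho>) = 0"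
          using True 0 by (simp_all add: H.image_velocity_def w_def dir_gG[OF z])
        have Pw: "dir C.Phi (G z) (w \<rho>) = (1, H.y' z \<nu> \<rho>)" for \<rho>
          by (simp add: w_def C.dir_Phi_G[OF z])
        then have "w 0 \<noteq> 0"
          using dir_zero[OF C.smooth_Phi[OF C.G_in_N[OF z]]] by (metis fst_conv fst_zero zero_neq_one)
        from ker_g1_line[OF C.G_in_N[OF z] g0(1) this g0(2)]
        obtain k where kw: "w \<rho> = k *\<^sub>R w 0" by blast
        have "dir C.Phi (G z) (w \<rho>) = k *\<^sub>R dir C.Phi (G z) (w 0)"
          unfolding kw by (rule dir_scale[OF C.smooth_Phi[OF C.G_in_N[OF z]]])
        then have "(1 :: real, H.y' z \<nu> \<rho>) = k *\<^sub>R (1, H.y' z \<nu> 0)"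
          unfolding Pw .
        then have "H.y' z \<nu> \<rho> = H.y' z \<nu> 0"
          by auto
        then have "H.lam z \<nu> \<rho> * det2 (C.n (H.zr z \<rho>)) (C.n z) = 0"
          by (metis H.y'_def zr0 det2.scaleR_left det2_self mult_zero_right real_scaleR_def)
        then show False
          using elim lam_neq_0[OF \<nu>(1), of \<rho>] by simp
      qed
    qed
  qed
  have "eventually (\<lambda>\<rho>. chart_admissible z \<nu> \<rho>) (at 0)"
    using e4 e5 e1[THEN eventually_nhds_conv_at[THEN iffD1], THEN conjunct1] e2[THEN eventually_nhds_conv_at[THEN iffD1], THEN conjunct1]
      e3[THEN eventually_nhds_conv_at[THEN iffD1], THEN conjunct1]
  proof eventually_elim
    case (elim \<rho>)
    have "det2 \<nu> (H.image_velocity z \<nu> \<rho>) \<noteq> 0"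
    proof
      assume "det2 \<nu> (H.image_velocity z \<nu> \<rho>) = 0"
      with vec2_eqI[OF \<nu>0, of "H.image_velocity z \<nu> \<rho>" 0] image_velocity_perp[OF z elim(5)] elim(2) show False
        by (simp add: det2.zero_right)
    qed
    with elim z \<nu>(1) show ?case
      by (simp add: chart_admissible_def)
  qed
  then obtain \<rho>1 where "\<rho>1 > 0" "\<And>\<rho>. \<rho> \<noteq> 0 \<Longrightarrow> dist \<rho> 0 < \<rho>1 \<Longrightarrow> chart_admissible z \<nu> \<rho>"
    unfolding eventually_at by auto
  then show thesis
    by (intro that[of \<rho>1]) (auto simp: dist_real_def)
qed

lemma no_transverse_kernel:
  assumes z: "z \<in> V" and jW: "C.jmap z \<in> W" "J (C.jmap z) = z"
  shows "dir gG z (1, 0) = 0 \<or> dir gG z (0, C.n z) = 0"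
proof (rule ccontr)
  define a b where "a = dir gG z (1, 0)" and "b = dir gG z (0, C.n z)"
  assume "\<not> (dir gG z (1, 0) = 0 \<or> dir gG z (0, C.n z) = 0)"
  then have ab: "a \<noteq> 0" "b \<noteq> 0"
    by (simp_all add: a_def b_def)
  \<comment> \<open>Needed is a covector that kills neither a nor b, so that its plane contains
    neither \<open>D1\<close> nor \<open>D2\<close>: a itself serves unless a and b are orthogonal,
    and then their sum does.\<close>
  define \<nu> where "\<nu> = (if a \<bullet> b = 0 then a + b else a)"
  have \<nu>: "\<nu> \<bullet> a \<noteq> 0" "\<nu> \<bullet> b \<noteq> 0"
    using ab by (cases "a \<bullet> b = 0"; simp add: \<nu>_def inner_add_left inner_commute[of b a])+
  note \<nu>' = \<nu>[unfolded a_def b_def]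
  obtain \<rho>1 where \<rho>1: "\<rho>1 > 0" "\<And>\<rho>. 0 < \<rho> \<Longrightarrow> \<rho> < \<rho>1 \<Longrightarrow> chart_admissible z \<nu> \<rho>"
    using chart_admissible_near_0[OF z jW(1) \<nu>'] by blast
  have deriv: "(H.h z \<nu> has_real_derivative 0) (at \<rho>)" if \<rho>: "0 < \<rho>" "\<rho> < \<rho>1" for \<rho>
  proof -
    let ?hh = "\<lambda>w. H.h (fst w) (fst (snd w)) (snd (snd w))"
    note g = \<rho>1(2)[OF \<rho>]
    have line: "((\<lambda>t. (z, \<nu>, t)) has_derivative (\<lambda>s. (0, 0, s))) (at \<rho>)"
      by (auto intro!: derivative_eq_intros)
    have sh: "smooth_at (z, \<nu>, \<rho>) ?hh"
      by (rule H.smooth_h[OF chart_admissible_imp_admissible[OF g]])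
    have "((\<lambda>t. ?hh (z, \<nu>, t)) has_derivative (\<lambda>s. dir ?hh (z, \<nu>, \<rho>) (0, 0, s))) (at \<rho>)"
      by (rule has_derivative_compose[OF line smooth_at_has_derivative[OF sh]])
    moreover have "dir ?hh (z, \<nu>, \<rho>) (0, 0, s) = 0" for s
    proof -
      have "(0, 0, s) = s *\<^sub>R (0 :: real \<times> (real^2), 0 :: real^2, 1 :: real)"
        by simp
      then show ?thesis
        using dir_h_eq_0[OF g] dir_scale[OF sh, of s "(0, 0, 1)"] by simp
    qed
    ultimately show ?thesis
      by (intro has_derivative_imp_has_field_derivative[where D = "\<lambda>s. 0"]) simp_all
  qed
  \<comment> \<open>Only the interval of positive \<rho> is used; it is connected and avoids the
    singular value 0.\<close>
  have const: "H.h z \<nu> \<rho> = H.h z \<nu> (\<rho>1 / 2)" if \<rho>: "0 < \<rho>" "\<rho> < \<rho>1" for \<rho>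
  proof -
    have "\<exists>c. \<forall>x\<in>{0<..<\<rho>1}. H.h z \<nu> x = c"
    proof (rule has_field_derivative_zero_constant)
      show "convex {0<..<\<rho>1}" by simp
      show "(H.h z \<nu> has_field_derivative 0) (at x within {0<..<\<rho>1})" if "x \<in> {0<..<\<rho>1}" for x
        using deriv[of x] that by (auto intro: has_field_derivative_at_within)
    qed
    then show ?thesis
      using \<rho> \<rho>1(1) by auto
  qed
  have F: "smooth_at (fst z, C.u z, dir C.u z (1, 0)) F"
    using smooth_F[OF jW(1)] by (simp add: C.jmap_def)
  have Fv: "F (fst z, C.u z, dir C.u z (1, 0)) = dir2 C.u z (1, 0) (1, 0)"
    using jW(2) by (simp add: F_def C.jmap_def)
  have uy: "eventually (\<lambda>z. \<forall>w. dir C.u z (0, w) = det2 w (C.n z)) (nhds z)"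
    using C.open_V z C.dir_u_y by (auto simp: eventually_nhds)
  show False
    by (rule H.blow_up[OF C.smooth_u[OF z] C.smooth_n[OF z] smooth_gG[OF z] smooth_at_isCont[OF F] Fv uy
          C.contact_chart[OF z] \<nu>' \<rho>1(1)], intro conjI, erule (1) const)
      (drule (1) \<rho>1(2), simp add: chart_admissible_def)
qed

end

text \<open>In an adapted chart (1, 0) spans \<open>D1\<close> and \<open>(0, n z)\<close> spans
  \<open>D2\<close>, so \<open>no_transverse_kernel\<close> is carried over to the fields
  \<open>X\<close> and \<open>Y\<close>.\<close>

lemma (in lewy_map) kernel_g1:
  assumes p: "p \<in> N"
  shows "dir g1 p (X p) = 0 \<or> dir g1 p (Y p) = 0"
proof -
  define \<omega> where "\<omega> = S.U1 p"
  have \<omega>: "\<omega> \<bullet> S.U1 p \<noteq> 0" "\<omega> \<noteq> 0"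
    using S.U1_neq_0[OF p] by (simp_all add: \<omega>_def)
  obtain G V U where G: "open V" "(\<omega> \<bullet> \<pi>1 p, \<pi>2 p) \<in> V" "smooth_on V G"
    "open U" "p \<in> U" "U \<subseteq> N \<inter> UNIV" "\<forall>q\<in>U. (\<omega> \<bullet> \<pi>1 q, \<pi>2 q) \<in> V \<and> G (\<omega> \<bullet> \<pi>1 q, \<pi>2 q) = q"
    "\<forall>z\<in>V. G z \<in> U \<and> \<omega> \<bullet> \<pi>1 (G z) = fst z \<and> \<pi>2 (G z) = snd z"
    by (rule S.chart[OF p \<omega>(1) open_UNIV UNIV_I])
  interpret C: fibration_chart N \<pi>1 \<pi>2 X Y \<omega> G V U
    by unfold_locales (use G \<omega>(2) in auto)
  define z where "z = C.Phi p"
  have z: "z \<in> V" "G z = p"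
    using C.Phi_in_V[OF G(5)] C.G_Phi[OF G(5)] by (simp_all add: z_def)
  obtain J W where J: "open W" "C.jmap z \<in> W" "smooth_on W J" "J (C.jmap z) = z"
    "\<forall>w\<in>W. J w \<in> V \<and> C.jmap (J w) = w"
    by (rule C.jmap_inverse[OF z(1)])
  interpret L: lewy_chart N \<pi>1 \<pi>2 X Y N' \<pi>1' \<pi>2' X' Y' f \<omega> G V U J W
    by unfold_locales (use J in auto)
  from L.no_transverse_kernel[OF z(1) J(2,4)] show ?thesis
  proof
    assume 0: "dir L.gG z (1, 0) = 0"
    obtain k where "k \<noteq> 0" "dir G z (1, 0) = k *\<^sub>R X (G z)"
      by (rule C.dir_G_X[OF z(1)])
    then show ?thesis
      using 0 by (simp add: L.dir_gG[OF z(1)] z(2) dir_scale[OF smooth_g1[OF p]])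
  next
    assume 0: "dir L.gG z (0, C.n z) = 0"
    obtain m where m: "C.n z = m *\<^sub>R S.U2 p"
      using det2_eq_0D[OF C.n_parallel_U2[OF z(1)] S.U2_neq_0[OF C.G_in_N[OF z(1)]]] z(2) by auto
    then have m0: "m \<noteq> 0"
      using C.n_neq_0[OF z(1)] by auto
    have "dir C.Phi p (Y p) = (0, S.U2 p)"
      using S.\<pi>1_Y_eq_0[OF p, of 1] by (simp add: C.dir_Phi[OF p] S.U2_def)
    then have "dir G z (0, S.U2 p) = Y p"
      using C.dir_G_Phi[OF z(1), of "Y p"] z(2) by simp
    moreover have "(0, C.n z) = m *\<^sub>R (0 :: real, S.U2 p)"
      by (simp add: m)
    ultimately have "dir G z (0, C.n z) = m *\<^sub>R Y p"
      by (simp only: dir_scale[OF C.smooth_G[OF z(1)]])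
    then show ?thesis
      using 0 m0 by (simp add: L.dir_gG[OF z(1)] z(2) dir_scale[OF smooth_g1[OF p]])
  qed
qed

section \<open>Spanning fields of the two line bundles\<close>

unbundle cross3_syntax

lemma bounded_bilinear_cross3: "bounded_bilinear cross3"
  by (rule bilinear_conv_bounded_bilinear[THEN iffD1]) (rule bilinear_cross)

text \<open>The cross product of the two rows of the derivative spans the kernel of a submersion and
  is defined on all of N at once.\<close>

definition kernel_field :: "(real^3 \<Rightarrow> real^2) \<Rightarrow> real^3 \<Rightarrow> real^3" where
  "kernel_field \<pi> p = (\<chi> j. dir \<pi> p (axis j 1) $ 1) \<times> (\<chi> j. dir \<pi> p (axis j 1) $ 2)"

lemma smooth_kernel_field: "smooth_at p \<pi> \<Longrightarrow> smooth_at p (kernel_field \<pi>)"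
  unfolding kernel_field_def[abs_def]
  by (intro smooth_at_bilinear[OF bounded_bilinear_cross3] smooth_at_vec)
    (simp_all add: smooth_at_vec_nth smooth_at_dir_const)

lemma kernel_field:
  assumes \<pi>: "smooth_at p \<pi>" "surj (dir \<pi> p)"
  shows "dir \<pi> p w = 0 \<longleftrightarrow> (\<exists>k. w = k *\<^sub>R kernel_field \<pi> p)" "kernel_field \<pi> p \<noteq> 0"
proof -
  define r where "r i = (\<chi> j. dir \<pi> p (axis j 1) $ i)" for i
  have r: "dir \<pi> p w $ i = r i \<bullet> w" for w i
  proof -
    have "w = (\<Sum>j\<in>UNIV. w $ j *\<^sub>R axis j 1)"
      by (simp add: vec_eq_iff axis_def if_distrib cong: if_cong)
    then have "dir \<pi> p w = (\<Sum>j\<in>UNIV. w $ j *\<^sub>R dir \<pi> p (axis j 1))"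
      using linear_sum[OF linear_dir[OF \<pi>(1)], of "\<lambda>j. w $ j *\<^sub>R axis j 1" UNIV] by (simp add: dir_scale[OF \<pi>(1)])
    then show ?thesis
      by (simp add: r_def inner_vec_def mult.commute)
  qed
  have k: "kernel_field \<pi> p = r 1 \<times> r 2"
    by (simp add: kernel_field_def r_def)
  obtain a b where ab: "dir \<pi> p a = axis 1 1" "dir \<pi> p b = axis 2 1"
    using surjD[OF \<pi>(2), of "axis 1 1"] surjD[OF \<pi>(2), of "axis 2 1"] by auto
  have "r 1 \<bullet> a = 1" "r 2 \<bullet> a = 0" "r 1 \<bullet> b = 0" "r 2 \<bullet> b = 1"
    by (simp_all add: r[symmetric] ab axis_def)
  then have "(r 1 \<times> r 2) \<bullet> (a \<times> b) = 1"
    by (simp add: dot_cross)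
  then show n0: "kernel_field \<pi> p \<noteq> 0"
    unfolding k by auto
  show "dir \<pi> p w = 0 \<longleftrightarrow> (\<exists>k. w = k *\<^sub>R kernel_field \<pi> p)"
  proof
    assume "dir \<pi> p w = 0"
    then have "r 1 \<bullet> w = 0" "r 2 \<bullet> w = 0"
      by (simp_all add: r[symmetric])
    then have "kernel_field \<pi> p \<times> w = 0"
      using Lagrange[of w "r 1" "r 2"] cross_skew[of w] unfolding k by (simp add: inner_commute)
    then have "collinear {0, kernel_field \<pi> p, w}"
      by (simp add: cross_eq_0)
    then show "\<exists>k. w = k *\<^sub>R kernel_field \<pi> p"
      using n0 by (auto simp: collinear_lemma intro: exI[of _ 0])
  next
    assume "\<exists>k. w = k *\<^sub>R kernel_field \<pi> p"
    then show "dir \<pi> p w = 0"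
      by (auto simp: vec_eq_iff[of "dir \<pi> p _"] r k forall_2 dot_cross_self)
  qed
qed

text \<open>The bracket is given in an arbitrary frame A, B of the plane, whose projections stay
  parallel to L, the projection of \<open>X\<close>. Differentiating this for A along B and for B
  along A and subtracting expresses the component of the bracket across L by derivatives of L. If L
  did not rotate along \<open>Y\<close>, the bracket would stay in the plane.\<close>

lemma contact_distribution_rotates:
  fixes \<pi> :: "real^3 \<Rightarrow> real^2"
  assumes contact: "contact_distribution N C" and p: "p \<in> N"
    and \<pi>: "\<And>q. q \<in> N \<Longrightarrow> smooth_at q \<pi>" "surj (dir \<pi> p)"
    and X: "smooth_at p X" "dir \<pi> p (X p) \<noteq> 0"
    and Y: "\<And>q k. q \<in> N \<Longrightarrow> dir \<pi> q (k *\<^sub>R Y q) = 0"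
    and C: "\<And>q. q \<in> N \<Longrightarrow> C q = {w. \<exists>a b. w = a *\<^sub>R X q + b *\<^sub>R Y q}"
  shows "det2 (dir \<pi> p (X p)) (dir (\<lambda>q. dir \<pi> q (X q)) p (Y p)) \<noteq> 0"
proof
  define L where "L q = dir \<pi> q (X q)" for q
  assume "det2 (dir \<pi> p (X p)) (dir (\<lambda>q. dir \<pi> q (X q)) p (Y p)) = 0"
  then have 0: "det2 (L p) (dir L p (Y p)) = 0"
    by (simp add: L_def[abs_def])
  have L: "smooth_at p L"
    unfolding L_def[abs_def] by (intro smooth_at_dir \<pi>(1) p smooth_at_ident X)
  obtain O' A B where fr: "open O'" "p \<in> O'" "O' \<subseteq> N" "smooth_on O' A" "smooth_on O' B"
    "\<And>q. q \<in> O' \<Longrightarrow> C q = span {A q, B q} \<and> span {A q, B q, lie_bracket A B q} = UNIV"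
    using contact p unfolding contact_distribution_def by meson
  have key: "det2 (L p) (dir2 \<pi> p (A p) w + dir \<pi> p (dir A p w)) + det2 (dir L p w) (dir \<pi> p (A p)) = 0"
    if A: "smooth_on O' A" "\<And>q. q \<in> O' \<Longrightarrow> A q \<in> C q" for A w
  proof -
    have sA: "smooth_at p A"
      using smooth_on_imp_smooth_at[OF A(1) fr(1,2)] .
    have s: "smooth_at p (\<lambda>q. dir \<pi> q (A q))"
      by (intro smooth_at_dir \<pi>(1) p smooth_at_ident sA)
    have "det2 (L q) (dir \<pi> q (A q)) = 0" if q: "q \<in> O'" for q
    proof -
      have qN: "q \<in> N"
        using q fr(3) by blast
      obtain a b where "A q = a *\<^sub>R X q + b *\<^sub>R Y q"
        using A(2)[OF q] C[OF qN] by blast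
      then show ?thesis
        by (simp add: dir_add[OF \<pi>(1)[OF qN]] dir_scale[OF \<pi>(1)[OF qN], of a] Y[OF qN] L_def det2.scaleR_right)
    qed
    then have "eventually (\<lambda>q. det2 (L q) (dir \<pi> q (A q)) = 0) (nhds p)"
      using fr(1,2) by (auto simp: eventually_nhds)
    from dir_cong[OF smooth_at_det2[OF L s] this]
    have "dir (\<lambda>q. det2 (L q) (dir \<pi> q (A q))) p w = 0"
      by simp
    then show ?thesis
      using dir_det2[OF L s, of w] dir_dir_comp[OF \<pi>(1)[OF p] smooth_at_ident sA, of w]
      by (simp add: dir_ident)
  qed
  have AB: "A q \<in> C q" "B q \<in> C q" if "q \<in> O'" for q
    using fr(6)[OF that] by (auto intro: span_base)
  obtain a b where A: "A p = a *\<^sub>R X p + b *\<^sub>R Y p"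
    using AB(1)[OF fr(2)] C[OF p] by blast
  obtain c d where B: "B p = c *\<^sub>R X p + d *\<^sub>R Y p"
    using AB(2)[OF fr(2)] C[OF p] by blast
  have \<pi>A: "dir \<pi> p (A p) = a *\<^sub>R L p" and \<pi>B: "dir \<pi> p (B p) = c *\<^sub>R L p"
    by (simp_all add: A B dir_add[OF \<pi>(1)[OF p]] dir_scale[OF \<pi>(1)[OF p], of _ "X p"] Y[OF p] L_def)
  have L0: "det2 (dir L p (Y p)) (L p) = 0"
    using 0 det2_swap[of "L p"] by simp
  \<comment> \<open>The contributions of \<open>X\<close> cancel by antisymmetry in A and B, and
    those of \<open>Y\<close> vanish by \<open>L0\<close>.\<close>
  have "det2 (dir L p (B p)) (a *\<^sub>R L p) - det2 (dir L p (A p)) (c *\<^sub>R L p) = 0"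
    by (simp add: A B dir_add[OF L] dir_scale[OF L] det2.add_left det2.scaleR_left det2.scaleR_right L0)
  with key[OF fr(4) AB(1), of "B p"] key[OF fr(5) AB(2), of "A p"]
  have "det2 (L p) (dir \<pi> p (dir B p (A p))) - det2 (L p) (dir \<pi> p (dir A p (B p))) = 0"
    unfolding \<pi>A \<pi>B dir2_commute[OF \<pi>(1)[OF p], of "B p" "A p"] by (simp add: det2.add_right)
  then have lb: "det2 (L p) (dir \<pi> p (lie_bracket A B p)) = 0"
    by (simp add: lie_bracket_def dir_diff[OF \<pi>(1)[OF p]] det2.diff_right)
  have "subspace {w. det2 (L p) (dir \<pi> p w) = 0}"
    by (auto simp: subspace_def dir_add[OF \<pi>(1)[OF p]] dir_scale[OF \<pi>(1)[OF p]] dir_zero[OF \<pi>(1)[OF p]]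
        det2.add_right det2.scaleR_right det2.zero_right)
  then have "span {A p, B p, lie_bracket A B p} \<subseteq> {w. det2 (L p) (dir \<pi> p w) = 0}"
    by (intro span_minimal) (auto simp: \<pi>A \<pi>B lb det2.scaleR_right)
  then have "det2 (L p) (dir \<pi> p w) = 0" for w
    using fr(6)[OF fr(2)] by auto
  then have "det2 (L p) w = 0" for w
    using surjD[OF \<pi>(2), of w] by auto
  moreover obtain w where "det2 (L p) w \<noteq> 0"
    using det2_nondegenerate[of "L p"] X(2) by (auto simp: L_def)
  ultimately show False
    by blast
qed

lemma para_CR_double_fibration:
  assumes cr: "para_CR N D1 D2" and l1: "leaf_projection N D2 \<pi>1" and l2: "leaf_projection N D1 \<pi>2"
  obtains X Y where "double_fibration N \<pi>1 \<pi>2 X Y"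
    "\<forall>p\<in>N. D1 p = span {X p}" "\<forall>p\<in>N. D2 p = span {Y p}"
    "\<forall>p\<in>N. dist_sum D1 D2 p = {w. \<exists>a b. w = a *\<^sub>R X p + b *\<^sub>R Y p}"
proof -
  define X where "X = kernel_field \<pi>2"
  define Y where "Y = kernel_field \<pi>1"
  have N: "open N" "\<And>p. p \<in> N \<Longrightarrow> D1 p \<inter> D2 p = {0}" "contact_distribution N (dist_sum D1 D2)"
    using cr by (auto simp: para_CR_def)
  have s: "smooth_at p \<pi>1" "smooth_at p \<pi>2" if "p \<in> N" for p
    using l1 l2 that smooth_on_imp_smooth_at[OF _ N(1)] by (auto simp: leaf_projection_def)
  have sj: "surj (dir \<pi>1 p)" "surj (dir \<pi>2 p)" if "p \<in> N" for p
    using l1 l2 that by (auto simp: leaf_projection_def)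
  have D: "{v. dir \<pi>1 p v = 0} = D2 p" "{v. dir \<pi>2 p v = 0} = D1 p" if "p \<in> N" for p
    using l1 l2 that by (auto simp: leaf_projection_def)
  have k1: "dir \<pi>1 p w = 0 \<longleftrightarrow> (\<exists>k. w = k *\<^sub>R Y p)" and k2: "dir \<pi>2 p w = 0 \<longleftrightarrow> (\<exists>k. w = k *\<^sub>R X p)"
    and X0: "X p \<noteq> 0" and Y0: "Y p \<noteq> 0" if "p \<in> N" for p w
    using kernel_field[OF s(1)[OF that] sj(1)[OF that]] kernel_field[OF s(2)[OF that] sj(2)[OF that]]
    by (simp_all add: X_def Y_def)
  have D1: "D1 p = span {X p}" and D2: "D2 p = span {Y p}" if "p \<in> N" for p
    using D[OF that] k1[OF that] k2[OF that] by (simp_all add: span_singleton full_SetCompr_eq[symmetric])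
  have S: "dist_sum D1 D2 p = {w. \<exists>a b. w = a *\<^sub>R X p + b *\<^sub>R Y p}" if "p \<in> N" for p
    unfolding dist_sum_def D1[OF that] D2[OF that] span_singleton by auto
  have S': "dist_sum D1 D2 p = {w. \<exists>a b. w = a *\<^sub>R Y p + b *\<^sub>R X p}" if "p \<in> N" for p
    unfolding S[OF that] by (auto; metis add.commute)
  have sX: "smooth_at p X" and sY: "smooth_at p Y" if "p \<in> N" for p
    unfolding X_def Y_def by (intro smooth_kernel_field s that)+
  have \<pi>X: "dir \<pi>1 p (X p) \<noteq> 0" and \<pi>Y: "dir \<pi>2 p (Y p) \<noteq> 0" if "p \<in> N" for p
  proof -
    have "X p \<in> D1 p" "Y p \<in> D2 p"
      using D1[OF that] D2[OF that] by (simp_all add: span_base)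
    then have "X p \<notin> D2 p" "Y p \<notin> D1 p"
      using N(2)[OF that] X0[OF that] Y0[OF that] by auto
    then show "dir \<pi>1 p (X p) \<noteq> 0" "dir \<pi>2 p (Y p) \<noteq> 0"
      using D[OF that] by auto
  qed
  have "double_fibration N \<pi>1 \<pi>2 X Y"
  proof
    fix p assume p: "p \<in> N"
    show "det2 (dir \<pi>1 p (X p)) (dir (\<lambda>q. dir \<pi>1 q (X q)) p (Y p)) \<noteq> 0"
      by (rule contact_distribution_rotates[OF N(3) p s(1) sj(1)[OF p] sX[OF p] \<pi>X[OF p] _ S]) (use k1 in auto)
    show "det2 (dir \<pi>2 p (Y p)) (dir (\<lambda>q. dir \<pi>2 q (Y q)) p (X p)) \<noteq> 0"
      by (rule contact_distribution_rotates[OF N(3) p s(2) sj(2)[OF p] sY[OF p] \<pi>Y[OF p] _ S']) (use k2 in auto)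
  qed (use N(1) s sX sY k1 k2 \<pi>X \<pi>Y in auto)
  then show thesis
    by (rule that) (use D1 D2 S in auto)
qed

lemma PT_minus_cong: "(\<And>p. p \<in> N \<Longrightarrow> C p = C' p) \<Longrightarrow> PT_minus N C = PT_minus N C'"
  unfolding PT_minus_def by blast

lemma image_span_line:
  assumes "linear L" "L x = k *\<^sub>R y" "L x \<noteq> 0"
  shows "L ` span {x} = span {y}"
proof -
  have "k \<noteq> 0"
    using assms by auto
  have "L ` span {x} = span {k *\<^sub>R y}"
    using linear_span_image[OF assms(1), of "{x}"] assms(2) by simp
  also have "\<dots> = span {y}"
    using \<open>k \<noteq> 0\<close> by (auto simp: span_singleton image_def) (metis nonzero_divide_eq_eq)
  finally show ?thesis .
qed

section \<open>The two alternatives for the differential of f\<close>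

context lewy_map
begin

text \<open>Lewy curves and contact planes are symmetric in the two fibrations, so everything proved
  about \<open>\<pi>1'\<close> holds for \<open>\<pi>2'\<close>.\<close>

lemma swap_target: "lewy_map N \<pi>1 \<pi>2 X Y N' \<pi>2' \<pi>1' Y' X' f"
proof -
  interpret R: double_fibration N' \<pi>2' \<pi>1' Y' X' by (rule T.swap)
  have "R.contact_plane = T.contact_plane"
    by (auto simp: fun_eq_iff R.contact_plane_def T.contact_plane_def) (metis add.commute)+
  then show ?thesis
    by unfold_locales
      (use smooth_f f_in bij_f Q QX Q' QX' maps in \<open>simp_all add: lewy_curves_swap[of N' \<pi>2' \<pi>1']\<close>)
qed

text \<open>\<open>kernel_g1\<close> for both target projections says that one of \<open>X\<close>,
  \<open>Y\<close> goes to \<open>D2'\<close> and one of them to \<open>D1'\<close>. No nonzero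
  vector is killed by both projections, so the two choices are complementary.\<close>

lemma dichotomy:
  assumes p: "p \<in> N"
  shows "dir g1 p (X p) \<noteq> 0 \<Longrightarrow> (\<exists>k. dir f p (X p) = k *\<^sub>R X' (f p)) \<and> (\<exists>k. dir f p (Y p) = k *\<^sub>R Y' (f p))"
    and "dir g1 p (Y p) \<noteq> 0 \<Longrightarrow> (\<exists>k. dir f p (X p) = k *\<^sub>R Y' (f p)) \<and> (\<exists>k. dir f p (Y p) = k *\<^sub>R X' (f p))"
    and "dir g1 p (X p) \<noteq> 0 \<or> dir g1 p (Y p) \<noteq> 0"
    and "dir f p (X p) \<noteq> 0" "dir f p (Y p) \<noteq> 0"
proof -
  interpret R: lewy_map N \<pi>1 \<pi>2 X Y N' \<pi>2' \<pi>1' Y' X' f by (rule swap_target)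
  note fp = f_in[OF p]
  have inj: "dir f p w = 0 \<Longrightarrow> w = 0" for w
    using injD[OF bij_is_inj[OF bij_f[OF p]], of w 0] dir_zero[OF smooth_f[OF p]] by simp
  have "X p \<noteq> 0" "Y p \<noteq> 0"
    using S.\<pi>1_X[OF p] S.\<pi>2_Y[OF p] dir_zero[OF S.smooth_\<pi>1[OF p]] dir_zero[OF S.smooth_\<pi>2[OF p]] by auto
  then show f0: "dir f p (X p) \<noteq> 0" "dir f p (Y p) \<noteq> 0"
    using inj by blast+
  have g1: "dir g1 p w = 0 \<longleftrightarrow> (\<exists>k. dir f p w = k *\<^sub>R Y' (f p))" for w
    by (simp add: dir_g1[OF p] T.ker_\<pi>1[OF fp])
  have g2: "dir R.g1 p w = 0 \<longleftrightarrow> (\<exists>k. dir f p w = k *\<^sub>R X' (f p))" for w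
    by (simp add: R.dir_g1[OF p] T.ker_\<pi>2[OF fp])
  have excl: "dir f p w = 0" if w: "dir g1 p w = 0" "dir R.g1 p w = 0" for w
  proof -
    obtain k l where kl: "dir f p w = k *\<^sub>R Y' (f p)" "dir f p w = l *\<^sub>R X' (f p)"
      using w[unfolded g1 g2] by blast
    have "k *\<^sub>R dir \<pi>2' (f p) (Y' (f p)) = dir \<pi>2' (f p) (dir f p w)"
      unfolding kl(1) by (rule dir_scale[OF T.smooth_\<pi>2[OF fp], symmetric])
    also have "\<dots> = 0"
      unfolding kl(2) by (simp add: T.ker_\<pi>2[OF fp])
    finally show ?thesis
      using T.\<pi>2_Y[OF fp] kl(1) by simp
  qed
  have k1: "dir g1 p (X p) = 0 \<or> dir g1 p (Y p) = 0"
    by (rule kernel_g1[OF p])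
  have k2: "dir R.g1 p (X p) = 0 \<or> dir R.g1 p (Y p) = 0"
    by (rule R.kernel_g1[OF p])
  show "(\<exists>k. dir f p (X p) = k *\<^sub>R X' (f p)) \<and> (\<exists>k. dir f p (Y p) = k *\<^sub>R Y' (f p))" if "dir g1 p (X p) \<noteq> 0"
    using that k1 k2 excl[of "Y p"] f0 g1 g2 by blast
  show "(\<exists>k. dir f p (X p) = k *\<^sub>R Y' (f p)) \<and> (\<exists>k. dir f p (Y p) = k *\<^sub>R X' (f p))" if "dir g1 p (Y p) \<noteq> 0"
    using that k1 k2 excl[of "X p"] f0 g1 g2 by blast
  show "dir g1 p (X p) \<noteq> 0 \<or> dir g1 p (Y p) \<noteq> 0"
    using k2 excl f0 by blast
qed

end

theorem corollary4p12:
  fixes N N' :: "(real^3) set"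
    and D1 D2 D1' D2' :: "real^3 \<Rightarrow> (real^3) set"
    and \<pi>1 \<pi>2 \<pi>1' \<pi>2' :: "real^3 \<Rightarrow> real^2"
    and f :: "real^3 \<Rightarrow> real^3"
  assumes "para_CR N D1 D2"
    and "leaf_projection N D2 \<pi>1" and "leaf_projection N D1 \<pi>2"
    and "lifts_foliate N (dist_sum D1 D2) (lewy_curves N \<pi>1 \<pi>2)"
    and "para_CR N' D1' D2'"
    and "leaf_projection N' D2' \<pi>1'" and "leaf_projection N' D1' \<pi>2'"
    and "lifts_foliate N' (dist_sum D1' D2') (lewy_curves N' \<pi>1' \<pi>2')"
    and "local_diffeo N N' f"
    and "maps_path_geometry f (lewy_curves N \<pi>1 \<pi>2) (lewy_curves N' \<pi>1' \<pi>2')"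
  shows "\<forall>p\<in>N. \<exists>U. open U \<and> p \<in> U \<and> U \<subseteq> N \<and>
           (pushes_to U f D1 D1' \<and> pushes_to U f D2 D2' \<or>
            pushes_to U f D1 D2' \<and> pushes_to U f D2 D1')"
proof -
  obtain X Y where S: "double_fibration N \<pi>1 \<pi>2 X Y" "\<forall>p\<in>N. D1 p = span {X p}"
    "\<forall>p\<in>N. D2 p = span {Y p}"
    "\<forall>p\<in>N. dist_sum D1 D2 p = {w. \<exists>a b. w = a *\<^sub>R X p + b *\<^sub>R Y p}"
    by (rule para_CR_double_fibration[OF assms(1-3)])
  obtain X' Y' where T: "double_fibration N' \<pi>1' \<pi>2' X' Y'" "\<forall>p\<in>N'. D1' p = span {X' p}"
    "\<forall>p\<in>N'. D2' p = span {Y' p}"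
    "\<forall>p\<in>N'. dist_sum D1' D2' p = {w. \<exists>a b. w = a *\<^sub>R X' p + b *\<^sub>R Y' p}"
    by (rule para_CR_double_fibration[OF assms(5-7)])
  interpret S: double_fibration N \<pi>1 \<pi>2 X Y by (rule S(1))
  interpret T: double_fibration N' \<pi>1' \<pi>2' X' Y' by (rule T(1))
  have PT: "PT_minus N (dist_sum D1 D2) = PT_minus N S.contact_plane"
    "PT_minus N' (dist_sum D1' D2') = PT_minus N' T.contact_plane"
    by (rule PT_minus_cong, simp add: S(4) T(4) S.contact_plane_def T.contact_plane_def)+
  have f: "smooth_at p f" "f p \<in> N'" "bij (dir f p)" if "p \<in> N" for p
    using assms(9) that smooth_on_imp_smooth_at[OF _ S.open_N] by (auto simp: local_diffeo_def)
  interpret M: lewy_map N \<pi>1 \<pi>2 X Y N' \<pi>1' \<pi>2' X' Y' f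
    by unfold_locales (use f assms(4,8,10) in \<open>auto simp: lifts_foliate_def PT\<close>)
  \<comment> \<open>Each alternative is selected by the nonvanishing of a continuous field, so it
    persists on an open neighbourhood.\<close>
  define A where "A Z = {p \<in> N. dir M.g1 p (Z p) \<noteq> 0}" for Z :: "real^3 \<Rightarrow> real^3"
  have open_A: "open (A Z)" if "\<And>p. p \<in> N \<Longrightarrow> smooth_at p Z" for Z
  proof -
    have "continuous_on N (\<lambda>p. dir M.g1 p (Z p))"
      by (intro continuous_at_imp_continuous_on ballI smooth_at_isCont smooth_at_dir M.smooth_g1 smooth_at_ident that)
    from continuous_open_preimage[OF this S.open_N open_Compl[OF closed_singleton, of 0]]
    have "open (N \<inter> (\<lambda>p. dir M.g1 p (Z p)) -` (- {0}))" .
    moreover have "N \<inter> (\<lambda>p. dir M.g1 p (Z p)) -` (- {0}) = A Z"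
      by (auto simp: A_def)
    ultimately show ?thesis by simp
  qed
  have push: "dir f q ` span {x} = span {y}" if "q \<in> N" "\<exists>k. dir f q x = k *\<^sub>R y" "dir f q x \<noteq> 0" for q x y
    using that image_span_line[OF linear_dir[OF f(1)]] by blast
  show ?thesis
  proof
    fix p assume p: "p \<in> N"
    from M.dichotomy(3)[OF p] show "\<exists>U. open U \<and> p \<in> U \<and> U \<subseteq> N \<and>
           (pushes_to U f D1 D1' \<and> pushes_to U f D2 D2' \<or> pushes_to U f D1 D2' \<and> pushes_to U f D2 D1')"
    proof
      assume "dir M.g1 p (X p) \<noteq> 0"
      then have "p \<in> A X"
        using p by (simp add: A_def)
      moreover have "pushes_to (A X) f D1 D1'" "pushes_to (A X) f D2 D2'"
        unfolding pushes_to_def A_def using M.dichotomy(1,4,5) f(2) by (auto simp: S T push)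
      ultimately show ?thesis
        using open_A[OF S.smooth_X] by (intro exI[of _ "A X"]) (auto simp: A_def)
    next
      assume "dir M.g1 p (Y p) \<noteq> 0"
      then have "p \<in> A Y"
        using p by (simp add: A_def)
      moreover have "pushes_to (A Y) f D1 D2'" "pushes_to (A Y) f D2 D1'"
        unfolding pushes_to_def A_def using M.dichotomy(2,4,5) f(2) by (auto simp: S T push)
      ultimately show ?thesis
        using open_A[OF S.smooth_Y] by (intro exI[of _ "A Y"]) (auto simp: A_def)
    qed
  qed
qed

end
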